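(* Let $(\mathfrak{F},F)$ be a structure category such that $\mathfrak{F}$ is a groupoid. Then an $\mathfrak{F}$-stratified fibre bundle $X \to \bar X$ is an $\mathfrak{F}$-bundle over $\bar X$. Conversely, given a stratified space $\bar X$ and an $\mathfrak{F}$-bundle $X$ over $\bar X$, then $X$ is an $\mathfrak{F}$-stratified fibre bundle. In particular, an $\mathfrak{F}$-complex $X\to\bar X$ is an $\mathfrak{F}$-bundle over $\bar X$ and, given a CW-complex $\bar X$ and an $\mathfrak{F}$-bundle $X$ over $\bar X$, then $X$ is $\mathfrak{F}$-isomorphic to an $\mathfrak{F}$-complex.
   Context: A groupoid is a category in which all morphisms are isomorphisms. Structure category: a small category $\mathfrak{F}$ with a functor $F\colon\mathfrak{F}\to\mathbf{Top}$ (fibre functor) such that $F(V)$ is locally compact, second-countable and Hausdorff for each object $V$; one often writes $V$ for $F(V)$. $\mathfrak{F}$-family: a space $X$ with a map $p_X\colon X\to\bar X$ (projection to the base space) and, for every $b\in\bar X$, an object $X_b$ of $\mathfrak{F}$ and a chosen homeomorphism (chart) $\Phi_b\colon p_X^{-1}(b)\approx F(X_b)$. An $\mathfrak{F}$-map $X\to Y$ is a pair of continuous maps $f\colon X\to Y$, $\bar f\colon\bar X\to\bar Y$ with $p_Yf=\bar fp_X$ such that for every $b\in\bar X$ the composite $\Phi_{\bar f b}\circ f|_{p_X^{-1}(b)}\circ\Phi_b^{-1}\colon F(X_b)\to F(Y_{\bar fb})$ equals $F(\phi)$ for some morphism $\phi\colon X_b\to Y_{\bar f b}$ of $\mathfrak{F}$.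 These form the category $\mathfrak{F}$-$\mathbf{Top}$; $\mathfrak{F}$-isomorphisms are its isomorphisms. For a family $X$ and a space $Z$, $X\times Z\to\bar X\times Z$ is a family with $(X\times Z)_{(b,z)}=X_b$. Pull-back: for a family $Y$ and a map $\bar f\colon\bar X\to\bar Y$, $\bar f^*Y=\bar X\times_{\bar Y}Y\to\bar X$ with $(\bar f^*Y)_b=Y_{\bar f b}$ and induced charts. The restriction $Y|U$ for $U\subset\bar Y$ is the pull-back along the inclusion. $\mathfrak{F}$-bundle: a family $X$ such that each $b\in\bar X$ has a neighbourhood $U$ with $X|U$ isomorphic in $\mathfrak{F}$-$\mathbf{Top}$ to a product family $U\times F(V)\to U$ (charts given by projection), for some object $V$. Push-outs: a closed inclusion is an $\mathfrak{F}$-map $i\colon A\to Y$ such that $\bar i$ is the inclusion of a closed subspace and $A=\bar i^*Y$. Push-outs in $\mathfrak{F}$-$\mathbf{Top}$ of $X\leftarrow A\xrightarrow{i}Y$ with $i$ a closed inclusion are formed by the push-outs in $\mathbf{Top}$ of total spaces and of base spaces. $\lim$ of an increasing sequence denotes the colimit. $\mathfrak{F}$-complex: an $\mathfrak{F}$-set $Z$ is a disjoint union of families $F(V)\to *$ (base discrete). $X$ is obtained from a family $D$ by attaching $n$-cells if $X=D\cup_f(Z\times D^n)$ is the push-out in $\mathfrak{F}$-$\mathbf{Top}$ of an $\mathfrak{F}$-map $f\colon Z\times S^{n-1}\to D$ and the inclusion $Z\times S^{n-1}\to Z\times D^n$, with $Z$ an $\mathfrak{F}$-set. A relative $\mathfrak{F}$-complex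 $(X,D)$ is a family $X$ with a filtration $D=X_{-1}\subset X_0\subset X_1\subset\dots\subset X$ by families such that $X_n$ is obtained from $X_{n-1}$ by attaching $n$-cells ($n\ge0$) and $X=\lim_n X_n$. An $\mathfrak{F}$-complex is the case $D=\emptyset$. Stratified space: a CW-pair is a pair homeomorphic to (CW-complex, subcomplex); a CW-space is a space homeomorphic to a CW-complex. A stratified space is a space $X$ with a filtration $X_0\subset X_1\subset\dots\subset\lim_{n}X_n=X$, where $X_0$ is a CW-space, and for every $i\ge1$ a given CW-pair $(M_i,A_i)$ and map $h_i\colon A_i\to X_{i-1}$ such that $X_i=X_{i-1}\cup_{h_i}M_i$ is the push-out. The $X_i\smallsetminus X_{i-1}$ are the strata. It is finite if the number of non-empty strata is finite. It is a stratified CW-complex if all attaching maps $h_i$ are cellular; a stratified space that is not finite is always assumed to be a stratified CW-complex. $\mathfrak{F}$-stratified fibre bundle: a stratified space $\bar X$ (with CW-pairs $(\bar M_i,\bar A_i)$, space $\bar X_0$ and attaching maps $\bar h_i$) together with an $\mathfrak{F}$-family $X\to\bar X$ such that, with $X_i=X|\bar X_i$: $X_0\to\bar X_0$ is an $\mathfrak{F}$-bundle; for $i\ge1$ there are an $\mathfrak{F}$-bundle $M_i\to\bar M_i$ with $A_i=M_i|\bar A_i$ and an $\mathfrak{F}$-map $h_i\colon A_i\to X_{i-1}$ over $\bar h_i$ such that $X_i=X_{i-1}\cup_{h_i}M_i$ is the push-out of $\mathfrak{F}$-maps; and $X=\lim_{i}X_i$. *)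

theory Defs
  imports "HOL-Analysis.Analysis"
begin

text \<open>Spaces are abstract topologies (type \<open>'a topology\<close>); functions between them are only
  relevant on the topspace.\<close>

section \<open>Push-outs, sequential colimits, CW-complexes\<close>

text \<open>\<open>P\<close> with the maps \<open>g\<close>, \<open>k\<close> is the push-out in \<open>Top\<close> of \<open>X \<leftarrow> A \<rightarrow> Y\<close> (maps \<open>f\<close>, \<open>i\<close>):
  the quotient of the disjoint union of \<open>X\<close> and \<open>Y\<close> by the equivalence relation generated by
  \<open>f a \<sim> i a\<close>. The universal property is \<open>top_pushout_universal\<close> below.\<close>

definition glue_rel :: "'a set \<Rightarrow> ('a \<Rightarrow> 'x) \<Rightarrow> ('a \<Rightarrow> 'y) \<Rightarrow> ('x + 'y) rel" where
  "glue_rel A f i = {(Inl (f a), Inr (i a)) | a. a \<in> A}"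

definition top_pushout ::
  "'a topology \<Rightarrow> 'x topology \<Rightarrow> 'y topology \<Rightarrow> ('a \<Rightarrow> 'x) \<Rightarrow> ('a \<Rightarrow> 'y)
    \<Rightarrow> ('x \<Rightarrow> 'p) \<Rightarrow> ('y \<Rightarrow> 'p) \<Rightarrow> 'p topology \<Rightarrow> bool" where
  "top_pushout A X Y f i g k P \<longleftrightarrow>
     continuous_map A X f \<and> continuous_map A Y i \<and>
     g ` topspace X \<union> k ` topspace Y = topspace P \<and>
     (\<forall>U \<subseteq> topspace P. openin P U \<longleftrightarrow>
        openin X {x \<in> topspace X. g x \<in> U} \<and> openin Y {y \<in> topspace Y. k y \<in> U}) \<and>
     (\<forall>u \<in> topspace X <+> topspace Y. \<forall>v \<in> topspace X <+> topspace Y.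
        case_sum g k u = case_sum g k v \<longleftrightarrow>
        (u, v) \<in> (glue_rel (topspace A) f i \<union> (glue_rel (topspace A) f i)\<inverse>)\<^sup>*)"

lemma top_pushout_maps:
  assumes P: "top_pushout A X Y f i g k P"
  shows "continuous_map X P g" and "continuous_map Y P k"
    and "\<And>a. a \<in> topspace A \<Longrightarrow> g (f a) = k (i a)"
proof -
  have opn: "openin P U \<longleftrightarrow>
        openin X {x \<in> topspace X. g x \<in> U} \<and> openin Y {y \<in> topspace Y. k y \<in> U}"
    if "U \<subseteq> topspace P" for U using P that by (auto simp: top_pushout_def)
  have gP: "g x \<in> topspace P" if "x \<in> topspace X" for x using P that by (auto simp: top_pushout_def)
  have kP: "k x \<in> topspace P" if "x \<in> topspace Y" for x using P that by (auto simp: top_pushout_def)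
  show "continuous_map X P g" "continuous_map Y P k"
    using opn openin_subset gP kP by (auto simp: continuous_map_def)
  show "g (f a) = k (i a)" if a: "a \<in> topspace A" for a
  proof -
    have "Inl (f a) \<in> topspace X <+> topspace Y" "Inr (i a) \<in> topspace X <+> topspace Y"
      using P a by (auto simp: top_pushout_def continuous_map_def)
    moreover have "(Inl (f a), Inr (i a))
        \<in> (glue_rel (topspace A) f i \<union> (glue_rel (topspace A) f i)\<inverse>)\<^sup>*"
      using a by (intro r_into_rtrancl) (auto simp: glue_rel_def)
    ultimately have "case_sum g k (Inl (f a)) = case_sum g k (Inr (i a))"
      using P unfolding top_pushout_def by blast
    then show ?thesis by simp
  qed
qed

lemma top_pushout_universal:
  assumes P: "top_pushout A X Y f i g k P"
    and p: "continuous_map X T p" and q: "continuous_map Y T q"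
    and pq: "\<And>a. a \<in> topspace A \<Longrightarrow> p (f a) = q (i a)"
  shows "\<exists>u. continuous_map P T u \<and> (\<forall>x\<in>topspace X. u (g x) = p x) \<and> (\<forall>y\<in>topspace Y. u (k y) = q y)"
proof -
  let ?D = "topspace X <+> topspace Y" and ?gk = "case_sum g k" and ?pq = "case_sum p q"
  let ?G = "glue_rel (topspace A) f i"
  have opn: "openin P U \<longleftrightarrow>
        openin X {x \<in> topspace X. g x \<in> U} \<and> openin Y {y \<in> topspace Y. k y \<in> U}"
    if "U \<subseteq> topspace P" for U using P that by (auto simp: top_pushout_def)
  have rel: "?gk u = ?gk v \<longleftrightarrow> (u, v) \<in> (?G \<union> ?G\<inverse>)\<^sup>*" if "u \<in> ?D" "v \<in> ?D" for u v
    using P that unfolding top_pushout_def by blast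
  have gP: "g x \<in> topspace P" if "x \<in> topspace X" for x using P that by (auto simp: top_pushout_def)
  have kP: "k x \<in> topspace P" if "x \<in> topspace Y" for x using P that by (auto simp: top_pushout_def)
  have step: "?pq u = ?pq v" if "(u, v) \<in> (?G \<union> ?G\<inverse>)\<^sup>*" for u v
    using that by (induction rule: rtrancl_induct) (auto simp: glue_rel_def pq)
  define u where "u z = ?pq (SOME d. d \<in> ?D \<and> ?gk d = z)" for z
  have u: "u (?gk d) = ?pq d" if "d \<in> ?D" for d
  proof -
    define e where "e = (SOME e. e \<in> ?D \<and> ?gk e = ?gk d)"
    have "e \<in> ?D \<and> ?gk e = ?gk d"
      unfolding e_def by (rule someI[of _ d]) (simp add: that)
    then have "(e, d) \<in> (?G \<union> ?G\<inverse>)\<^sup>*"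
      using rel[of e d] that by (elim conjE) (rule iffD1, assumption+)
    then have "?pq e = ?pq d" by (rule step)
    then show ?thesis by (simp only: u_def e_def)
  qed
  have ug: "u (g x) = p x" if "x \<in> topspace X" for x using u[of "Inl x"] that by auto
  have uk: "u (k x) = q x" if "x \<in> topspace Y" for x using u[of "Inr x"] that by auto
  have "continuous_map P T u"
    unfolding continuous_map_def
  proof (intro conjI funcsetI allI impI)
    fix z assume "z \<in> topspace P"
    then have "z \<in> g ` topspace X \<union> k ` topspace Y"
      using P by (simp add: top_pushout_def)
    then consider x where "x \<in> topspace X" "z = g x" | y where "y \<in> topspace Y" "z = k y"
      by blast
    then show "u z \<in> topspace T"
      using ug uk p q by cases (auto simp: continuous_map_def)
  next
    fix U assume U: "openin T U"
    have "{x \<in> topspace X. g x \<in> {z \<in> topspace P. u z \<in> U}} = {x \<in> topspace X. p x \<in> U}"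
      using ug gP by auto
    moreover have "{x \<in> topspace Y. k x \<in> {z \<in> topspace P. u z \<in> U}} = {x \<in> topspace Y. q x \<in> U}"
      using uk kP by auto
    ultimately show "openin P {z \<in> topspace P. u z \<in> U}"
      using U p q by (subst opn) (auto simp: continuous_map_def)
  qed
  then show "\<exists>u. continuous_map P T u \<and> (\<forall>x\<in>topspace X. u (g x) = p x) \<and> (\<forall>y\<in>topspace Y. u (k y) = q y)"
    using ug uk by blast
qed

definition seq_colimit :: "'b topology \<Rightarrow> (nat \<Rightarrow> 'b set) \<Rightarrow> bool" where
  "seq_colimit X B \<longleftrightarrow>
     (\<forall>n. B n \<subseteq> B (Suc n)) \<and> (\<Union>n. B n) = topspace X \<and>
     (\<forall>U \<subseteq> topspace X. openin X U \<longleftrightarrow> (\<forall>n. openin (subtopology X (B n)) (U \<inter> B n)))"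

definition disk :: "nat \<Rightarrow> (nat \<Rightarrow> real) topology" where
  "disk n = subtopology (Euclidean_space n) {x. (\<Sum>i<n. (x i)\<^sup>2) \<le> 1}"

text \<open>The \<open>(n-1)\<close>-sphere bounding \<open>disk n\<close>; it is empty for \<open>n = 0\<close>.\<close>

definition bdry_sphere :: "nat \<Rightarrow> (nat \<Rightarrow> real) topology" where
  "bdry_sphere n = subtopology (Euclidean_space n) {x. (\<Sum>i<n. (x i)\<^sup>2) = 1}"

text \<open>In a CW-structure \<open>Z n\<close> indexes the \<open>n\<close>-cells, \<open>\<Phi> n\<close> collects their characteristic maps, and
  \<open>skel Z \<Phi> n\<close> is the \<open>(n-1)\<close>-skeleton, so that \<open>skel Z \<Phi> 0\<close> is empty.\<close>

definition skel :: "(nat \<Rightarrow> 'z set) \<Rightarrow> (nat \<Rightarrow> 'z \<times> (nat \<Rightarrow> real) \<Rightarrow> 'b) \<Rightarrow> nat \<Rightarrow> 'b set" where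
  "skel Z \<Phi> n = (\<Union>m<n. \<Phi> m ` (Z m \<times> topspace (disk m)))"

definition CW_complex ::
  "'b topology \<Rightarrow> (nat \<Rightarrow> 'z set) \<Rightarrow> (nat \<Rightarrow> 'z \<times> (nat \<Rightarrow> real) \<Rightarrow> 'b) \<Rightarrow> bool" where
  "CW_complex X Z \<Phi> \<longleftrightarrow>
     (\<forall>n. \<exists>f. top_pushout
        (prod_topology (discrete_topology (Z n)) (bdry_sphere n))
        (subtopology X (skel Z \<Phi> n))
        (prod_topology (discrete_topology (Z n)) (disk n))
        f (\<lambda>x. x) (\<lambda>x. x) (\<Phi> n)
        (subtopology X (skel Z \<Phi> (Suc n)))) \<and>
     seq_colimit X (skel Z \<Phi>)"

definition subcomplex ::
  "'b topology \<Rightarrow> (nat \<Rightarrow> 'z set) \<Rightarrow> (nat \<Rightarrow> 'z \<times> (nat \<Rightarrow> real) \<Rightarrow> 'b) \<Rightarrow> 'b set \<Rightarrow> bool" where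
  "subcomplex X Z \<Phi> A \<longleftrightarrow>
     closedin X A \<and>
     (\<exists>Z'. (\<forall>n. Z' n \<subseteq> Z n) \<and>
        A = (\<Union>n. \<Phi> n ` (Z' n \<times> (topspace (disk n) - topspace (bdry_sphere n)))))"

text \<open>CW-structures are transported along homeomorphisms, so a space (pair) homeomorphic to a
  CW-complex (with subcomplex) is one that admits such a structure. Taking the cells to be
  indexed by points of the space is no restriction, as they can be indexed by their centres.\<close>

definition CW_space :: "'b topology \<Rightarrow> bool" where
  "CW_space X \<longleftrightarrow> (\<exists>(Z :: nat \<Rightarrow> 'b set) \<Phi>. CW_complex X Z \<Phi>)"

definition CW_pair :: "'b topology \<Rightarrow> 'b set \<Rightarrow> bool" where
  "CW_pair X A \<longleftrightarrow> (\<exists>(Z :: nat \<Rightarrow> 'b set) \<Phi>. CW_complex X Z \<Phi> \<and> subcomplex X Z \<Phi> A)"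


section \<open>Stratified spaces\<close>

text \<open>\<open>stage S i\<close> is \<open>X\<^sub>i\<close>, and for \<open>i \<ge> 1\<close> the pair \<open>(piece S i, piece_sub S i)\<close> is \<open>(M\<^sub>i, A\<^sub>i)\<close>,
  \<open>att S i\<close> is the attaching map \<open>h\<^sub>i\<close> and \<open>char_map S i\<close> the canonical map
  \<open>M\<^sub>i \<rightarrow> X\<^sub>i\<close> of the push-out; the values at \<open>i = 0\<close> are irrelevant.\<close>

record ('b, 'm) stratification =
  whole :: "'b topology"
  stage :: "nat \<Rightarrow> 'b set"
  piece :: "nat \<Rightarrow> 'm topology"
  piece_sub :: "nat \<Rightarrow> 'm set"
  att :: "nat \<Rightarrow> 'm \<Rightarrow> 'b"
  char_map :: "nat \<Rightarrow> 'm \<Rightarrow> 'b"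

definition stratified_filtration :: "('b, 'm) stratification \<Rightarrow> bool" where
  "stratified_filtration S \<longleftrightarrow>
     seq_colimit (whole S) (stage S) \<and>
     CW_space (subtopology (whole S) (stage S 0)) \<and>
     (\<forall>i\<ge>1. CW_pair (piece S i) (piece_sub S i) \<and>
        top_pushout
          (subtopology (piece S i) (piece_sub S i))
          (subtopology (whole S) (stage S (i - 1)))
          (piece S i)
          (att S i) (\<lambda>x. x) (\<lambda>x. x) (char_map S i)
          (subtopology (whole S) (stage S i)))"

definition finitely_stratified :: "('b, 'm) stratification \<Rightarrow> bool" where
  "finitely_stratified S \<longleftrightarrow> finite {i. i \<ge> 1 \<and> stage S i - stage S (i - 1) \<noteq> {}}"

text \<open>\<open>strat_skel S Z\<^sub>0 \<Phi>\<^sub>0 Z \<Phi> i\<close> are the skeleta of the induced CW-structure of \<open>X\<^sub>i\<close>, whose cells are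
  those of \<open>X\<^sub>0\<close> and those of \<open>M\<^sub>j - A\<^sub>j\<close> for \<open>1 \<le> j \<le> i\<close>.\<close>

primrec strat_skel ::
  "('b, 'm) stratification \<Rightarrow> (nat \<Rightarrow> 'b set) \<Rightarrow> (nat \<Rightarrow> 'b \<times> (nat \<Rightarrow> real) \<Rightarrow> 'b)
    \<Rightarrow> (nat \<Rightarrow> nat \<Rightarrow> 'm set) \<Rightarrow> (nat \<Rightarrow> nat \<Rightarrow> 'm \<times> (nat \<Rightarrow> real) \<Rightarrow> 'm)
    \<Rightarrow> nat \<Rightarrow> nat \<Rightarrow> 'b set" where
  "strat_skel S Z0 \<Phi>0 Z \<Phi> 0 n = skel Z0 \<Phi>0 n"
| "strat_skel S Z0 \<Phi>0 Z \<Phi> (Suc i) n =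
     strat_skel S Z0 \<Phi>0 Z \<Phi> i n \<union> char_map S (Suc i) ` skel (Z (Suc i)) (\<Phi> (Suc i)) n"

definition stratified_CW_complex :: "('b, 'm) stratification \<Rightarrow> bool" where
  "stratified_CW_complex S \<longleftrightarrow>
     stratified_filtration S \<and>
     (\<exists>Z0 \<Phi>0 Z \<Phi>.
        CW_complex (subtopology (whole S) (stage S 0)) Z0 \<Phi>0 \<and>
        (\<forall>i\<ge>1. CW_complex (piece S i) (Z i) (\<Phi> i) \<and>
           subcomplex (piece S i) (Z i) (\<Phi> i) (piece_sub S i) \<and>
           (\<forall>n. att S i ` (piece_sub S i \<inter> skel (Z i) (\<Phi> i) n)
                  \<subseteq> strat_skel S Z0 \<Phi>0 Z \<Phi> (i - 1) n)))"

definition stratified_space :: "('b, 'm) stratification \<Rightarrow> bool" where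
  "stratified_space S \<longleftrightarrow>
     stratified_filtration S \<and> (finitely_stratified S \<or> stratified_CW_complex S)"


section \<open>Structure categories\<close>

record ('o, 'a) category =
  Obj :: "'o set"
  Arr :: "'a set"
  Dom :: "'a \<Rightarrow> 'o"
  Cod :: "'a \<Rightarrow> 'o"
  Ide :: "'o \<Rightarrow> 'a"
  Comp :: "'a \<Rightarrow> 'a \<Rightarrow> 'a"  \<comment> \<open>\<open>Comp \<psi> \<phi>\<close> is \<open>\<psi>\<close> after \<open>\<phi>\<close>\<close>

definition category :: "('o, 'a, 'c) category_scheme \<Rightarrow> bool" where
  "category C \<longleftrightarrow>
     (\<forall>\<phi>\<in>Arr C. Dom C \<phi> \<in> Obj C \<and> Cod C \<phi> \<in> Obj C) \<and>
     (\<forall>V\<in>Obj C. Ide C V \<in> Arr C \<and> Dom C (Ide C V) = V \<and> Cod C (Ide C V) = V) \<and>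
     (\<forall>\<phi>\<in>Arr C. \<forall>\<psi>\<in>Arr C. Dom C \<psi> = Cod C \<phi> \<longrightarrow>
        Comp C \<psi> \<phi> \<in> Arr C \<and> Dom C (Comp C \<psi> \<phi>) = Dom C \<phi> \<and> Cod C (Comp C \<psi> \<phi>) = Cod C \<psi>) \<and>
     (\<forall>\<phi>\<in>Arr C. Comp C \<phi> (Ide C (Dom C \<phi>)) = \<phi> \<and> Comp C (Ide C (Cod C \<phi>)) \<phi> = \<phi>) \<and>
     (\<forall>\<phi>\<in>Arr C. \<forall>\<psi>\<in>Arr C. \<forall>\<theta>\<in>Arr C. Dom C \<psi> = Cod C \<phi> \<and> Dom C \<theta> = Cod C \<psi> \<longrightarrow>
        Comp C \<theta> (Comp C \<psi> \<phi>) = Comp C (Comp C \<theta> \<psi>) \<phi>)"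

definition isomorphism :: "('o, 'a, 'c) category_scheme \<Rightarrow> 'a \<Rightarrow> bool" where
  "isomorphism C \<phi> \<longleftrightarrow> \<phi> \<in> Arr C \<and>
     (\<exists>\<psi>\<in>Arr C. Dom C \<psi> = Cod C \<phi> \<and> Cod C \<psi> = Dom C \<phi> \<and>
        Comp C \<psi> \<phi> = Ide C (Dom C \<phi>) \<and> Comp C \<phi> \<psi> = Ide C (Cod C \<phi>))"

definition groupoid :: "('o, 'a, 'c) category_scheme \<Rightarrow> bool" where
  "groupoid C \<longleftrightarrow> category C \<and> (\<forall>\<phi>\<in>Arr C. isomorphism C \<phi>)"

text \<open>\<open>fib\<close> and \<open>act\<close> are the fibre functor \<open>F\<close> on objects and on morphisms. As the category is
  small, all its fibres embed in one type \<open>'f\<close>.\<close>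

record ('o, 'a, 'f) structure_category = "('o, 'a) category" +
  fib :: "'o \<Rightarrow> 'f topology"
  act :: "'a \<Rightarrow> 'f \<Rightarrow> 'f"

definition structure_category :: "('o, 'a, 'f) structure_category \<Rightarrow> bool" where
  "structure_category C \<longleftrightarrow>
     category C \<and>
     (\<forall>V\<in>Obj C. locally_compact_space (fib C V) \<and> second_countable (fib C V) \<and>
        Hausdorff_space (fib C V)) \<and>
     (\<forall>\<phi>\<in>Arr C. continuous_map (fib C (Dom C \<phi>)) (fib C (Cod C \<phi>)) (act C \<phi>)) \<and>
     (\<forall>V\<in>Obj C. \<forall>v\<in>topspace (fib C V). act C (Ide C V) v = v) \<and>
     (\<forall>\<phi>\<in>Arr C. \<forall>\<psi>\<in>Arr C. Dom C \<psi> = Cod C \<phi> \<longrightarrow>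
        (\<forall>v\<in>topspace (fib C (Dom C \<phi>)). act C (Comp C \<psi> \<phi>) v = act C \<psi> (act C \<phi> v)))"


section \<open>Families and bundles\<close>

record ('x, 'b, 'o, 'f) family =
  total :: "'x topology"
  base :: "'b topology"
  proj :: "'x \<Rightarrow> 'b"
  obj :: "'b \<Rightarrow> 'o"
  chart :: "'b \<Rightarrow> 'x \<Rightarrow> 'f"

definition fibre :: "('x, 'b, 'o, 'f) family \<Rightarrow> 'b \<Rightarrow> 'x set" where
  "fibre X b = {x \<in> topspace (total X). proj X x = b}"

definition F_family ::
  "('o, 'a, 'f) structure_category \<Rightarrow> ('x, 'b, 'o, 'f) family \<Rightarrow> bool" where
  "F_family C X \<longleftrightarrow>
     continuous_map (total X) (base X) (proj X) \<and>
     (\<forall>b\<in>topspace (base X). obj X b \<in> Obj C \<and>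
        homeomorphic_map (subtopology (total X) (fibre X b)) (fib C (obj X b)) (chart X b))"

text \<open>\<open>represents C X Y f fb b \<phi>\<close>: on the fibre over \<open>b\<close>, \<open>f\<close> equals \<open>F \<phi>\<close> in the charts.\<close>

definition represents ::
  "('o, 'a, 'f) structure_category \<Rightarrow> ('x, 'b, 'o, 'f) family \<Rightarrow> ('y, 'c, 'o, 'f) family
    \<Rightarrow> ('x \<Rightarrow> 'y) \<Rightarrow> ('b \<Rightarrow> 'c) \<Rightarrow> 'b \<Rightarrow> 'a \<Rightarrow> bool" where
  "represents C X Y f fb b \<phi> \<longleftrightarrow>
     \<phi> \<in> Arr C \<and> Dom C \<phi> = obj X b \<and> Cod C \<phi> = obj Y (fb b) \<and>
     (\<forall>x\<in>fibre X b. chart Y (fb b) (f x) = act C \<phi> (chart X b x))"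

definition F_map ::
  "('o, 'a, 'f) structure_category \<Rightarrow> ('x, 'b, 'o, 'f) family \<Rightarrow> ('y, 'c, 'o, 'f) family
    \<Rightarrow> ('x \<Rightarrow> 'y) \<Rightarrow> ('b \<Rightarrow> 'c) \<Rightarrow> bool" where
  "F_map C X Y f fb \<longleftrightarrow>
     continuous_map (total X) (total Y) f \<and> continuous_map (base X) (base Y) fb \<and>
     (\<forall>x\<in>topspace (total X). proj Y (f x) = fb (proj X x)) \<and>
     (\<forall>b\<in>topspace (base X). \<exists>\<phi>. represents C X Y f fb b \<phi>)"

definition F_isomorphic ::
  "('o, 'a, 'f) structure_category \<Rightarrow> ('x, 'b, 'o, 'f) family \<Rightarrow> ('y, 'c, 'o, 'f) family \<Rightarrow> bool"
  where
  "F_isomorphic C X Y \<longleftrightarrow>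
     (\<exists>f fb g gb. F_map C X Y f fb \<and> F_map C Y X g gb \<and>
        (\<forall>x\<in>topspace (total X). g (f x) = x) \<and> (\<forall>y\<in>topspace (total Y). f (g y) = y) \<and>
        (\<forall>b\<in>topspace (base X). gb (fb b) = b) \<and> (\<forall>c\<in>topspace (base Y). fb (gb c) = c))"

text \<open>The pull-back along an inclusion \<open>U \<subseteq> base X\<close>, identified with the part of \<open>X\<close> over \<open>U\<close>.\<close>

definition restrict_fam :: "('x, 'b, 'o, 'f) family \<Rightarrow> 'b set \<Rightarrow> ('x, 'b, 'o, 'f) family" where
  "restrict_fam X U =
     X\<lparr>total := subtopology (total X) {x \<in> topspace (total X). proj X x \<in> U},
       base := subtopology (base X) U\<rparr>"

definition product_fam ::
  "('o, 'a, 'f) structure_category \<Rightarrow> 'b topology \<Rightarrow> 'o \<Rightarrow> ('b \<times> 'f, 'b, 'o, 'f) family" where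
  "product_fam C U V =
     \<lparr>total = prod_topology U (fib C V), base = U, proj = fst, obj = (\<lambda>_. V), chart = (\<lambda>_. snd)\<rparr>"

definition F_bundle ::
  "('o, 'a, 'f) structure_category \<Rightarrow> ('x, 'b, 'o, 'f) family \<Rightarrow> bool" where
  "F_bundle C X \<longleftrightarrow>
     F_family C X \<and>
     (\<forall>b\<in>topspace (base X). \<exists>W U V.
        openin (base X) W \<and> b \<in> W \<and> W \<subseteq> U \<and> U \<subseteq> topspace (base X) \<and> V \<in> Obj C \<and>
        F_isomorphic C (restrict_fam X U) (product_fam C (subtopology (base X) U) V))"


section \<open>Push-outs of families and complexes\<close>

text \<open>Here the inclusion is the identity function on the elements of \<open>A\<close>.\<close>

definition closed_inclusion :: "('y, 'c, 'o, 'f) family \<Rightarrow> ('y, 'c, 'o, 'f) family \<Rightarrow> bool" where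
  "closed_inclusion A Y \<longleftrightarrow>
     closedin (base Y) (topspace (base A)) \<and> A = restrict_fam Y (topspace (base A))"

text \<open>On the fibre over \<open>b\<close>, both \<open>f\<close> and its inverse are given by morphisms.\<close>

definition fibre_iso ::
  "('o, 'a, 'f) structure_category \<Rightarrow> ('x, 'b, 'o, 'f) family \<Rightarrow> ('y, 'c, 'o, 'f) family
    \<Rightarrow> ('x \<Rightarrow> 'y) \<Rightarrow> ('b \<Rightarrow> 'c) \<Rightarrow> 'b \<Rightarrow> bool" where
  "fibre_iso C X Y f fb b \<longleftrightarrow>
     (\<exists>\<phi> \<psi>. represents C X Y f fb b \<phi> \<and>
        \<psi> \<in> Arr C \<and> Dom C \<psi> = Cod C \<phi> \<and> Cod C \<psi> = Dom C \<phi> \<and>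
        (\<forall>v\<in>topspace (fib C (Dom C \<phi>)). act C \<psi> (act C \<phi> v) = v) \<and>
        (\<forall>w\<in>topspace (fib C (Cod C \<phi>)). act C \<phi> (act C \<psi> w) = w))"

text \<open>Push-out in the category of families of \<open>X \<leftarrow> A \<rightarrow> Y\<close> with \<open>A \<rightarrow> Y\<close> a closed inclusion: it is
  formed by the push-outs of total and of base spaces. Its charts are those of \<open>X\<close> over the base of
  \<open>X\<close> and those of \<open>Y\<close> over the rest of the base; as push-outs are only determined up to
  isomorphism of families, the two \<open>fibre_iso\<close> conditions say that \<open>P\<close> has these charts up to
  isomorphism. The universal property is \<open>F_pushout_universal\<close> below.\<close>

definition F_pushout ::
  "('o, 'a, 'f) structure_category
    \<Rightarrow> ('y, 'c, 'o, 'f) family \<Rightarrow> ('x, 'b, 'o, 'f) family \<Rightarrow> ('y, 'c, 'o, 'f) family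
    \<Rightarrow> ('y \<Rightarrow> 'x) \<Rightarrow> ('c \<Rightarrow> 'b) \<Rightarrow> ('x \<Rightarrow> 'p) \<Rightarrow> ('b \<Rightarrow> 'q) \<Rightarrow> ('y \<Rightarrow> 'p) \<Rightarrow> ('c \<Rightarrow> 'q)
    \<Rightarrow> ('p, 'q, 'o, 'f) family \<Rightarrow> bool" where
  "F_pushout C A X Y f fb g gb k kb P \<longleftrightarrow>
     F_family C A \<and> F_family C X \<and> F_family C Y \<and> F_family C P \<and>
     closed_inclusion A Y \<and>
     F_map C A X f fb \<and> F_map C X P g gb \<and> F_map C Y P k kb \<and>
     top_pushout (total A) (total X) (total Y) f (\<lambda>x. x) g k (total P) \<and>
     top_pushout (base A) (base X) (base Y) fb (\<lambda>x. x) gb kb (base P) \<and>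
     (\<forall>b\<in>topspace (base X). fibre_iso C X P g gb b) \<and>
     (\<forall>c\<in>topspace (base Y) - topspace (base A). fibre_iso C Y P k kb c)"

lemma represents_factor:
  assumes C: "structure_category C" and FP: "F_family C P"
    and Z: "F_family C Z" and b: "b \<in> topspace (base Z)" and fi: "fibre_iso C Z P r rb b"
    and r: "F_map C Z P r rb" and s: "F_map C Z T s sb"
    and us: "\<And>x. x \<in> topspace (total Z) \<Longrightarrow> u (r x) = s x" and usb: "ub (rb b) = sb b"
  shows "\<exists>\<theta>. represents C P T u ub (rb b) \<theta>"
proof -
  obtain \<phi> \<psi> where ph: "represents C Z P r rb b \<phi>"
    and ps: "\<psi> \<in> Arr C" "Dom C \<psi> = Cod C \<phi>" "Cod C \<psi> = Dom C \<phi>"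
    and inv: "\<And>w. w \<in> topspace (fib C (Cod C \<phi>)) \<Longrightarrow> act C \<phi> (act C \<psi> w) = w"
    using fi by (auto simp: fibre_iso_def)
  obtain \<theta> where th: "represents C Z T s sb b \<theta>"
    using s b by (auto simp: F_map_def)
  have rbb: "rb b \<in> topspace (base P)" using r b by (auto simp: F_map_def continuous_map_def)
  have "represents C P T u ub (rb b) (Comp C \<theta> \<psi>)"
    unfolding represents_def
  proof (intro conjI ballI)
    have d: "Dom C \<theta> = Cod C \<psi>" "\<theta> \<in> Arr C" using th ph ps by (auto simp: represents_def)
    have cat: "category C" using C by (simp add: structure_category_def)
    have dc: "Comp C \<theta> \<psi> \<in> Arr C \<and> Dom C (Comp C \<theta> \<psi>) = Dom C \<psi> \<and> Cod C (Comp C \<theta> \<psi>) = Cod C \<theta>"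
      using cat d ps(1) unfolding category_def by blast
    show "Comp C \<theta> \<psi> \<in> Arr C" "Dom C (Comp C \<theta> \<psi>) = obj P (rb b)" "Cod C (Comp C \<theta> \<psi>) = obj T (ub (rb b))"
      using dc ps ph th usb by (auto simp: represents_def)
    fix z assume z: "z \<in> fibre P (rb b)"
    let ?w = "chart P (rb b) z"
    have hP: "homeomorphic_map (subtopology (total P) (fibre P (rb b))) (fib C (obj P (rb b))) (chart P (rb b))"
      using FP rbb by (auto simp: F_family_def)
    have hZ: "homeomorphic_map (subtopology (total Z) (fibre Z b)) (fib C (obj Z b)) (chart Z b)"
      using Z b by (auto simp: F_family_def)
    have fs: "topspace (subtopology (total P) (fibre P (rb b))) = fibre P (rb b)"
      "topspace (subtopology (total Z) (fibre Z b)) = fibre Z b"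
      by (auto simp: fibre_def)
    have w: "?w \<in> topspace (fib C (Dom C \<psi>))"
      using homeomorphic_imp_surjective_map[OF hP] z fs ps ph by (auto simp: represents_def)
    have v: "act C \<psi> ?w \<in> topspace (fib C (obj Z b))"
    proof -
      have "continuous_map (fib C (Dom C \<psi>)) (fib C (Cod C \<psi>)) (act C \<psi>)"
        using C ps(1) unfolding structure_category_def by blast
      then have "act C \<psi> ?w \<in> topspace (fib C (Cod C \<psi>))"
        using w by (auto simp: continuous_map_def)
      then show ?thesis using ps ph by (simp add: represents_def)
    qed
    obtain x where x: "x \<in> fibre Z b" "chart Z b x = act C \<psi> ?w"
    proof -
      have "chart Z b ` fibre Z b = topspace (fib C (obj Z b))"
        using homeomorphic_imp_surjective_map[OF hZ] by (simp only: fs)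
      with v have "act C \<psi> ?w \<in> chart Z b ` fibre Z b" by (simp only:)
      then show thesis using that by (elim imageE) simp
    qed
    have "chart P (rb b) (r x) = ?w"
      using ph x inv w ps by (auto simp: represents_def)
    moreover have "r x \<in> fibre P (rb b)"
      using x r by (auto simp: fibre_def F_map_def continuous_map_def)
    ultimately have rx: "r x = z"
      using inj_onD[OF homeomorphic_imp_injective_map[OF hP]] z by (simp only: fs)
    have "u z = s x" using us x rx by (auto simp: fibre_def)
    then have "chart T (ub (rb b)) (u z) = act C \<theta> (act C \<psi> ?w)"
      using th x usb by (auto simp: represents_def)
    also have "\<dots> = act C (Comp C \<theta> \<psi>) ?w"
    proof -
      have "\<forall>v\<in>topspace (fib C (Dom C \<psi>)). act C (Comp C \<theta> \<psi>) v = act C \<theta> (act C \<psi> v)"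
        using C d ps(1) unfolding structure_category_def by blast
      then show ?thesis using w by simp
    qed
    finally show "chart T (ub (rb b)) (u z) = act C (Comp C \<theta> \<psi>) ?w" .
  qed
  then show ?thesis by blast
qed

lemma F_pushout_universal:
  assumes C: "structure_category C" and T: "F_family C T"
    and P: "F_pushout C A X Y f fb g gb k kb P"
    and p: "F_map C X T p pb" and q: "F_map C Y T q qb"
    and pq: "\<And>a. a \<in> topspace (total A) \<Longrightarrow> p (f a) = q a"
    and pqb: "\<And>a. a \<in> topspace (base A) \<Longrightarrow> pb (fb a) = qb a"
  shows "\<exists>u ub. F_map C P T u ub \<and>
    (\<forall>x\<in>topspace (total X). u (g x) = p x) \<and> (\<forall>y\<in>topspace (total Y). u (k y) = q y) \<and>
    (\<forall>b\<in>topspace (base X). ub (gb b) = pb b) \<and> (\<forall>c\<in>topspace (base Y). ub (kb c) = qb c)"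
proof -
  have tp: "top_pushout (total A) (total X) (total Y) f (\<lambda>x. x) g k (total P)"
    and bp: "top_pushout (base A) (base X) (base Y) fb (\<lambda>x. x) gb kb (base P)"
    and g: "F_map C X P g gb" and k: "F_map C Y P k kb" and FP: "F_family C P"
    and FX: "F_family C X" and FY: "F_family C Y"
    using P by (auto simp: F_pushout_def)
  obtain u where u: "continuous_map (total P) (total T) u"
    and ug: "\<And>x. x\<in>topspace (total X) \<Longrightarrow> u (g x) = p x"
    and uk: "\<And>x. x\<in>topspace (total Y) \<Longrightarrow> u (k x) = q x"
    using top_pushout_universal[OF tp, of "total T" p q] p q pq by (auto simp: F_map_def)
  obtain ub where ub: "continuous_map (base P) (base T) ub"
    and ugb: "\<And>x. x\<in>topspace (base X) \<Longrightarrow> ub (gb x) = pb x"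
    and ukb: "\<And>x. x\<in>topspace (base Y) \<Longrightarrow> ub (kb x) = qb x"
    using top_pushout_universal[OF bp, of "base T" pb qb] p q pqb by (auto simp: F_map_def)
  have projX: "proj X x \<in> topspace (base X)" if "x \<in> topspace (total X)" for x
    using FX that by (auto simp: F_family_def continuous_map_def)
  have projY: "proj Y x \<in> topspace (base Y)" if "x \<in> topspace (total Y)" for x
    using FY that by (auto simp: F_family_def continuous_map_def)
  have projg: "proj P (g x) = gb (proj X x)" "proj T (p x) = pb (proj X x)" if "x \<in> topspace (total X)" for x
    using g p that by (auto simp: F_map_def)
  have projk: "proj P (k x) = kb (proj Y x)" "proj T (q x) = qb (proj Y x)" if "x \<in> topspace (total Y)" for x
    using k q that by (auto simp: F_map_def)
  have cover: "topspace (total P) = g ` topspace (total X) \<union> k ` topspace (total Y)"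
    using tp by (auto simp: top_pushout_def)
  have comm: "proj T (u z) = ub (proj P z)" if "z \<in> topspace (total P)" for z
    using that cover projg projk projX projY ug uk ugb ukb by auto
  have "\<exists>\<theta>. represents C P T u ub c \<theta>" if c: "c \<in> topspace (base P)" for c
  proof (cases "c \<in> gb ` topspace (base X)")
    case True
    then obtain b where b: "b \<in> topspace (base X)" "c = gb b" by auto
    show ?thesis unfolding b(2)
      by (rule represents_factor[OF C FP FX b(1) _ g p]) (use P b ug ugb in \<open>auto simp: F_pushout_def\<close>)
  next
    case False
    then obtain b where b: "b \<in> topspace (base Y)" "c = kb b"
      using c bp by (auto simp: top_pushout_def)
    have "b \<notin> topspace (base A)"
    proof
      assume bA: "b \<in> topspace (base A)"
      then have "gb (fb b) = kb b"
        using top_pushout_maps(3)[OF bp] by simp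
      moreover have "fb b \<in> topspace (base X)"
        using P bA by (auto simp: F_pushout_def F_map_def continuous_map_def)
      ultimately have "kb b \<in> gb ` topspace (base X)" by (rule image_eqI[OF sym])
      then show False using False b(2) by simp
    qed
    then show ?thesis unfolding b(2)
      using represents_factor[OF C FP FY b(1) _ k q] P b uk ukb by (auto simp: F_pushout_def)
  qed
  then have "F_map C P T u ub"
    using u ub comm by (auto simp: F_map_def)
  then show ?thesis using ug uk ugb ukb by blast
qed


definition F_set ::
  "('o, 'a, 'f) structure_category \<Rightarrow> 'z set \<Rightarrow> ('z \<Rightarrow> 'o) \<Rightarrow> ('z \<times> 'f, 'z, 'o, 'f) family" where
  "F_set C Z V =
     \<lparr>total = sum_topology (\<lambda>z. fib C (V z)) Z, base = discrete_topology Z,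
      proj = fst, obj = V, chart = (\<lambda>_. snd)\<rparr>"

definition times_fam ::
  "('x, 'b, 'o, 'f) family \<Rightarrow> 't topology \<Rightarrow> ('x \<times> 't, 'b \<times> 't, 'o, 'f) family" where
  "times_fam X T =
     \<lparr>total = prod_topology (total X) T, base = prod_topology (base X) T,
      proj = map_prod (proj X) id, obj = obj X \<circ> fst, chart = (\<lambda>b x. chart X (fst b) (fst x))\<rparr>"

lemma cells_closed_inclusion:
  "closed_inclusion (times_fam (F_set C Z V) (bdry_sphere n)) (times_fam (F_set C Z V) (disk n))"
proof -
  have cont: "continuous_map (Euclidean_space n) euclideanreal (\<lambda>x. \<Sum>i<n. (x i)\<^sup>2)"
    unfolding Euclidean_space_def
    by (intro continuous_map_from_subtopology continuous_map_sum continuous_map_real_pow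
        continuous_map_product_projection) auto
  have cl: "closedin (Euclidean_space n) {x \<in> topspace (Euclidean_space n). (\<Sum>i<n. (x i)\<^sup>2) \<in> {1}}"
    by (rule closedin_continuous_map_preimage[OF cont]) auto
  let ?S = "topspace (bdry_sphere n)"
  have S: "{x \<in> topspace (Euclidean_space n). (\<Sum>i<n. (x i)\<^sup>2) \<in> {1}} = ?S"
    by (auto simp: bdry_sphere_def)
  have cld: "closedin (disk n) ?S"
    using cl unfolding S disk_def closedin_subtopology
    by (intro exI[of _ ?S]) (auto simp: bdry_sphere_def)
  have bs: "bdry_sphere n = subtopology (disk n) ?S"
  proof -
    have "{x. (\<Sum>i<n. (x i)\<^sup>2) \<le> 1} \<inter> ?S = topspace (Euclidean_space n) \<inter> {x. (\<Sum>i<n. (x i)\<^sup>2) = 1}"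
      by (auto simp: bdry_sphere_def)
    then show ?thesis
      unfolding disk_def subtopology_subtopology
      by (metis bdry_sphere_def subtopology_restrict)
  qed
  have 1: "prod_topology W (bdry_sphere n) = subtopology (prod_topology W (disk n)) (topspace W \<times> ?S)" for W :: "'w topology"
    by (simp add: subtopology_Times flip: bs)
  show ?thesis
    unfolding closed_inclusion_def
  proof
    show "closedin (base (times_fam (F_set C Z V) (disk n))) (topspace (base (times_fam (F_set C Z V) (bdry_sphere n))))"
      using cld by (simp add: times_fam_def F_set_def closedin_prod_Times_iff)
    show "times_fam (F_set C Z V) (bdry_sphere n) = restrict_fam (times_fam (F_set C Z V) (disk n))
      (topspace (base (times_fam (F_set C Z V) (bdry_sphere n))))"
      unfolding restrict_fam_def times_fam_def F_set_def
      using closedin_subset[OF cld]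
      by (auto simp: 1 intro!: arg_cong[of _ _ "subtopology _"])
  qed
qed

text \<open>Both families live inside one ambient family, so that \<open>D \<rightarrow> X\<close> is an inclusion. Indexing the
  cells by points of the base is no restriction (use their centres).\<close>

definition attach_cells ::
  "('o, 'a, 'f) structure_category \<Rightarrow> nat
    \<Rightarrow> ('x, 'b, 'o, 'f) family \<Rightarrow> ('x, 'b, 'o, 'f) family \<Rightarrow> bool" where
  "attach_cells C n D X \<longleftrightarrow>
     (\<exists>(Z :: 'b set) V f fb k kb. V ` Z \<subseteq> Obj C \<and>
        F_pushout C (times_fam (F_set C Z V) (bdry_sphere n)) D (times_fam (F_set C Z V) (disk n))
          f fb (\<lambda>x. x) (\<lambda>b. b) k kb X)"

definition fam_colimit :: "('x, 'b, 'o, 'f) family \<Rightarrow> (nat \<Rightarrow> 'b set) \<Rightarrow> bool" where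
  "fam_colimit X B \<longleftrightarrow>
     seq_colimit (base X) B \<and>
     seq_colimit (total X) (\<lambda>n. {x \<in> topspace (total X). proj X x \<in> B n})"

text \<open>The filtration is indexed so that \<open>B 0\<close> is the base of \<open>D = X\<^sub>-\<^sub>1\<close> and \<open>B (Suc n)\<close> that
  of \<open>X\<^sub>n\<close>. Each member is closed in the next, so it is the restriction of \<open>X\<close> to its base.\<close>

definition relative_F_complex ::
  "('o, 'a, 'f) structure_category
    \<Rightarrow> ('x, 'b, 'o, 'f) family \<Rightarrow> ('x, 'b, 'o, 'f) family \<Rightarrow> bool" where
  "relative_F_complex C X D \<longleftrightarrow>
     F_family C X \<and>
     (\<exists>B. D = restrict_fam X (B 0) \<and>
        (\<forall>n. attach_cells C n (restrict_fam X (B n)) (restrict_fam X (B (Suc n)))) \<and>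
        fam_colimit X B)"

definition F_complex ::
  "('o, 'a, 'f) structure_category \<Rightarrow> ('x, 'b, 'o, 'f) family \<Rightarrow> bool" where
  "F_complex C X \<longleftrightarrow> relative_F_complex C X (restrict_fam X {})"


section \<open>Stratified fibre bundles\<close>

text \<open>\<open>M i\<close>, \<open>h i\<close>, \<open>k i\<close> for \<open>i \<ge> 1\<close> are the bundle over \<open>piece S i\<close>, the attaching map over
  \<open>att S i\<close>, and the canonical map to the push-out over \<open>char_map S i\<close>. They are explicit
  parameters because their type cannot be quantified in a definition.\<close>

definition F_stratified_fibre_bundle ::
  "('o, 'a, 'f) structure_category \<Rightarrow> ('b, 'm) stratification \<Rightarrow> ('x, 'b, 'o, 'f) family
    \<Rightarrow> (nat \<Rightarrow> ('n, 'm, 'o, 'f) family) \<Rightarrow> (nat \<Rightarrow> 'n \<Rightarrow> 'x) \<Rightarrow> (nat \<Rightarrow> 'n \<Rightarrow> 'x) \<Rightarrow> bool" where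
  "F_stratified_fibre_bundle C S X M h k \<longleftrightarrow>
     stratified_space S \<and> F_family C X \<and> base X = whole S \<and>
     F_bundle C (restrict_fam X (stage S 0)) \<and>
     (\<forall>i\<ge>1. F_bundle C (M i) \<and> base (M i) = piece S i \<and>
        F_pushout C
          (restrict_fam (M i) (piece_sub S i))
          (restrict_fam X (stage S (i - 1)))
          (M i)
          (h i) (att S i) (\<lambda>x. x) (\<lambda>b. b) (k i) (char_map S i)
          (restrict_fam X (stage S i))) \<and>
     fam_colimit X (stage S)"

end

(*
The bundle statements are reduced to one criterion: a family over a base that is built from cells,
such that over each closed cell it is trivial and both the base and the total space carry the
coherent topology, is a bundle. To trivialize it near an open cell e, push
points radially to the boundary of their cell, again and again, until they arrive in e. The points
for which this succeeds form an open set, and transporting the fibres along these moves identifies the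
part of the family over it with a product. This gives a continuous fibrewise isomorphism; in a
groupoid of homeomorphisms its inverse is continuous because disks are locally connected.

For a stratified bundle the cells come from the CW-structures of the strata, since a bundle over a
disk is trivial. Conversely, push-outs and colimits of base spaces lift to the total spaces of a
bundle, because pulling a quotient map back to a bundle with locally compact fibres gives a quotient
map.
*)

theory Submission
  imports Defs
begin

section \<open>Topological preliminaries\<close>

text \<open>The charts of a family are chosen point by point, and an \<open>F_map\<close> only
  records that some morphism exists over each point. No topology on the morphisms is available in
  which transition maps could vary continuously, so all continuity has to be read off from the total
  space; this is why the criterion demands the coherent topology upstairs as well as downstairs.
  Only the end point of a sequence of pushes matters, so no homotopies have to be concatenated:
  openness is a recursion along a well-founded order of the cells. This makes the fibre coordinate
  continuous on the total space. The opposite direction starts from a product whose topology is not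
  known to be coherent, and that is where local compactness of the fibres and local connectedness of
  disks enter. The order on the cells is kept abstract because attaching maps of a finite stratified
  space need not be cellular: the boundary of a cell may meet cells of higher dimension in an
  earlier stratum.\<close>

lemma openin_tube:
  assumes W: "openin (prod_topology Y V) W" and K: "compactin V K"
  shows "openin Y {y \<in> topspace Y. {y} \<times> K \<subseteq> W}"
proof (subst openin_subopen, safe)
  fix y assume y: "y \<in> topspace Y" "{y} \<times> K \<subseteq> W"
  obtain U U' where U: "openin Y U" "openin V U'" "y \<in> U" "K \<subseteq> U'" "U \<times> U' \<subseteq> W"
    using tube_lemma_right[OF W K y] by blast
  then show "\<exists>T. openin Y T \<and> y \<in> T \<and> T \<subseteq> {y \<in> topspace Y. {y} \<times> K \<subseteq> W}"
    by (intro exI[of _ U]) (use openin_subset[OF U(1)] in auto)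
qed

lemma openin_prod_box:
  assumes "openin (prod_topology X Y) W" and "(x, y) \<in> W"
  obtains U V where "openin X U" "openin Y V" "x \<in> U" "y \<in> V" "U \<times> V \<subseteq> W"
proof -
  have "\<exists>U V. openin X U \<and> openin Y V \<and> x \<in> U \<and> y \<in> V \<and> U \<times> V \<subseteq> W"
    using assms by (simp only: openin_prod_topology_alt)
  then show ?thesis using that by blast
qed

text \<open>A compact neighbourhood \<open>N\<close> of \<open>v\<close> in the slice of
  \<open>W\<close> over \<open>b\<close> stays inside the slices over a whole open set of base
  points, which gives a box. Openness in the product is thereby reduced to openness in
  \<open>B\<close> alone, where a coherent topology can be tested.\<close>

lemma openin_prod_via_compacts:
  assumes V: "locally_compact_space V" "Hausdorff_space V"
    and W: "W \<subseteq> topspace B \<times> topspace V"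
    and fib: "\<And>b. b \<in> topspace B \<Longrightarrow> openin V {v. (b, v) \<in> W}"
    and cpt: "\<And>K. compactin V K \<Longrightarrow> openin B {b \<in> topspace B. {b} \<times> K \<subseteq> W}"
  shows "openin (prod_topology B V) W"
proof (subst openin_subopen, safe)
  fix b v assume bv: "(b, v) \<in> W"
  have nb: "neighbourhood_base_of (\<lambda>C. compactin V C \<and> closedin V C) V"
    using V locally_compact_space_neighbourhood_base_closedin by blast
  have b: "b \<in> topspace B" using W bv by auto
  obtain O1 N where N: "openin V O1" "compactin V N" "v \<in> O1" "O1 \<subseteq> N" "N \<subseteq> {v. (b, v) \<in> W}"
    using nb fib[OF b] bv unfolding neighbourhood_base_of by (metis mem_Collect_eq)
  let ?N = "{b \<in> topspace B. {b} \<times> N \<subseteq> W}"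
  show "\<exists>T. openin (prod_topology B V) T \<and> (b, v) \<in> T \<and> T \<subseteq> W"
    by (intro exI[of _ "?N \<times> O1"]) (use N b cpt[OF N(2)] in \<open>auto simp: openin_prod_Times_iff\<close>)
qed

text \<open>Without local connectedness of \<open>T\<close> this fails: inversion is not continuous in the
  homeomorphism group of a general locally compact space. Here the connected set
  \<open>{h s x | s \<in> U}\<close> of nearby times misses the image of the boundary of a compact neighbourhood \<open>N\<close>,
  so it stays inside the image of \<open>N\<close>.\<close>

lemma continuous_map_fibrewise_inverse:
  assumes T: "locally_connected_space T" and V: "locally_compact_space V" "Hausdorff_space V"
    and h: "continuous_map (prod_topology T V) V' (\<lambda>(t, v). h t v)"
    and hom: "\<And>t. t \<in> topspace T \<Longrightarrow> homeomorphic_maps V V' (h t) (g t)"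
  shows "continuous_map (prod_topology T V') V (\<lambda>(t, w). g t w)"
proof -
  have nb: "neighbourhood_base_of (\<lambda>C. compactin V C \<and> closedin V C) V"
    using V locally_compact_space_neighbourhood_base_closedin by blast
  have hm: "h t v \<in> topspace V'" "g t (h t v) = v" if "t \<in> topspace T" "v \<in> topspace V" for t v
    using hom[OF that(1)] that(2) by (auto simp: homeomorphic_maps_def continuous_map_def)
  have gm: "g t w \<in> topspace V" "h t (g t w) = w" if "t \<in> topspace T" "w \<in> topspace V'" for t w
    using hom[OF that(1)] that(2) by (auto simp: homeomorphic_maps_def continuous_map_def)
  have opn: "openin V' (h t ` A)" if "t \<in> topspace T" "openin V A" for t A
    using hom[OF that(1)] that(2) homeomorphic_maps_map homeomorphic_map_openness_eq by metis
  have cls: "closedin V' (h t ` A)" if "t \<in> topspace T" "closedin V A" for t A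
    using hom[OF that(1)] that(2) homeomorphic_maps_map homeomorphic_map_closedness_eq by metis
  have "openin (prod_topology T V') {p \<in> topspace (prod_topology T V'). (case p of (t, w) \<Rightarrow> g t w) \<in> G}"
    if G: "openin V G" for G
  proof (subst openin_subopen, clarsimp)
    fix t0 w0 assume t0: "t0 \<in> topspace T" and w0: "w0 \<in> topspace V'" and gG: "g t0 w0 \<in> G"
    let ?x0 = "g t0 w0"
    obtain O1 N where N: "openin V O1" "compactin V N" "closedin V N" "?x0 \<in> O1" "O1 \<subseteq> N" "N \<subseteq> G"
      using nb G gG unfolding neighbourhood_base_of by metis
    obtain O2 N2 where N2: "openin V O2" "closedin V N2" "?x0 \<in> O2" "O2 \<subseteq> N2" "N2 \<subseteq> O1"
      using nb N(1,4) unfolding neighbourhood_base_of by metis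
    let ?Bd = "N - O1"
    have NV: "N \<subseteq> topspace V" using N(3) closedin_subset by blast
    have Bd: "compactin V ?Bd"
      using N by (metis closed_compactin Diff_subset closedin_diff)
    \<comment> \<open>\<open>N2\<close> lies inside \<open>O1\<close>, so \<open>h t0\<close> sends
      the boundary \<open>N - O1\<close> into the open set \<open>?far\<close>, and by the tube
      lemma \<open>h t\<close> still does so for \<open>t\<close> near \<open>t0\<close>.
      Injectivity of \<open>h t0\<close> keeps \<open>?far\<close> apart from
      \<open>?near\<close>.\<close>
    let ?far = "h t0 ` (topspace V - N2)" and ?near = "h t0 ` O2"
    have far: "openin V' ?far" using opn[OF t0] N2(2) by (simp add: closedin_def)
    have near: "openin V' ?near" using opn[OF t0] N2(1) by simp
    have disj: "?far \<inter> ?near = {}"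
    proof -
      have "inj_on (h t0) (topspace V)" by (rule inj_on_inverseI[of _ "g t0"]) (use hm t0 in auto)
      then have "h t0 ` ((topspace V - N2) \<inter> O2) = ?far \<inter> ?near"
        using openin_subset[OF N2(1)] by (intro inj_on_image_Int) auto
      then show ?thesis using N2(4) by blast
    qed
    let ?W1 = "{p \<in> topspace (prod_topology T V). (\<lambda>(t, v). h t v) p \<in> ?far}"
    have "openin (prod_topology T V) ?W1"
      by (rule openin_continuous_map_preimage[OF h far])
    then obtain T1 where T1: "openin T T1" "t0 \<in> T1" and T1': "\<And>t v. t \<in> T1 \<Longrightarrow> v \<in> ?Bd \<Longrightarrow> h t v \<in> ?far"
    proof -
      assume W1: "openin (prod_topology T V) ?W1"
      have sub: "{t0} \<times> ?Bd \<subseteq> ?W1" using t0 NV N2 by auto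
      obtain U U' where U: "openin T U" "t0 \<in> U" "?Bd \<subseteq> U'" "U \<times> U' \<subseteq> ?W1"
        using tube_lemma_right[OF W1 Bd t0 sub] by blast
      show thesis
      proof (rule that[OF U(1,2)])
        fix t v assume "t \<in> U" "v \<in> ?Bd"
        then have "(t, v) \<in> ?W1" using U(3,4) by blast
        then show "h t v \<in> ?far" by simp
      qed
    qed
    \<comment> \<open>At \<open>s = t0\<close> the point \<open>h s (g t0 w)\<close> is
      \<open>w\<close> itself. Joint continuity in \<open>s\<close> and \<open>w\<close> keeps it in
      \<open>?near\<close> close to \<open>(t0, w0)\<close>, and so confines the connected set of
      nearby times.\<close>
    have cq: "continuous_map (prod_topology T V') V' (\<lambda>(s, w). h s (g t0 w))"
    proof -
      have g0: "continuous_map V' V (g t0)" using hom[OF t0] by (simp add: homeomorphic_maps_def)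
      have "continuous_map (prod_topology T V') (prod_topology T V) (\<lambda>p. (fst p, g t0 (snd p)))"
        by (intro continuous_map_pairedI continuous_map_fst continuous_map_compose[OF continuous_map_snd g0, unfolded comp_def])
      from continuous_map_compose[OF this h] show ?thesis by (simp add: comp_def case_prod_unfold)
    qed
    define W2 where "W2 = {p \<in> topspace (prod_topology T V'). (\<lambda>(s, w). h s (g t0 w)) p \<in> ?near}"
    have "openin (prod_topology T V') W2"
      unfolding W2_def by (rule openin_continuous_map_preimage[OF cq near])
    moreover have "(t0, w0) \<in> W2"
      using t0 w0 N2 by (auto simp: W2_def)
    ultimately obtain T2 Q where T2: "openin T T2" "openin V' Q" "t0 \<in> T2" "w0 \<in> Q"
      and T2': "T2 \<times> Q \<subseteq> W2"
      using openin_prod_box by metis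
    obtain U where U: "openin T U" "connectedin T U" "t0 \<in> U" "U \<subseteq> T1 \<inter> T2"
      using T T1 T2 unfolding locally_connected_space by (metis IntI openin_Int)
    let ?Q = "Q \<inter> ?near"
    have in_O1: "g t w \<in> O1" if t: "t \<in> U" and w: "w \<in> ?Q" for t w
    proof -
      let ?x = "g t0 w"
      have tT: "t \<in> topspace T" using t U(1) openin_subset by blast
      have wV: "w \<in> topspace V'" using w T2(2) openin_subset by blast
      have xO: "?x \<in> O2" using w hm(2)[OF t0] openin_subset[OF N2(1)] by auto
      let ?P = "(\<lambda>s. h s ?x) ` U"
      have "continuous_map T V' (\<lambda>s. h s ?x)"
      proof -
        have "continuous_map T (prod_topology T V) (\<lambda>s. (s, ?x))"
          using gm(1)[OF t0 wV] by (intro continuous_map_pairedI) auto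
        from continuous_map_compose[OF this h] show ?thesis by (simp add: comp_def)
      qed
      then have conn: "connectedin V' ?P" by (rule connectedin_continuous_map_image[OF _ U(2)])
      have Pnear: "?P \<subseteq> ?near"
      proof clarify
        fix s assume "s \<in> U"
        then have "(s, w) \<in> T2 \<times> Q" using U(4) w by blast
        then have "(s, w) \<in> W2" by (rule subsetD[OF T2'])
        then show "h s ?x \<in> ?near" by (simp add: W2_def)
      qed
      have wP: "w \<in> ?P" using gm(2)[OF t0 wV] U(3) by force
      have xP: "h t ?x \<in> ?P" using t by auto
      have bd: "h t ` ?Bd \<subseteq> ?far" using T1' t U(4) by auto
      have cov: "?P \<subseteq> h t ` O1 \<union> (topspace V' - h t ` N)"
      proof
        fix z assume z: "z \<in> ?P"
        then have zV: "z \<in> topspace V'" using conn connectedin_subset_topspace by blast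
        have "z \<notin> ?far" using z Pnear disj by blast
        then have "z \<notin> h t ` ?Bd" using bd by blast
        then show "z \<in> h t ` O1 \<union> (topspace V' - h t ` N)" using zV by auto
      qed
      moreover have "openin V' (h t ` O1)" "openin V' (topspace V' - h t ` N)"
        using opn[OF tT N(1)] cls[OF tT N(3)] by auto
      moreover have "h t ` O1 \<inter> (topspace V' - h t ` N) \<inter> ?P = {}" using N(5) by blast
      moreover have "h t ` O1 \<inter> ?P \<noteq> {}" using xP xO N2 by blast
      ultimately have "(topspace V' - h t ` N) \<inter> ?P = {}"
        using conn unfolding connectedin by blast
      then have "w \<in> h t ` O1" using wP cov by blast
      then show ?thesis using hm(2)[OF tT] openin_subset[OF N(1)] by auto
    qed
    show "\<exists>Ta. openin (prod_topology T V') Ta \<and> (t0, w0) \<in> Ta \<and>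
       Ta \<subseteq> {p. p \<in> topspace T \<times> topspace V' \<and> (case p of (t, w) \<Rightarrow> g t w) \<in> G}"
    proof (intro exI[of _ "U \<times> ?Q"] conjI)
      show "openin (prod_topology T V') (U \<times> ?Q)"
        using U(1) T2(2) near by (auto simp: openin_prod_Times_iff)
      show "(t0, w0) \<in> U \<times> ?Q" using U(3) T2(4) N2(3) gm(2)[OF t0 w0] by force
      show "U \<times> ?Q \<subseteq> {p. p \<in> topspace T \<times> topspace V' \<and> (case p of (t, w) \<Rightarrow> g t w) \<in> G}"
        using in_O1 N(5,6) openin_subset[OF U(1)] openin_subset[OF T2(2)] by auto
    qed
  qed
  then show ?thesis using gm by (auto simp: continuous_map_def)
qed

lemma continuous_map_paste:
  assumes A: "closedin S A" and B: "closedin S B" and AB: "A \<union> B = topspace S"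
    and f: "continuous_map (subtopology S A) Y f" and g: "continuous_map (subtopology S B) Y g"
    and fg: "\<And>x. x \<in> A \<Longrightarrow> x \<in> B \<Longrightarrow> f x = g x"
  shows "continuous_map S Y (\<lambda>x. if x \<in> A then f x else g x)"
proof -
  have AS: "A \<subseteq> topspace S" and BS: "B \<subseteq> topspace S"
    using A B closedin_subset by auto
  have fY: "f x \<in> topspace Y" if "x \<in> A" for x
    using f that AS by (auto simp: continuous_map_def)
  have gY: "g x \<in> topspace Y" if "x \<in> B" for x
    using g that BS by (auto simp: continuous_map_def)
  have "closedin S {x \<in> topspace S. (if x \<in> A then f x else g x) \<in> C}" if C: "closedin Y C" for C
  proof -
    have "closedin S {x \<in> A. f x \<in> C}"
      using closedin_continuous_map_preimage[OF f C] A AS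
      by (simp add: closedin_closed_subtopology Int_absorb1)
    moreover have "closedin S {x \<in> B. g x \<in> C}"
      using closedin_continuous_map_preimage[OF g C] B BS
      by (simp add: closedin_closed_subtopology Int_absorb1)
    moreover have "{x \<in> topspace S. (if x \<in> A then f x else g x) \<in> C} = {x \<in> A. f x \<in> C} \<union> {x \<in> B. g x \<in> C}"
      using AB fg by auto
    ultimately show ?thesis by auto
  qed
  then show ?thesis
    using AB fY gY by (auto simp: continuous_map_closedin)
qed

section \<open>Disks and cubes\<close>

definition dnorm :: "nat \<Rightarrow> (nat \<Rightarrow> real) \<Rightarrow> real" where
  "dnorm n x = sqrt (\<Sum>i<n. (x i)\<^sup>2)"

lemma dnorm_nonneg: "0 \<le> dnorm n x"
  by (auto simp: dnorm_def intro!: sum_nonneg)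

lemma dnorm_scale: "0 \<le> a \<Longrightarrow> dnorm n (\<lambda>i. a * x i) = a * dnorm n x"
  by (simp add: dnorm_def power_mult_distrib real_sqrt_mult flip: sum_distrib_left)

lemma topspace_disk: "topspace (disk n) = {x. (\<forall>i\<ge>n. x i = 0) \<and> dnorm n x \<le> 1}"
  by (auto simp: disk_def topspace_Euclidean_space dnorm_def sum_nonneg)

lemma topspace_bdry_sphere: "topspace (bdry_sphere n) = {x. (\<forall>i\<ge>n. x i = 0) \<and> dnorm n x = 1}"
  by (auto simp: bdry_sphere_def topspace_Euclidean_space dnorm_def sum_nonneg)

lemma bdry_sphere_subset_disk: "topspace (bdry_sphere n) \<subseteq> topspace (disk n)"
  by (auto simp: topspace_disk topspace_bdry_sphere)

lemma bdry_sphere_eq_subtopology: "bdry_sphere n = subtopology (disk n) (topspace (bdry_sphere n))"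
proof -
  have "bdry_sphere n = subtopology (Euclidean_space n) (topspace (bdry_sphere n))"
    by (metis bdry_sphere_def subtopology_restrict topspace_subtopology)
  moreover have "topspace (bdry_sphere n) \<subseteq> {x. (\<Sum>i<n. (x i)\<^sup>2) \<le> 1}"
    by (auto simp: bdry_sphere_def)
  ultimately show ?thesis
    by (simp add: disk_def subtopology_subtopology Int_absorb1)
qed

lemma continuous_map_Euclidean_component:
  "continuous_map (Euclidean_space n) euclideanreal (\<lambda>x. x i)"
  unfolding Euclidean_space_def
  by (intro continuous_map_from_subtopology continuous_map_product_projection) auto

lemma continuous_map_dnorm: "continuous_map (Euclidean_space n) euclideanreal (dnorm n)"
  unfolding dnorm_def
  by (intro continuous_map_sqrt continuous_map_sum continuous_map_real_pow
      continuous_map_Euclidean_component) auto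

lemma continuous_map_disk_dnorm: "continuous_map (disk n) euclideanreal (dnorm n)"
  unfolding disk_def by (intro continuous_map_from_subtopology continuous_map_dnorm)

lemma continuous_map_into_Euclidean_space:
  assumes "\<And>i. i < n \<Longrightarrow> continuous_map X euclideanreal (\<lambda>x. f x i)"
    and "\<And>x i. x \<in> topspace X \<Longrightarrow> i \<ge> n \<Longrightarrow> f x i = 0"
  shows "continuous_map X (Euclidean_space n) f"
proof -
  have "continuous_map X (Euclidean_space n) (\<lambda>x i. if i < n then f x i else 0)"
    using assms(1) by (simp add: continuous_map_componentwise_Euclidean_space)
  then show ?thesis
    by (rule continuous_map_eq) (use assms(2) in \<open>auto simp: fun_eq_iff\<close>)
qed

lemma closedin_bdry_sphere: "closedin (disk n) (topspace (bdry_sphere n))"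
proof -
  have "closedin (disk n) {x \<in> topspace (disk n). dnorm n x \<in> {1}}"
    by (rule closedin_continuous_map_preimage[OF continuous_map_disk_dnorm]) auto
  moreover have "{x \<in> topspace (disk n). dnorm n x \<in> {1}} = topspace (bdry_sphere n)"
    by (auto simp: topspace_disk topspace_bdry_sphere)
  ultimately show ?thesis by simp
qed

text \<open>The radial projection onto the disk. It makes the disk a retract of Euclidean space,
  which yields local connectedness, and of the cube, to which trivializing over a disk is
  reduced.\<close>

definition disk_retract :: "nat \<Rightarrow> (nat \<Rightarrow> real) \<Rightarrow> nat \<Rightarrow> real" where
  "disk_retract n x = (\<lambda>i. x i / max 1 (dnorm n x))"

lemma disk_retract:
  shows "continuous_map (Euclidean_space n) (disk n) (disk_retract n)"
    and "x \<in> topspace (disk n) \<Longrightarrow> disk_retract n x = x"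
proof -
  have "continuous_map (Euclidean_space n) (Euclidean_space n) (disk_retract n)"
  proof (rule continuous_map_into_Euclidean_space)
    show "continuous_map (Euclidean_space n) euclideanreal (\<lambda>x. disk_retract n x i)" for i
      unfolding disk_retract_def
      by (intro continuous_map_real_divide continuous_map_Euclidean_component continuous_map_real_max
          continuous_map_dnorm) auto
  qed (auto simp: disk_retract_def topspace_Euclidean_space)
  moreover have "disk_retract n x \<in> topspace (disk n)" if "x \<in> topspace (Euclidean_space n)" for x
  proof -
    let ?a = "inverse (max 1 (dnorm n x))"
    have "disk_retract n x = (\<lambda>i. ?a * x i)"
      by (simp add: disk_retract_def divide_inverse mult.commute)
    then have "dnorm n (disk_retract n x) = ?a * dnorm n x"
      by (simp add: dnorm_scale)
    also have "\<dots> \<le> 1" using dnorm_nonneg[of n x] by (auto simp: max_def field_simps)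
    finally show ?thesis using that by (simp add: topspace_disk topspace_Euclidean_space disk_retract_def)
  qed
  then have "disk_retract n \<in> topspace (Euclidean_space n) \<rightarrow> {x. (\<Sum>i<n. (x i)\<^sup>2) \<le> 1}"
    by (auto simp: disk_def)
  ultimately show "continuous_map (Euclidean_space n) (disk n) (disk_retract n)"
    unfolding disk_def by (rule continuous_map_into_subtopology)
  show "disk_retract n x = x" if "x \<in> topspace (disk n)"
    using that by (auto simp: disk_retract_def topspace_disk max_def fun_eq_iff)
qed

lemma locally_connected_disk: "locally_connected_space (disk n)"
proof (rule locally_connected_space_retraction_map_image[OF _ locally_connected_Euclidean_space[of n]])
  show "retraction_map (Euclidean_space n) (disk n) (disk_retract n)"
    unfolding retraction_map_def retraction_maps_def
    by (intro exI[of _ "\<lambda>x. x"]) (auto simp: disk_retract, auto simp: disk_def continuous_map_from_subtopology)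
qed

text \<open>Division by zero fixes the centre; the results below keep it out by
  \<open>dnorm n x \<noteq> 0\<close>. For \<open>n = 0\<close> the centre is the whole disk, so
  vertices are never pushed.\<close>

definition radial :: "nat \<Rightarrow> (nat \<Rightarrow> real) \<Rightarrow> nat \<Rightarrow> real" where
  "radial n x = (\<lambda>i. x i / dnorm n x)"

lemma radial_in_bdry:
  assumes "x \<in> topspace (disk n)" and "dnorm n x \<noteq> 0"
  shows "radial n x \<in> topspace (bdry_sphere n)"
proof -
  have "radial n x = (\<lambda>i. inverse (dnorm n x) * x i)"
    by (simp add: radial_def divide_inverse mult.commute)
  then have "dnorm n (radial n x) = 1"
    using assms(2) dnorm_nonneg[of n x] by (simp add: dnorm_scale)
  then show ?thesis using assms(1) by (simp add: topspace_disk topspace_bdry_sphere radial_def)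
qed

lemma radial_on_bdry: "x \<in> topspace (bdry_sphere n) \<Longrightarrow> radial n x = x"
  by (simp add: radial_def topspace_bdry_sphere)

lemma openin_disk_punctured: "openin (disk n) {x \<in> topspace (disk n). dnorm n x \<noteq> 0}"
proof -
  have "openin (disk n) {x \<in> topspace (disk n). dnorm n x \<in> - {0}}"
    by (rule openin_continuous_map_preimage[OF continuous_map_disk_dnorm]) auto
  then show ?thesis by simp
qed

lemma continuous_map_radial:
  "continuous_map (subtopology (disk n) {x \<in> topspace (disk n). dnorm n x \<noteq> 0}) (bdry_sphere n) (radial n)"
proof -
  let ?S = "subtopology (disk n) {x \<in> topspace (disk n). dnorm n x \<noteq> 0}"
  have "continuous_map ?S (Euclidean_space n) (radial n)"
  proof (rule continuous_map_into_Euclidean_space)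
    show "continuous_map ?S euclideanreal (\<lambda>x. radial n x i)" for i
      unfolding radial_def disk_def
      by (intro continuous_map_real_divide continuous_map_from_subtopology
          continuous_map_Euclidean_component continuous_map_dnorm) auto
  qed (auto simp: radial_def topspace_disk)
  moreover have "radial n \<in> topspace ?S \<rightarrow> {x. (\<Sum>i<n. (x i)\<^sup>2) = 1}"
    using radial_in_bdry by (fastforce simp: bdry_sphere_def)
  ultimately show ?thesis
    unfolding bdry_sphere_def by (rule continuous_map_into_subtopology)
qed

text \<open>The segment \<open>t * x\<close> with \<open>t < 1\<close> runs inside the open disk, so
  a closed set containing the open disk also contains the end point at \<open>t = 1\<close>.\<close>

lemma disk_interior_dense:
  assumes C: "closedin (disk n) C" and sub: "topspace (disk n) - topspace (bdry_sphere n) \<subseteq> C"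
  shows "topspace (disk n) \<subseteq> C"
proof
  fix x assume x: "x \<in> topspace (disk n)"
  let ?p = "\<lambda>t i. t * x i"
  let ?I = "subtopology euclideanreal {0..1}"
  have p: "continuous_map ?I (disk n) ?p"
    unfolding disk_def
  proof (rule continuous_map_into_subtopology)
    show "continuous_map ?I (Euclidean_space n) ?p"
      by (rule continuous_map_into_Euclidean_space)
        (use x in \<open>auto simp: topspace_disk intro!: continuous_intros\<close>)
    have "?p t \<in> topspace (disk n)" if "t \<in> {0..1}" for t
      using x that dnorm_nonneg[of n x] by (auto simp: topspace_disk dnorm_scale mult_le_one)
    then show "?p \<in> topspace ?I \<rightarrow> {x. (\<Sum>i<n. (x i)\<^sup>2) \<le> 1}"
      by (auto simp: disk_def)
  qed
  have "closedin ?I {t \<in> topspace ?I. ?p t \<in> C}"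
    by (rule closedin_continuous_map_preimage[OF p C])
  then have cl: "closed {t \<in> {0..1}. ?p t \<in> C}"
    by (simp add: closedin_closed_eq)
  have "t \<in> {t \<in> {0..1}. ?p t \<in> C}" if t: "0 < t" "t < 1" for t
  proof -
    have "?p t \<in> topspace (disk n)"
      using x t dnorm_nonneg[of n x] by (auto simp: topspace_disk dnorm_scale mult_le_one)
    moreover have "dnorm n (?p t) < 1"
    proof -
      have "t * dnorm n x \<le> t" using x t by (intro mult_left_le) (auto simp: topspace_disk)
      then show ?thesis using t dnorm_scale[of t n x] by linarith
    qed
    ultimately have "?p t \<in> C" using sub by (auto simp: topspace_bdry_sphere)
    then show ?thesis using t by simp
  qed
  then have "closure {0<..<1} \<subseteq> {t \<in> {0..1}. ?p t \<in> C}"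
    using cl by (intro closure_minimal) auto
  then have "{0..1} \<subseteq> {t \<in> {0..1::real}. ?p t \<in> C}" by simp
  then have "1 \<in> {t \<in> {0..1::real}. ?p t \<in> C}" by (rule subsetD) simp
  then show "x \<in> C" by simp
qed

text \<open>A cube can be cut along one coordinate at a time, and setting that coordinate to the
  cutting value retracts onto the cut. In a disk the same operation may leave the disk.\<close>

definition cube :: "nat \<Rightarrow> (nat \<Rightarrow> real) topology" where
  "cube n = subtopology (Euclidean_space n) {x. \<forall>i<n. \<bar>x i\<bar> \<le> 1}"

lemma topspace_cube: "topspace (cube n) = {x. (\<forall>i\<ge>n. x i = 0) \<and> (\<forall>i<n. \<bar>x i\<bar> \<le> 1)}"
  by (auto simp: cube_def topspace_Euclidean_space)

lemma continuous_map_cube_component: "continuous_map (cube n) euclideanreal (\<lambda>x. x i)"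
  unfolding cube_def by (intro continuous_map_from_subtopology continuous_map_Euclidean_component)

lemma cube_box:
  assumes W: "openin (cube n) W" and x: "x \<in> W"
  obtains e where "e > 0" "{y \<in> topspace (cube n). \<forall>i<n. \<bar>y i - x i\<bar> < e} \<subseteq> W"
proof -
  obtain U where U: "openin (powertop_real UNIV) U"
    and WU: "W = U \<inter> {x. \<forall>i\<ge>n. x i = 0} \<inter> {x. \<forall>i<n. \<bar>x i\<bar> \<le> 1}"
    using W unfolding cube_def Euclidean_space_def openin_subtopology by auto
  have "x \<in> U" using x WU by simp
  then obtain B where B: "x \<in> (\<Pi>\<^sub>E i\<in>UNIV. B i)" "\<And>i. openin euclideanreal (B i)" "(\<Pi>\<^sub>E i\<in>UNIV. B i) \<subseteq> U"
    using product_topology_open_contains_basis[OF U] by metis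
  have "\<exists>e>0. \<forall>z. \<bar>z - x i\<bar> < e \<longrightarrow> z \<in> B i" for i
  proof -
    have "open (B i)" "x i \<in> B i" using B by auto
    then show ?thesis unfolding open_dist by (auto simp: dist_real_def)
  qed
  then obtain d where d: "\<And>i. d i > 0" "\<And>i z. \<bar>z - x i\<bar> < d i \<Longrightarrow> z \<in> B i" by metis
  \<comment> \<open>\<open>insert 1\<close> keeps the minimum defined for \<open>n = 0\<close>. The
    coordinates from \<open>n\<close> on vanish and require no bound.\<close>
  let ?e = "Min (insert 1 (d ` {..<n}))"
  show thesis
  proof (rule that[of ?e])
    show "?e > 0" using d(1) by simp
    show "{y \<in> topspace (cube n). \<forall>i<n. \<bar>y i - x i\<bar> < ?e} \<subseteq> W"
    proof clarify
      fix y assume y: "y \<in> topspace (cube n)" "\<forall>i<n. \<bar>y i - x i\<bar> < ?e"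
      have "y i \<in> B i" for i
      proof (cases "i < n")
        case True
        then have "?e \<le> d i" by simp
        then show ?thesis using y(2) True d(2) by (meson order_less_le_trans)
      next
        case False
        then have "y i = x i" using y(1) x WU by (simp add: topspace_cube)
        then show ?thesis using B(1) by auto
      qed
      then have "y \<in> U" using B(3) by auto
      then show "y \<in> W" using y(1) WU by (auto simp: topspace_cube)
    qed
  qed
qed

lemma continuous_map_cube_update:
  assumes "\<bar>a\<bar> \<le> 1" and "m < n"
  shows "continuous_map (cube n) (cube n) (\<lambda>y. y(m := a))"
proof -
  have "continuous_map (cube n) (Euclidean_space n) (\<lambda>y. y(m := a))"
    by (rule continuous_map_into_Euclidean_space)
      (use assms in \<open>auto simp: topspace_cube fun_upd_def intro: continuous_map_cube_component\<close>)
  then show ?thesis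
    using assms by (subst (2) cube_def) (auto simp: topspace_cube intro!: continuous_map_into_subtopology)
qed

section \<open>Parametrizations of fibres\<close>

locale groupoid_structure =
  fixes C :: "('o, 'a, 'f) structure_category"
  assumes sc: "structure_category C" and gr: "groupoid C"
begin

section \<open>Maps of fibres induced by morphisms\<close>

text \<open>Arrows matter only through their action on fibres, up to equality on
  \<open>fib C V\<close>. Speaking of functions allows composites and inverses to be formed without
  naming the arrows behind them.\<close>

definition arr_map :: "'o \<Rightarrow> 'o \<Rightarrow> ('f \<Rightarrow> 'f) \<Rightarrow> bool" where
  "arr_map V W g \<longleftrightarrow>
     (\<exists>\<phi>\<in>Arr C. Dom C \<phi> = V \<and> Cod C \<phi> = W \<and> (\<forall>v\<in>topspace (fib C V). g v = act C \<phi> v))"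

lemma cat: "category C" using sc by (simp add: structure_category_def)

lemma fib_props:
  assumes "V \<in> Obj C"
  shows "locally_compact_space (fib C V)" and "Hausdorff_space (fib C V)"
  using assms sc by (auto simp: structure_category_def)

lemma arr_map_Obj: "arr_map V W g \<Longrightarrow> V \<in> Obj C \<and> W \<in> Obj C"
  using cat by (auto simp: arr_map_def category_def)

lemma arr_map_continuous: "arr_map V W g \<Longrightarrow> continuous_map (fib C V) (fib C W) g"
proof -
  assume "arr_map V W g"
  then obtain \<phi> where \<phi>: "\<phi> \<in> Arr C" "Dom C \<phi> = V" "Cod C \<phi> = W" "\<And>v. v \<in> topspace (fib C V) \<Longrightarrow> g v = act C \<phi> v"
    by (auto simp: arr_map_def)
  have "continuous_map (fib C (Dom C \<phi>)) (fib C (Cod C \<phi>)) (act C \<phi>)"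
    using sc \<phi>(1) unfolding structure_category_def by blast
  then show ?thesis using \<phi> by (auto intro: continuous_map_eq)
qed

lemma arr_map_in: "arr_map V W g \<Longrightarrow> v \<in> topspace (fib C V) \<Longrightarrow> g v \<in> topspace (fib C W)"
  using arr_map_continuous by (auto simp: continuous_map_def)

lemma arr_map_id: "V \<in> Obj C \<Longrightarrow> arr_map V V (\<lambda>v. v)"
  using sc unfolding arr_map_def structure_category_def category_def
  by (intro bexI[of _ "Ide C V"]) auto

lemma arr_map_comp:
  assumes g: "arr_map V W g" and h: "arr_map W U h"
  shows "arr_map V U (\<lambda>v. h (g v))"
proof -
  obtain \<phi> where \<phi>: "\<phi> \<in> Arr C" "Dom C \<phi> = V" "Cod C \<phi> = W" "\<And>v. v \<in> topspace (fib C V) \<Longrightarrow> g v = act C \<phi> v"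
    using g by (auto simp: arr_map_def)
  obtain \<psi> where \<psi>: "\<psi> \<in> Arr C" "Dom C \<psi> = W" "Cod C \<psi> = U" "\<And>v. v \<in> topspace (fib C W) \<Longrightarrow> h v = act C \<psi> v"
    using h by (auto simp: arr_map_def)
  have "Comp C \<psi> \<phi> \<in> Arr C \<and> Dom C (Comp C \<psi> \<phi>) = V \<and> Cod C (Comp C \<psi> \<phi>) = U"
    using cat \<phi> \<psi> unfolding category_def by auto
  moreover have "act C (Comp C \<psi> \<phi>) v = act C \<psi> (act C \<phi> v)" if "v \<in> topspace (fib C V)" for v
    using sc \<phi> \<psi> that unfolding structure_category_def by auto
  ultimately show ?thesis
    unfolding arr_map_def using arr_map_in[OF g] \<phi> \<psi> by (intro bexI[of _ "Comp C \<psi> \<phi>"]) auto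
qed

text \<open>By functoriality the inverse arrow acts as the inverse map. This lemma and
  \<open>fibre_isoI\<close> are the places where the groupoid hypothesis is used directly.\<close>

lemma arr_map_inverse:
  assumes g: "arr_map V W g"
  obtains g' where "arr_map W V g'" "homeomorphic_maps (fib C V) (fib C W) g g'"
proof -
  obtain \<phi> where \<phi>: "\<phi> \<in> Arr C" "Dom C \<phi> = V" "Cod C \<phi> = W" "\<And>v. v \<in> topspace (fib C V) \<Longrightarrow> g v = act C \<phi> v"
    using g by (auto simp: arr_map_def)
  obtain \<psi> where \<psi>: "\<psi> \<in> Arr C" "Dom C \<psi> = W" "Cod C \<psi> = V" "Comp C \<psi> \<phi> = Ide C V" "Comp C \<phi> \<psi> = Ide C W"
    using gr \<phi> unfolding groupoid_def isomorphism_def by metis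
  have h: "arr_map W V (act C \<psi>)" using \<psi> by (auto simp: arr_map_def)
  have ob: "V \<in> Obj C" "W \<in> Obj C" using arr_map_Obj[OF g] by auto
  have 1: "act C \<psi> (act C \<phi> v) = v" if "v \<in> topspace (fib C V)" for v
  proof -
    have "act C (Comp C \<psi> \<phi>) v = act C \<psi> (act C \<phi> v)"
      using sc \<phi> \<psi>(1,2,3) that unfolding structure_category_def by auto
    moreover have "act C (Ide C V) v = v" using sc ob that unfolding structure_category_def by auto
    ultimately show ?thesis using \<psi>(4) by simp
  qed
  have 2: "act C \<phi> (act C \<psi> w) = w" if "w \<in> topspace (fib C W)" for w
  proof -
    have "act C (Comp C \<phi> \<psi>) w = act C \<phi> (act C \<psi> w)"
      using sc \<phi> \<psi>(1,2,3) that unfolding structure_category_def by auto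
    moreover have "act C (Ide C W) w = w" using sc ob that unfolding structure_category_def by auto
    ultimately show ?thesis using \<psi>(5) by simp
  qed
  show thesis
  proof (rule that[OF h])
    show "homeomorphic_maps (fib C V) (fib C W) g (act C \<psi>)"
      unfolding homeomorphic_maps_def
      using arr_map_continuous[OF g] arr_map_continuous[OF h] 1 2 \<phi>(4) arr_map_in[OF h] by auto
  qed
qed

lemma represents_iff:
  assumes X: "F_family C X" and b: "b \<in> topspace (base X)"
  shows "(\<exists>\<phi>. represents C X Y f fb b \<phi>) \<longleftrightarrow>
    (\<exists>g. arr_map (obj X b) (obj Y (fb b)) g \<and> (\<forall>x\<in>fibre X b. chart Y (fb b) (f x) = g (chart X b x)))"
proof -
  have "homeomorphic_map (subtopology (total X) (fibre X b)) (fib C (obj X b)) (chart X b)"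
    using X b by (auto simp: F_family_def)
  then have ch: "chart X b x \<in> topspace (fib C (obj X b))" if "x \<in> fibre X b" for x
    using that homeomorphic_imp_surjective_map by (fastforce simp: fibre_def)
  show ?thesis
  proof
    assume "\<exists>\<phi>. represents C X Y f fb b \<phi>"
    then obtain \<phi> where "represents C X Y f fb b \<phi>" by blast
    then show "\<exists>g. arr_map (obj X b) (obj Y (fb b)) g \<and> (\<forall>x\<in>fibre X b. chart Y (fb b) (f x) = g (chart X b x))"
      by (intro exI[of _ "act C \<phi>"]) (auto simp: represents_def arr_map_def)
  next
    assume "\<exists>g. arr_map (obj X b) (obj Y (fb b)) g \<and> (\<forall>x\<in>fibre X b. chart Y (fb b) (f x) = g (chart X b x))"
    then show "\<exists>\<phi>. represents C X Y f fb b \<phi>"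
      using ch by (force simp: represents_def arr_map_def)
  qed
qed

text \<open>In a groupoid any representing arrow is invertible, so the \<open>fibre_iso\<close>
  conditions in \<open>F_pushout\<close> come with the maps of families themselves.\<close>

lemma fibre_isoI:
  assumes "represents C X Y f fb b \<phi>"
  shows "fibre_iso C X Y f fb b"
proof -
  have p: "\<phi> \<in> Arr C" using assms by (simp add: represents_def)
  obtain \<psi> where \<psi>: "\<psi> \<in> Arr C" "Dom C \<psi> = Cod C \<phi>" "Cod C \<psi> = Dom C \<phi>"
    "Comp C \<psi> \<phi> = Ide C (Dom C \<phi>)" "Comp C \<phi> \<psi> = Ide C (Cod C \<phi>)"
    using gr p unfolding groupoid_def isomorphism_def by metis
  have ob: "Dom C \<phi> \<in> Obj C" "Cod C \<phi> \<in> Obj C" using cat p unfolding category_def by auto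
  have ide: "\<And>V v. V \<in> Obj C \<Longrightarrow> v \<in> topspace (fib C V) \<Longrightarrow> act C (Ide C V) v = v"
    using sc unfolding structure_category_def by auto
  have cmp: "\<And>\<phi> \<psi> v. \<phi> \<in> Arr C \<Longrightarrow> \<psi> \<in> Arr C \<Longrightarrow> Dom C \<psi> = Cod C \<phi> \<Longrightarrow> v \<in> topspace (fib C (Dom C \<phi>))
      \<Longrightarrow> act C (Comp C \<psi> \<phi>) v = act C \<psi> (act C \<phi> v)"
    using sc unfolding structure_category_def by blast
  show ?thesis
    unfolding fibre_iso_def
  proof (intro exI conjI ballI)
    fix v assume v: "v \<in> topspace (fib C (Dom C \<phi>))"
    show "act C \<psi> (act C \<phi> v) = v"
      using cmp[OF p \<psi>(1,2) v] ide[OF ob(1) v] \<psi>(4) by simp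
  next
    fix w assume w: "w \<in> topspace (fib C (Cod C \<phi>))"
    show "act C \<phi> (act C \<psi> w) = w"
      using cmp[OF \<psi>(1) p, of w] \<psi>(2,3,5) ide[OF ob(2) w] w by simp
  qed (use assms \<psi> in auto)
qed

text \<open>An admissible parametrization: read in the chart it is a morphism. As \<open>V\<close>
  may differ from \<open>obj X b\<close>, one object can serve for many points, and the chosen
  charts, of which nothing is known as \<open>b\<close> varies, disappear from the
  arguments.\<close>

definition fibre_param :: "('x, 'b, 'o, 'f) family \<Rightarrow> 'b \<Rightarrow> 'o \<Rightarrow> ('f \<Rightarrow> 'x) \<Rightarrow> bool" where
  "fibre_param X b V p \<longleftrightarrow>
     (\<exists>g. arr_map V (obj X b) g \<and>
        (\<forall>v\<in>topspace (fib C V). p v \<in> fibre X b \<and> chart X b (p v) = g v))"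

lemma chart_homeo:
  assumes "F_family C X" and "b \<in> topspace (base X)"
  shows "homeomorphic_map (subtopology (total X) (fibre X b)) (fib C (obj X b)) (chart X b)"
    and "bij_betw (chart X b) (fibre X b) (topspace (fib C (obj X b)))"
proof -
  show h: "homeomorphic_map (subtopology (total X) (fibre X b)) (fib C (obj X b)) (chart X b)"
    using assms by (auto simp: F_family_def)
  have "topspace (subtopology (total X) (fibre X b)) = fibre X b" by (auto simp: fibre_def)
  then show "bij_betw (chart X b) (fibre X b) (topspace (fib C (obj X b)))"
    using homeomorphic_imp_injective_map[OF h] homeomorphic_imp_surjective_map[OF h]
    by (simp add: bij_betw_def)
qed

text \<open>In the chart \<open>p\<close> becomes a morphism, hence a homeomorphism; so
  \<open>p\<close> is that morphism followed by the inverse chart.\<close>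

lemma fibre_param_homeo:
  assumes X: "F_family C X" and b: "b \<in> topspace (base X)" and p: "fibre_param X b V p"
  shows "homeomorphic_map (fib C V) (subtopology (total X) (fibre X b)) p"
    and "bij_betw p (topspace (fib C V)) (fibre X b)"
proof -
  let ?F = "subtopology (total X) (fibre X b)"
  have tF: "topspace ?F = fibre X b" by (auto simp: fibre_def)
  obtain g where g: "arr_map V (obj X b) g"
    and pg: "\<And>v. v \<in> topspace (fib C V) \<Longrightarrow> p v \<in> fibre X b \<and> chart X b (p v) = g v"
    using p unfolding fibre_param_def by metis
  obtain g' where g': "homeomorphic_maps (fib C V) (fib C (obj X b)) g g'"
    using arr_map_inverse[OF g] by blast
  obtain ch' where ch': "homeomorphic_maps ?F (fib C (obj X b)) (chart X b) ch'"
    using chart_homeo(1)[OF X b] homeomorphic_map_maps by metis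
  have "homeomorphic_maps (fib C (obj X b)) ?F ch' (chart X b)"
    using ch' homeomorphic_maps_sym by blast
  then have "homeomorphic_map (fib C V) ?F (ch' \<circ> g)"
    using g' homeomorphic_map_compose homeomorphic_maps_map by metis
  moreover have "(ch' \<circ> g) v = p v" if "v \<in> topspace (fib C V)" for v
    using pg[OF that] ch' tF by (auto simp: homeomorphic_maps_def)
  ultimately show h: "homeomorphic_map (fib C V) ?F p"
    using homeomorphic_map_eq by metis
  show "bij_betw p (topspace (fib C V)) (fibre X b)"
    using homeomorphic_imp_injective_map[OF h] homeomorphic_imp_surjective_map[OF h]
    by (simp only: bij_betw_def tF)
qed

text \<open>Both parametrizations are morphisms in the chart, so the comparison is the morphism of
  \<open>p\<close> followed by the inverse of that of \<open>q\<close>. It is obtained for each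
  \<open>b\<close> separately; continuity in \<open>b\<close> is another matter.\<close>

lemma fibre_param_transition:
  assumes X: "F_family C X" and b: "b \<in> topspace (base X)"
    and p: "fibre_param X b V p" and q: "fibre_param X b W q"
  obtains g where "arr_map V W g" "\<And>v. v \<in> topspace (fib C V) \<Longrightarrow> q (g v) = p v"
proof -
  obtain g where g: "arr_map V (obj X b) g"
    and pg: "\<And>v. v \<in> topspace (fib C V) \<Longrightarrow> p v \<in> fibre X b \<and> chart X b (p v) = g v"
    using p unfolding fibre_param_def by metis
  obtain h where h: "arr_map W (obj X b) h"
    and qh: "\<And>v. v \<in> topspace (fib C W) \<Longrightarrow> q v \<in> fibre X b \<and> chart X b (q v) = h v"
    using q unfolding fibre_param_def by metis
  obtain h' where h': "arr_map (obj X b) W h'" "homeomorphic_maps (fib C W) (fib C (obj X b)) h h'"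
    using arr_map_inverse[OF h] by blast
  show thesis
  proof (rule that[OF arr_map_comp[OF g h'(1)]])
    fix v assume v: "v \<in> topspace (fib C V)"
    have gv: "g v \<in> topspace (fib C (obj X b))" using arr_map_in[OF g v] .
    have w: "h' (g v) \<in> topspace (fib C W)" using arr_map_in[OF h'(1) gv] .
    have "chart X b (q (h' (g v))) = chart X b (p v)"
      using qh[OF w] pg[OF v] h'(2) gv by (auto simp: homeomorphic_maps_def)
    then show "q (h' (g v)) = p v"
      using chart_homeo(2)[OF X b] qh[OF w] pg[OF v] by (auto simp: bij_betw_def inj_on_def)
  qed
qed

lemma fibre_param_comp:
  assumes p: "fibre_param X b W p" and g: "arr_map V W g"
  shows "fibre_param X b V (\<lambda>v. p (g v))"
proof -
  obtain h where h: "arr_map W (obj X b) h"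
    and ph: "\<And>v. v \<in> topspace (fib C W) \<Longrightarrow> p v \<in> fibre X b \<and> chart X b (p v) = h v"
    using p unfolding fibre_param_def by metis
  show ?thesis
    unfolding fibre_param_def using arr_map_comp[OF g h] ph arr_map_in[OF g] by blast
qed

lemma fibre_param_cong:
  "fibre_param X b V p \<Longrightarrow> (\<And>v. v \<in> topspace (fib C V) \<Longrightarrow> q v = p v) \<Longrightarrow> fibre_param X b V q"
  by (auto simp: fibre_param_def)

lemma fibre_param_chart_inverse:
  assumes X: "F_family C X" and b: "b \<in> topspace (base X)"
  shows "fibre_param X b (obj X b) (inv_into (fibre X b) (chart X b))"
proof -
  have bij: "bij_betw (chart X b) (fibre X b) (topspace (fib C (obj X b)))"
    by (rule chart_homeo(2)[OF X b])
  have "obj X b \<in> Obj C" using X b by (auto simp: F_family_def)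
  moreover have "inv_into (fibre X b) (chart X b) v \<in> fibre X b \<and>
      chart X b (inv_into (fibre X b) (chart X b) v) = v" if "v \<in> topspace (fib C (obj X b))" for v
    using bij that by (metis bij_betw_imp_surj_on f_inv_into_f inv_into_into)
  ultimately show ?thesis
    unfolding fibre_param_def using arr_map_id by blast
qed

lemma fibre_param_F_map:
  assumes X: "F_family C X" and f: "F_map C X Y f fb" and b: "b \<in> topspace (base X)"
    and p: "fibre_param X b V p"
  shows "fibre_param Y (fb b) V (\<lambda>v. f (p v))"
proof -
  obtain g where g: "arr_map V (obj X b) g"
    and pg: "\<And>v. v \<in> topspace (fib C V) \<Longrightarrow> p v \<in> fibre X b \<and> chart X b (p v) = g v"
    using p unfolding fibre_param_def by metis
  obtain h where h: "arr_map (obj X b) (obj Y (fb b)) h" "\<And>x. x \<in> fibre X b \<Longrightarrow> chart Y (fb b) (f x) = h (chart X b x)"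
    using f b represents_iff[OF X b, of Y f fb] by (auto simp: F_map_def)
  have "f (p v) \<in> fibre Y (fb b)" if "v \<in> topspace (fib C V)" for v
    using pg[OF that] f by (auto simp: fibre_def F_map_def continuous_map_def)
  then show ?thesis
    unfolding fibre_param_def using arr_map_comp[OF g h(1)] pg h(2) by (intro exI[of _ "\<lambda>v. h (g v)"]) auto
qed

text \<open>One admissible parametrization per fibre is enough: in charts \<open>f\<close> is the
  inverse of its morphism followed by the morphism of the image parametrization. That
  \<open>f\<close> covers \<open>fb\<close> follows too, because the parametrization is onto the
  fibre.\<close>

lemma F_mapI:
  assumes X: "F_family C X"
    and "continuous_map (total X) (total Y) f" and "continuous_map (base X) (base Y) fb"
    and par: "\<And>b. b \<in> topspace (base X) \<Longrightarrow> \<exists>V p. fibre_param X b V p \<and> fibre_param Y (fb b) V (\<lambda>v. f (p v))"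
  shows "F_map C X Y f fb"
proof -
  have 1: "\<exists>\<phi>. represents C X Y f fb b \<phi>" and 2: "\<And>x. x \<in> fibre X b \<Longrightarrow> f x \<in> fibre Y (fb b)"
    if b: "b \<in> topspace (base X)" for b
  proof -
    obtain V p where p: "fibre_param X b V p" and fp: "fibre_param Y (fb b) V (\<lambda>v. f (p v))"
      using par[OF b] by blast
    obtain g where g: "arr_map V (obj X b) g"
      and pg: "\<And>v. v \<in> topspace (fib C V) \<Longrightarrow> p v \<in> fibre X b \<and> chart X b (p v) = g v"
      using p unfolding fibre_param_def by metis
    obtain h where h: "arr_map V (obj Y (fb b)) h"
      and ph: "\<And>v. v \<in> topspace (fib C V) \<Longrightarrow> f (p v) \<in> fibre Y (fb b) \<and> chart Y (fb b) (f (p v)) = h v"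
      using fp unfolding fibre_param_def by metis
    obtain g' where g': "arr_map (obj X b) V g'" "homeomorphic_maps (fib C V) (fib C (obj X b)) g g'"
      using arr_map_inverse[OF g] by blast
    have bij: "bij_betw p (topspace (fib C V)) (fibre X b)" by (rule fibre_param_homeo(2)[OF X b p])
    show "f x \<in> fibre Y (fb b)" if "x \<in> fibre X b" for x
    proof -
      obtain v where "v \<in> topspace (fib C V)" "x = p v"
        using bij \<open>x \<in> fibre X b\<close> unfolding bij_betw_def by blast
      then show ?thesis using ph by simp
    qed
    have "chart Y (fb b) (f x) = h (g' (chart X b x))" if "x \<in> fibre X b" for x
    proof -
      obtain v where v: "v \<in> topspace (fib C V)" "x = p v"
        using bij \<open>x \<in> fibre X b\<close> unfolding bij_betw_def by blast
      then show ?thesis using ph[OF v(1)] pg[OF v(1)] g'(2) by (auto simp: homeomorphic_maps_def)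
    qed
    then show "\<exists>\<phi>. represents C X Y f fb b \<phi>"
      using arr_map_comp[OF g'(1) h] represents_iff[OF X b, of Y f fb] by blast
  qed
  have "proj X x \<in> topspace (base X) \<and> x \<in> fibre X (proj X x)" if "x \<in> topspace (total X)" for x
    using X that by (auto simp: F_family_def continuous_map_def fibre_def)
  then show ?thesis using assms(2,3) 1 2 by (auto simp: F_map_def fibre_def)
qed

section \<open>Trivializations\<close>

text \<open>A trivialization of the pull-back of \<open>X\<close> along \<open>c: T \<rightarrow> base X\<close>: \<open>\<Psi>\<close> is \<open>T \<times> F(V) \<rightarrow> c\<^sup>*X \<rightarrow> X\<close> and
  \<open>\<Theta>\<close> is the second component of the inverse of \<open>T \<times> F(V) \<rightarrow> c\<^sup>*X\<close>.\<close>

definition trivialization ::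
  "('x, 'b, 'o, 'f) family \<Rightarrow> 't topology \<Rightarrow> ('t \<Rightarrow> 'b) \<Rightarrow> 'o \<Rightarrow> ('t \<Rightarrow> 'f \<Rightarrow> 'x) \<Rightarrow> ('t \<Rightarrow> 'x \<Rightarrow> 'f) \<Rightarrow> bool" where
  "trivialization X T c V \<Psi> \<Theta> \<longleftrightarrow>
     V \<in> Obj C \<and> continuous_map T (base X) c \<and>
     continuous_map (prod_topology T (fib C V)) (total X) (\<lambda>p. \<Psi> (fst p) (snd p)) \<and>
     continuous_map (subtopology (prod_topology T (total X)) {p. proj X (snd p) = c (fst p)})
       (fib C V) (\<lambda>p. \<Theta> (fst p) (snd p)) \<and>
     (\<forall>t\<in>topspace T. fibre_param X (c t) V (\<Psi> t) \<and>
        (\<forall>v\<in>topspace (fib C V). \<Theta> t (\<Psi> t v) = v))"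

lemma trivialization_inverse:
  assumes X: "F_family C X" and tr: "trivialization X T c V \<Psi> \<Theta>"
    and t: "t \<in> topspace T" and x: "x \<in> fibre X (c t)"
  shows "\<Theta> t x \<in> topspace (fib C V)" and "\<Psi> t (\<Theta> t x) = x"
proof -
  have b: "c t \<in> topspace (base X)" using tr t by (auto simp: trivialization_def continuous_map_def)
  have "bij_betw (\<Psi> t) (topspace (fib C V)) (fibre X (c t))"
    using tr t by (intro fibre_param_homeo(2)[OF X b]) (auto simp: trivialization_def)
  then obtain v where v: "v \<in> topspace (fib C V)" "x = \<Psi> t v"
    using x unfolding bij_betw_def by blast
  then show "\<Theta> t x \<in> topspace (fib C V)" "\<Psi> t (\<Theta> t x) = x"
    using tr t by (auto simp: trivialization_def)
qed

lemma trivialization_in_fibre: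
  assumes "trivialization X T c V \<Psi> \<Theta>" and "t \<in> topspace T" and "v \<in> topspace (fib C V)"
  shows "\<Psi> t v \<in> fibre X (c t)"
  using assms by (auto simp: trivialization_def fibre_param_def)

lemma trivialization_continuous:
  assumes tr: "trivialization X T c V \<Psi> \<Theta>" and a: "continuous_map S T a"
  shows "continuous_map S (fib C V) b \<Longrightarrow> continuous_map S (total X) (\<lambda>s. \<Psi> (a s) (b s))"
    and "continuous_map S (total X) d \<Longrightarrow> (\<And>s. s \<in> topspace S \<Longrightarrow> proj X (d s) = c (a s))
      \<Longrightarrow> continuous_map S (fib C V) (\<lambda>s. \<Theta> (a s) (d s))"
proof -
  assume b: "continuous_map S (fib C V) b"
  have "continuous_map (prod_topology T (fib C V)) (total X) (\<lambda>p. \<Psi> (fst p) (snd p))"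
    using tr by (simp add: trivialization_def)
  from continuous_map_compose[OF continuous_map_pairedI[OF a b] this]
  show "continuous_map S (total X) (\<lambda>s. \<Psi> (a s) (b s))" by (simp add: comp_def)
next
  assume d: "continuous_map S (total X) d" and dc: "\<And>s. s \<in> topspace S \<Longrightarrow> proj X (d s) = c (a s)"
  have th: "continuous_map (subtopology (prod_topology T (total X)) {p. proj X (snd p) = c (fst p)})
       (fib C V) (\<lambda>p. \<Theta> (fst p) (snd p))"
    using tr by (simp add: trivialization_def)
  have "continuous_map S (subtopology (prod_topology T (total X)) {p. proj X (snd p) = c (fst p)}) (\<lambda>s. (a s, d s))"
    using a d dc by (auto intro!: continuous_map_into_subtopology continuous_map_pairedI)
  from continuous_map_compose[OF this th]
  show "continuous_map S (fib C V) (\<lambda>s. \<Theta> (a s) (d s))" by (simp add: comp_def)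
qed

lemma trivialization_pullback:
  assumes tr: "trivialization X T c V \<Psi> \<Theta>" and g: "continuous_map S T g"
    and c': "\<And>s. s \<in> topspace S \<Longrightarrow> c' s = c (g s)"
  shows "trivialization X S c' V (\<lambda>s. \<Psi> (g s)) (\<lambda>s. \<Theta> (g s))"
  unfolding trivialization_def
proof (intro conjI ballI)
  show "V \<in> Obj C" using tr by (simp add: trivialization_def)
  have "continuous_map S (base X) (c \<circ> g)"
    using tr g by (auto simp: trivialization_def intro: continuous_map_compose)
  then show "continuous_map S (base X) c'" by (rule continuous_map_eq) (simp add: c')
  show "continuous_map (prod_topology S (fib C V)) (total X) (\<lambda>p. \<Psi> (g (fst p)) (snd p))"
    by (intro trivialization_continuous(1)[OF tr] continuous_map_snd
        continuous_map_compose[OF continuous_map_fst g, unfolded comp_def])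
  show "continuous_map (subtopology (prod_topology S (total X)) {p. proj X (snd p) = c' (fst p)})
      (fib C V) (\<lambda>p. \<Theta> (g (fst p)) (snd p))"
    by (rule trivialization_continuous(2)[OF tr])
      (auto simp: c' intro!: continuous_map_from_subtopology continuous_map_snd
        continuous_map_compose[OF continuous_map_fst g, unfolded comp_def])
next
  fix s assume s: "s \<in> topspace S"
  then have gs: "g s \<in> topspace T" using g by (auto simp: continuous_map_def)
  show "fibre_param X (c' s) V (\<Psi> (g s))" using tr gs s by (simp add: trivialization_def c')
  show "\<Theta> (g s) (\<Psi> (g s) v) = v" if "v \<in> topspace (fib C V)" for v
    using tr gs that by (simp add: trivialization_def)
qed

lemma trivialization_subset:
  assumes tr: "trivialization X (subtopology T A) c V \<Psi> \<Theta>" and "B \<subseteq> A"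
  shows "trivialization X (subtopology T B) c V \<Psi> \<Theta>"
proof -
  have "continuous_map (subtopology T B) (subtopology T A) (\<lambda>x. x)"
    using assms(2) by (auto simp: continuous_map_in_subtopology intro: continuous_map_from_subtopology)
  from trivialization_pullback[OF tr this] show ?thesis by simp
qed

section \<open>Restriction and gluing of trivializations\<close>

lemma fibre_restrict: "b \<in> A \<Longrightarrow> fibre (restrict_fam X A) b = fibre X b"
  by (auto simp: fibre_def restrict_fam_def)

lemma restrict_simps [simp]:
  "total (restrict_fam X A) = subtopology (total X) {x \<in> topspace (total X). proj X x \<in> A}"
  "base (restrict_fam X A) = subtopology (base X) A"
  "proj (restrict_fam X A) = proj X" "obj (restrict_fam X A) = obj X" "chart (restrict_fam X A) = chart X"
  by (auto simp: restrict_fam_def)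

lemma F_family_restrict:
  assumes X: "F_family C X"
  shows "F_family C (restrict_fam X A)"
proof -
  have "continuous_map (total X) (base X) (proj X)" using X by (simp add: F_family_def)
  then have "continuous_map (total (restrict_fam X A)) (base (restrict_fam X A)) (proj (restrict_fam X A))"
    by (auto simp: continuous_map_in_subtopology intro: continuous_map_from_subtopology)
  moreover have "subtopology (total (restrict_fam X A)) (fibre (restrict_fam X A) b)
      = subtopology (total X) (fibre X b)" if "b \<in> A" for b
    unfolding fibre_restrict[OF that]
    using that by (auto simp: subtopology_subtopology fibre_def intro!: arg_cong[of _ _ "subtopology _"])
  ultimately show ?thesis
    using X by (auto simp: F_family_def)
qed

lemma fibre_param_restrict:
  "b \<in> A \<Longrightarrow> fibre_param (restrict_fam X A) b V p \<longleftrightarrow> fibre_param X b V p"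
  by (simp add: fibre_param_def fibre_restrict)

text \<open>Since \<open>c\<close> maps into \<open>A\<close>, every fibre involved lies over
  \<open>A\<close>. Only the ambient topologies change, and they induce the same topology on the
  part over \<open>A\<close>.\<close>

lemma trivialization_restrict:
  assumes X: "F_family C X" and sub: "c ` topspace T \<subseteq> A"
  shows "trivialization (restrict_fam X A) T c V \<Psi> \<Theta> \<longleftrightarrow> trivialization X T c V \<Psi> \<Theta>"
proof -
  let ?S = "{x \<in> topspace (total X). proj X x \<in> A}"
  have 1: "continuous_map T (base (restrict_fam X A)) c \<longleftrightarrow> continuous_map T (base X) c"
    using sub by (auto simp: continuous_map_in_subtopology)
  have 2: "(\<forall>t\<in>topspace T. fibre_param (restrict_fam X A) (c t) V (\<Psi> t) \<and> (\<forall>v\<in>topspace (fib C V). \<Theta> t (\<Psi> t v) = v))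
    \<longleftrightarrow> (\<forall>t\<in>topspace T. fibre_param X (c t) V (\<Psi> t) \<and> (\<forall>v\<in>topspace (fib C V). \<Theta> t (\<Psi> t v) = v))"
    using sub by (simp add: fibre_param_restrict image_subset_iff)
  have 3: "continuous_map (prod_topology T (fib C V)) (total (restrict_fam X A)) (\<lambda>p. \<Psi> (fst p) (snd p))
    \<longleftrightarrow> continuous_map (prod_topology T (fib C V)) (total X) (\<lambda>p. \<Psi> (fst p) (snd p))"
    if "\<forall>t\<in>topspace T. fibre_param X (c t) V (\<Psi> t) \<and> (\<forall>v\<in>topspace (fib C V). \<Theta> t (\<Psi> t v) = v)"
  proof -
    have "\<Psi> t v \<in> ?S" if "t \<in> topspace T" "v \<in> topspace (fib C V)" for t v
    proof -
      have "\<Psi> t v \<in> fibre X (c t)" using that \<open>\<forall>t\<in>topspace T. _\<close> by (auto simp: fibre_param_def)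
      moreover have "c t \<in> A" using sub that by blast
      ultimately show ?thesis by (simp add: fibre_def)
    qed
    then show ?thesis by (auto simp: continuous_map_in_subtopology)
  qed
  have "subtopology (prod_topology T (total (restrict_fam X A))) {p. proj X (snd p) = c (fst p)}
     = subtopology (prod_topology T (total X)) {p. proj X (snd p) = c (fst p)}"
  proof -
    have "prod_topology T (total (restrict_fam X A)) = subtopology (prod_topology T (total X)) (topspace T \<times> ?S)"
      by (simp add: subtopology_Times)
    then show ?thesis
      unfolding subtopology_subtopology
      by (subst (1 2) subtopology_restrict[symmetric])
        (use sub in \<open>auto simp: subtopology_subtopology intro!: arg_cong[of _ _ "subtopology _"]\<close>)
  qed
  then show ?thesis
    unfolding trivialization_def 1 2 restrict_simps(3) using 3 by auto
qed

text \<open>The first trivialization is corrected so as to match the second on the overlap: at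
  \<open>t\<close> in \<open>T1\<close> the transition map over \<open>\<rho> t\<close>, that is
  \<open>\<Psi>2 (\<rho> t)\<close> followed by \<open>\<Theta>1 (\<rho> t)\<close>, is inserted
  before \<open>\<Psi>1 t\<close>. It is continuous because trivializations carry continuous
  inverses, and where \<open>\<rho>\<close> is the identity the corrected map is
  \<open>\<Psi>2 t\<close>.\<close>

lemma trivialization_glue:
  assumes X: "F_family C X" and c: "continuous_map T (base X) c"
    and T1: "closedin T T1" and T2: "closedin T T2" and TT: "T1 \<union> T2 = topspace T"
    and tr1: "trivialization X (subtopology T T1) c V1 \<Psi>1 \<Theta>1"
    and tr2: "trivialization X (subtopology T T2) c V2 \<Psi>2 \<Theta>2"
    and \<rho>: "continuous_map (subtopology T T1) (subtopology T (T1 \<inter> T2)) \<rho>"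
    and \<rho>_id: "\<And>t. t \<in> T1 \<inter> T2 \<Longrightarrow> \<rho> t = t"
  shows "\<exists>\<Psi> \<Theta>. trivialization X T c V2 \<Psi> \<Theta>"
proof -
  define \<Psi> where "\<Psi> t v = (if t \<in> T2 then \<Psi>2 t v else \<Psi>1 t (\<Theta>1 (\<rho> t) (\<Psi>2 (\<rho> t) v)))" for t v
  define \<Theta> where "\<Theta> t x = (if t \<in> T2 then \<Theta>2 t x else \<Theta>2 (\<rho> t) (\<Psi>1 (\<rho> t) (\<Theta>1 t x)))" for t x
  have sT: "T1 \<subseteq> topspace T" "T2 \<subseteq> topspace T" using T1 T2 closedin_subset by auto
  have tops: "topspace (subtopology T T1) = T1" "topspace (subtopology T T2) = T2" using sT by auto
  have \<rho>T: "\<rho> t \<in> T1" "\<rho> t \<in> T2" if "t \<in> T1" for t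
    using \<rho> that sT by (auto simp: continuous_map_def)
  have \<rho>1: "continuous_map (subtopology T T1) (subtopology T T1) \<rho>"
    and \<rho>2: "continuous_map (subtopology T T1) (subtopology T T2) \<rho>"
    using \<rho> by (auto simp: continuous_map_in_subtopology)
  let ?V1 = "fib C V1" and ?V2 = "fib C V2"
  note in1 = trivialization_in_fibre[OF tr1, unfolded tops] and in2 = trivialization_in_fibre[OF tr2, unfolded tops]
  note inv1 = trivialization_inverse[OF X tr1, unfolded tops] and inv2 = trivialization_inverse[OF X tr2, unfolded tops]
  have l1: "\<Theta>1 t (\<Psi>1 t v) = v" if "t \<in> T1" "v \<in> topspace ?V1" for t v
    using tr1 that tops by (auto simp: trivialization_def)
  have l2: "\<Theta>2 t (\<Psi>2 t v) = v" if "t \<in> T2" "v \<in> topspace ?V2" for t v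
    using tr2 that tops by (auto simp: trivialization_def)
  have tr: "trivialization X T c V2 \<Psi> \<Theta>"
    unfolding trivialization_def
  proof (intro conjI ballI)
    show V2: "V2 \<in> Obj C" using tr2 by (simp add: trivialization_def)
    let ?S = "prod_topology T ?V2"
    have "continuous_map ?S (total X) (\<lambda>p. if p \<in> T2 \<times> topspace ?V2 then \<Psi>2 (fst p) (snd p)
        else \<Psi>1 (fst p) (\<Theta>1 (\<rho> (fst p)) (\<Psi>2 (\<rho> (fst p)) (snd p))))"
    proof (rule continuous_map_paste[where B = "T1 \<times> topspace ?V2"])
      have e: "subtopology ?S (A \<times> topspace ?V2) = prod_topology (subtopology T A) ?V2" for A
        by (simp add: subtopology_Times)
      show "continuous_map (subtopology ?S (T2 \<times> topspace ?V2)) (total X) (\<lambda>p. \<Psi>2 (fst p) (snd p))"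
        unfolding e by (intro trivialization_continuous(1)[OF tr2] continuous_map_fst continuous_map_snd)
      let ?P = "prod_topology (subtopology T T1) ?V2"
      have r: "continuous_map ?P (subtopology T T1) (\<lambda>p. \<rho> (fst p))"
        "continuous_map ?P (subtopology T T2) (\<lambda>p. \<rho> (fst p))"
        using continuous_map_compose[OF continuous_map_fst \<rho>1] continuous_map_compose[OF continuous_map_fst \<rho>2]
        by (auto simp: comp_def)
      have "continuous_map ?P ?V1 (\<lambda>p. \<Theta>1 (\<rho> (fst p)) (\<Psi>2 (\<rho> (fst p)) (snd p)))"
      proof (rule trivialization_continuous(2)[OF tr1 r(1)])
        show "continuous_map ?P (total X) (\<lambda>p. \<Psi>2 (\<rho> (fst p)) (snd p))"
          by (intro trivialization_continuous(1)[OF tr2] r continuous_map_snd)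
        show "proj X (\<Psi>2 (\<rho> (fst p)) (snd p)) = c (\<rho> (fst p))" if "p \<in> topspace ?P" for p
          using in2[of "\<rho> (fst p)" "snd p"] that \<rho>T by (auto simp: fibre_def)
      qed
      then show "continuous_map (subtopology ?S (T1 \<times> topspace ?V2)) (total X)
          (\<lambda>p. \<Psi>1 (fst p) (\<Theta>1 (\<rho> (fst p)) (\<Psi>2 (\<rho> (fst p)) (snd p))))"
        unfolding e by (intro trivialization_continuous(1)[OF tr1] continuous_map_fst)
      fix p assume "p \<in> T2 \<times> topspace ?V2" "p \<in> T1 \<times> topspace ?V2"
      then show "\<Psi>2 (fst p) (snd p) = \<Psi>1 (fst p) (\<Theta>1 (\<rho> (fst p)) (\<Psi>2 (\<rho> (fst p)) (snd p)))"
        using \<rho>_id in2 inv1(2) by auto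
    qed (use T1 T2 TT in \<open>auto simp: closedin_prod_Times_iff\<close>)
    then show "continuous_map ?S (total X) (\<lambda>p. \<Psi> (fst p) (snd p))"
      by (rule continuous_map_eq) (auto simp: \<Psi>_def)
    let ?R = "subtopology (prod_topology T (total X)) {p. proj X (snd p) = c (fst p)}"
    have "continuous_map ?R ?V2 (\<lambda>p. if p \<in> {p \<in> topspace ?R. fst p \<in> T2} then \<Theta>2 (fst p) (snd p)
       else \<Theta>2 (\<rho> (fst p)) (\<Psi>1 (\<rho> (fst p)) (\<Theta>1 (fst p) (snd p))))"
    proof (rule continuous_map_paste[where B = "{p \<in> topspace ?R. fst p \<in> T1}"])
      have f: "continuous_map ?R T fst"
        by (intro continuous_map_from_subtopology continuous_map_fst)
      show "closedin ?R {p \<in> topspace ?R. fst p \<in> T2}" "closedin ?R {p \<in> topspace ?R. fst p \<in> T1}"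
        using closedin_continuous_map_preimage[OF f] T1 T2 by auto
      have r: "continuous_map (subtopology ?R {p \<in> topspace ?R. fst p \<in> A}) (subtopology T A) fst" for A
        by (auto simp: continuous_map_in_subtopology intro!: continuous_map_from_subtopology[OF f])
      have s: "continuous_map (subtopology ?R A) (total X) snd" for A
        by (intro continuous_map_from_subtopology continuous_map_snd)
      let ?R1 = "subtopology ?R {p \<in> topspace ?R. fst p \<in> T1}" and ?R2 = "subtopology ?R {p \<in> topspace ?R. fst p \<in> T2}"
      show "continuous_map ?R2 ?V2 (\<lambda>p. \<Theta>2 (fst p) (snd p))"
        by (rule trivialization_continuous(2)[OF tr2 r s]) auto
      have \<theta>1: "continuous_map ?R1 ?V1 (\<lambda>p. \<Theta>1 (fst p) (snd p))"
        by (rule trivialization_continuous(2)[OF tr1 r s]) auto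
      have rr: "continuous_map ?R1 (subtopology T T1) (\<lambda>p. \<rho> (fst p))"
        "continuous_map ?R1 (subtopology T T2) (\<lambda>p. \<rho> (fst p))"
        using continuous_map_compose[OF r \<rho>1] continuous_map_compose[OF r \<rho>2] by (auto simp: comp_def)
      have R1: "fst p \<in> T1" "snd p \<in> fibre X (c (fst p))" "proj X (snd p) = c (fst p)" if "p \<in> topspace ?R1" for p
        using that by (auto simp: fibre_def)
      show "continuous_map ?R1 ?V2 (\<lambda>p. \<Theta>2 (\<rho> (fst p)) (\<Psi>1 (\<rho> (fst p)) (\<Theta>1 (fst p) (snd p))))"
      proof (rule trivialization_continuous(2)[OF tr2 rr(2)])
        show "continuous_map ?R1 (total X) (\<lambda>p. \<Psi>1 (\<rho> (fst p)) (\<Theta>1 (fst p) (snd p)))"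
          by (rule trivialization_continuous(1)[OF tr1 rr(1) \<theta>1])
        show "proj X (\<Psi>1 (\<rho> (fst p)) (\<Theta>1 (fst p) (snd p))) = c (\<rho> (fst p))" if p: "p \<in> topspace ?R1" for p
          using in1[OF \<rho>T(1)[OF R1(1)[OF p]] inv1(1)[OF R1(1,2)[OF p]]] by (simp add: fibre_def)
      qed
      fix p assume "p \<in> {p \<in> topspace ?R. fst p \<in> T2}" "p \<in> {p \<in> topspace ?R. fst p \<in> T1}"
      then have p: "fst p \<in> T1" "fst p \<in> T2" "snd p \<in> fibre X (c (fst p))" by (auto simp: fibre_def)
      then show "\<Theta>2 (fst p) (snd p) = \<Theta>2 (\<rho> (fst p)) (\<Psi>1 (\<rho> (fst p)) (\<Theta>1 (fst p) (snd p)))"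
        using \<rho>_id inv1(2) by auto
    next
      have "fst p \<in> T2 \<or> fst p \<in> T1" if "p \<in> topspace ?R" for p
      proof -
        have "fst p \<in> topspace T" using that by auto
        then show ?thesis using TT by blast
      qed
      then show "{p \<in> topspace ?R. fst p \<in> T2} \<union> {p \<in> topspace ?R. fst p \<in> T1} = topspace ?R"
        by blast
    qed
    then show "continuous_map ?R ?V2 (\<lambda>p. \<Theta> (fst p) (snd p))"
      by (rule continuous_map_eq) (auto simp: \<Theta>_def)
  next
    fix t assume t: "t \<in> topspace T"
    show "fibre_param X (c t) V2 (\<Psi> t)"
    proof (cases "t \<in> T2")
      case True
      then have "fibre_param X (c t) V2 (\<Psi>2 t)" using tr2 tops by (auto simp: trivialization_def)
      then show ?thesis by (rule fibre_param_cong) (simp add: \<Psi>_def True)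
    next
      case False
      then have t1: "t \<in> T1" using t TT by auto
      have b: "c (\<rho> t) \<in> topspace (base X)" using c \<rho>T(1)[OF t1] sT by (auto simp: continuous_map_def)
      have p: "fibre_param X (c (\<rho> t)) V2 (\<Psi>2 (\<rho> t))"
        using tr2 \<rho>T[OF t1] tops by (auto simp: trivialization_def)
      have q: "fibre_param X (c (\<rho> t)) V1 (\<Psi>1 (\<rho> t))"
        using tr1 \<rho>T[OF t1] tops by (auto simp: trivialization_def)
      \<comment> \<open>The correction at \<open>t\<close> compares two parametrizations of the
        fibre over \<open>c (\<rho> t)\<close>, hence is a morphism.\<close>
      obtain g where g: "arr_map V2 V1 g" "\<And>v. v \<in> topspace ?V2 \<Longrightarrow> \<Psi>1 (\<rho> t) (g v) = \<Psi>2 (\<rho> t) v"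
        using fibre_param_transition[OF X b p q] by blast
      have "\<Theta>1 (\<rho> t) (\<Psi>2 (\<rho> t) v) = g v" if "v \<in> topspace ?V2" for v
        using l1[OF \<rho>T(1)[OF t1] arr_map_in[OF g(1) that]] g(2)[OF that] by simp
      moreover have "fibre_param X (c t) V2 (\<lambda>v. \<Psi>1 t (g v))"
        using tr1 t1 tops by (intro fibre_param_comp[OF _ g(1)]) (auto simp: trivialization_def)
      ultimately show ?thesis by (rule_tac fibre_param_cong) (auto simp: \<Psi>_def False)
    qed
    fix v assume v: "v \<in> topspace ?V2"
    show "\<Theta> t (\<Psi> t v) = v"
    proof (cases "t \<in> T2")
      case True
      then show ?thesis using l2 v by (simp add: \<Theta>_def \<Psi>_def)
    next
      case False
      then have t1: "t \<in> T1" using t TT by auto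
      have m: "\<Psi>2 (\<rho> t) v \<in> fibre X (c (\<rho> t))" using in2 \<rho>T t1 v by simp
      then have w: "\<Theta>1 (\<rho> t) (\<Psi>2 (\<rho> t) v) \<in> topspace ?V1" using inv1(1) \<rho>T t1 by simp
      then show ?thesis
        using l1[OF t1 w] inv1(2)[OF \<rho>T(1)[OF t1] m] l2[OF \<rho>T(2)[OF t1] v]
        by (simp add: \<Theta>_def \<Psi>_def False)
    qed
  qed (rule c)
  then show ?thesis by blast
qed

section \<open>Product families and local triviality\<close>

lemma fibre_param_product:
  assumes "V \<in> Obj C" "b \<in> topspace U"
  shows "fibre_param (product_fam C U V) b V (\<lambda>v. (b, v))"
  unfolding fibre_param_def
  using arr_map_id[OF assms(1)] assms(2)
  by (intro exI[of _ "\<lambda>v. v"]) (auto simp: product_fam_def fibre_def)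

lemma F_family_product:
  assumes "V \<in> Obj C"
  shows "F_family C (product_fam C U V)"
  unfolding F_family_def
proof (intro conjI ballI)
  show "continuous_map (total (product_fam C U V)) (base (product_fam C U V)) (proj (product_fam C U V))"
    by (auto simp: product_fam_def continuous_map_fst)
next
  fix b assume b: "b \<in> topspace (base (product_fam C U V))"
  show "obj (product_fam C U V) b \<in> Obj C" using assms by (simp add: product_fam_def)
  have "fibre (product_fam C U V) b = {b} \<times> topspace (fib C V)"
    using b by (auto simp: fibre_def product_fam_def)
  moreover have "homeomorphic_maps (subtopology (prod_topology U (fib C V)) ({b} \<times> topspace (fib C V))) (fib C V) snd (Pair b)"
    using b by (auto simp: homeomorphic_maps_def product_fam_def continuous_map_in_subtopology
        intro!: continuous_map_from_subtopology continuous_map_snd continuous_map_pairedI)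
  ultimately show "homeomorphic_map (subtopology (total (product_fam C U V)) (fibre (product_fam C U V) b))
      (fib C (obj (product_fam C U V) b)) (chart (product_fam C U V) b)"
    by (auto simp: product_fam_def homeomorphic_map_maps)
qed

text \<open>An isomorphism with the product may cover a homeomorphism \<open>fb\<close> of
  \<open>U\<close> other than the identity. Evaluating the inverse \<open>g\<close> over
  \<open>fb b\<close> undoes this, so the resulting trivialization lies over the identity of
  \<open>U\<close>.\<close>

lemma F_isomorphic_product_imp_trivialization:
  assumes X: "F_family C X" and V: "V \<in> Obj C" and U: "U \<subseteq> topspace (base X)"
    and iso: "F_isomorphic C (restrict_fam X U) (product_fam C (subtopology (base X) U) V)"
  shows "\<exists>\<Psi> \<Theta>. trivialization X (subtopology (base X) U) (\<lambda>b. b) V \<Psi> \<Theta>"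
proof -
  let ?U = "subtopology (base X) U" and ?XU = "restrict_fam X U"
  let ?P = "product_fam C ?U V"
  have tU: "topspace ?U = U" using U by auto
  obtain f fb g gb where f: "F_map C ?XU ?P f fb" and g: "F_map C ?P ?XU g gb"
    and gf: "\<And>x. x \<in> topspace (total ?XU) \<Longrightarrow> g (f x) = x" and fg: "\<And>y. y \<in> topspace (total ?P) \<Longrightarrow> f (g y) = y"
    and gfb: "\<And>b. b \<in> topspace (base ?XU) \<Longrightarrow> gb (fb b) = b"
    using iso unfolding F_isomorphic_def by auto
  have fb: "continuous_map ?U ?U fb" using f by (auto simp: F_map_def product_fam_def)
  have fbU: "fb b \<in> U" if "b \<in> U" for b using fb that tU by (auto simp: continuous_map_def)
  have gc: "continuous_map (prod_topology ?U (fib C V)) (total ?XU) g"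
    using g by (simp add: F_map_def product_fam_def)
  have fc: "continuous_map (total ?XU) (prod_topology ?U (fib C V)) f"
    using f by (simp add: F_map_def product_fam_def)
  have "trivialization ?XU ?U (\<lambda>b. b) V (\<lambda>b v. g (fb b, v)) (\<lambda>b x. snd (f x))"
    unfolding trivialization_def
  proof (intro conjI ballI)
    have "continuous_map (prod_topology ?U (fib C V)) (prod_topology ?U (fib C V)) (\<lambda>p. (fb (fst p), snd p))"
      by (intro continuous_map_pairedI continuous_map_snd continuous_map_compose[OF continuous_map_fst fb, unfolded comp_def])
    from continuous_map_compose[OF this gc]
    show "continuous_map (prod_topology ?U (fib C V)) (total ?XU) (\<lambda>p. g (fb (fst p), snd p))"
      by (simp only: comp_def)
    have "continuous_map (total ?XU) (fib C V) (\<lambda>x. snd (f x))"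
      using continuous_map_compose[OF fc continuous_map_snd] by (simp add: comp_def)
    then have "continuous_map (prod_topology ?U (total ?XU)) (fib C V) (\<lambda>p. snd (f (snd p)))"
      using continuous_map_compose[OF continuous_map_snd] by (fastforce simp only: comp_def)
    then show "continuous_map (subtopology (prod_topology ?U (total ?XU)) {p. proj ?XU (snd p) = fst p})
       (fib C V) (\<lambda>p. snd (f (snd p)))"
      by (rule continuous_map_from_subtopology)
  next
    fix b assume b: "b \<in> topspace ?U"
    have bb: "fb b \<in> topspace ?U" using b fbU tU by simp
    have "fibre_param ?XU (gb (fb b)) V (\<lambda>v. g (fb b, v))"
      by (rule fibre_param_F_map[OF F_family_product[OF V] g _ fibre_param_product[OF V bb]])
        (use bb in \<open>simp add: product_fam_def\<close>)
    then show "fibre_param ?XU b V (\<lambda>v. g (fb b, v))" using gfb b by simp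
    fix v assume "v \<in> topspace (fib C V)"
    then show "snd (f (g (fb b, v))) = v" using fg[of "(fb b, v)"] bb by (simp add: product_fam_def)
  qed (use V in \<open>auto simp: continuous_map_in_subtopology\<close>)
  then show ?thesis using trivialization_restrict[OF X, of "\<lambda>b. b" ?U U] tU by auto
qed

lemma trivialization_imp_F_isomorphic_product:
  assumes X: "F_family C X" and U: "U \<subseteq> topspace (base X)"
    and tr: "trivialization X (subtopology (base X) U) (\<lambda>b. b) V \<Psi> \<Theta>"
  shows "F_isomorphic C (restrict_fam X U) (product_fam C (subtopology (base X) U) V)"
proof -
  let ?U = "subtopology (base X) U" and ?XU = "restrict_fam X U"
  let ?P = "product_fam C ?U V"
  have tU: "topspace ?U = U" using U by auto
  have V: "V \<in> Obj C" using tr by (simp add: trivialization_def)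
  have XU: "F_family C ?XU" by (rule F_family_restrict[OF X])
  have tr': "trivialization ?XU ?U (\<lambda>b. b) V \<Psi> \<Theta>"
    using tr trivialization_restrict[OF X, of "\<lambda>b. b" ?U U] tU by auto
  have pr: "continuous_map (total ?XU) ?U (proj X)" using XU by (simp add: F_family_def)
  have prU: "proj X x \<in> U" if "x \<in> topspace (total ?XU)" for x using that by auto
  let ?f = "\<lambda>x. (proj X x, \<Theta> (proj X x) x)" and ?g = "\<lambda>p. \<Psi> (fst p) (snd p)"
  have fc: "continuous_map (total ?XU) (total ?P) ?f"
  proof -
    have "continuous_map (total ?XU) (fib C V) (\<lambda>x. \<Theta> (proj X x) x)"
      by (rule trivialization_continuous(2)[OF tr' pr]) auto
    then show ?thesis using pr by (auto simp: product_fam_def intro: continuous_map_pairedI)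
  qed
  have gc: "continuous_map (total ?P) (total ?XU) ?g"
    using tr' by (simp add: trivialization_def product_fam_def)
  have par: "fibre_param ?XU b V (\<Psi> b)" if "b \<in> U" for b
    using tr' that tU by (simp add: trivialization_def)
  have l: "\<Theta> b (\<Psi> b v) = v" "proj X (\<Psi> b v) = b" if "b \<in> U" "v \<in> topspace (fib C V)" for b v
    using tr' that tU trivialization_in_fibre[OF tr', of b v] by (auto simp: trivialization_def fibre_def)
  have "F_map C ?XU ?P ?f (\<lambda>b. b)"
  proof (rule F_mapI[OF XU fc])
    show "continuous_map (base ?XU) (base ?P) (\<lambda>b. b)" by (simp add: product_fam_def)
    fix b assume "b \<in> topspace (base ?XU)"
    then have b: "b \<in> U" by simp
    have "fibre_param ?P b V (\<lambda>v. ?f (\<Psi> b v))"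
      by (rule fibre_param_cong[OF fibre_param_product[OF V]]) (use b tU l in auto)
    then show "\<exists>V p. fibre_param ?XU b V p \<and> fibre_param ?P b V (\<lambda>v. ?f (p v))"
      using par[OF b] by blast
  qed
  moreover have "F_map C ?P ?XU ?g (\<lambda>b. b)"
  proof (rule F_mapI[OF F_family_product[OF V] gc])
    show "continuous_map (base ?P) (base ?XU) (\<lambda>b. b)" by (simp add: product_fam_def)
    fix b assume "b \<in> topspace (base ?P)"
    then have b: "b \<in> U" "b \<in> topspace ?U" by (simp_all add: product_fam_def)
    show "\<exists>V' p. fibre_param ?P b V' p \<and> fibre_param ?XU b V' (\<lambda>v. ?g (p v))"
      using fibre_param_product[OF V b(2)] par[OF b(1)] by (intro exI[of _ V] exI[of _ "\<lambda>v. (b, v)"]) simp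
  qed
  moreover have "?g (?f x) = x" if "x \<in> topspace (total ?XU)" for x
    using trivialization_inverse(2)[OF XU tr', of "proj X x" x] that U by (auto simp: fibre_def)
  moreover have "?f (?g y) = y" if "y \<in> topspace (total ?P)" for y
  proof -
    obtain b v where y: "y = (b, v)" by (cases y)
    have "b \<in> U" "v \<in> topspace (fib C V)" using that tU by (auto simp: product_fam_def y)
    then show ?thesis using l by (simp add: y)
  qed
  ultimately show ?thesis unfolding F_isomorphic_def by (intro exI conjI) auto
qed

definition locally_trivial_at :: "('x, 'b, 'o, 'f) family \<Rightarrow> 'b \<Rightarrow> bool" where
  "locally_trivial_at X b \<longleftrightarrow> (\<exists>W V \<Psi> \<Theta>. openin (base X) W \<and> b \<in> W \<and>
     trivialization X (subtopology (base X) W) (\<lambda>b. b) V \<Psi> \<Theta>)"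

lemma locally_trivial_atI:
  "openin (base X) W \<Longrightarrow> b \<in> W \<Longrightarrow> trivialization X (subtopology (base X) W) (\<lambda>b. b) V \<Psi> \<Theta>
    \<Longrightarrow> locally_trivial_at X b"
  unfolding locally_trivial_at_def by (intro exI conjI)

lemma locally_trivial_atE:
  assumes "locally_trivial_at X b"
  obtains W V \<Psi> \<Theta> where "openin (base X) W" "b \<in> W"
    "trivialization X (subtopology (base X) W) (\<lambda>b. b) V \<Psi> \<Theta>"
  using assms unfolding locally_trivial_at_def by (elim exE conjE)

text \<open>The neighbourhood \<open>U\<close> in the definition need not be open; its
  trivialization is cut down to the open \<open>W\<close> inside it. Conversely an open
  \<open>W\<close> serves as its own \<open>U\<close>.\<close>

lemma F_bundle_iff:
  "F_bundle C X \<longleftrightarrow> F_family C X \<and> (\<forall>b\<in>topspace (base X). locally_trivial_at X b)"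
proof (intro iffI conjI ballI; (elim conjE)?)
  assume B: "F_bundle C X"
  then show X: "F_family C X" by (simp add: F_bundle_def)
  fix b assume b: "b \<in> topspace (base X)"
  have "\<exists>W U V. openin (base X) W \<and> b \<in> W \<and> W \<subseteq> U \<and> U \<subseteq> topspace (base X) \<and> V \<in> Obj C \<and>
       F_isomorphic C (restrict_fam X U) (product_fam C (subtopology (base X) U) V)"
    using B b by (simp add: F_bundle_def)
  then obtain W U V where W: "openin (base X) W" "b \<in> W" "W \<subseteq> U" "U \<subseteq> topspace (base X)" "V \<in> Obj C"
    "F_isomorphic C (restrict_fam X U) (product_fam C (subtopology (base X) U) V)"
    by (elim exE conjE)
  obtain \<Psi> \<Theta> where "trivialization X (subtopology (base X) U) (\<lambda>b. b) V \<Psi> \<Theta>"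
    using F_isomorphic_product_imp_trivialization[OF X W(5,4,6)] by (elim exE)
  then show "locally_trivial_at X b"
    by (rule locally_trivial_atI[OF W(1,2) trivialization_subset[OF _ W(3)]])
next
  assume X: "F_family C X" and A: "\<forall>b\<in>topspace (base X). locally_trivial_at X b"
  have "\<exists>W U V. openin (base X) W \<and> b \<in> W \<and> W \<subseteq> U \<and> U \<subseteq> topspace (base X) \<and> V \<in> Obj C \<and>
        F_isomorphic C (restrict_fam X U) (product_fam C (subtopology (base X) U) V)"
    if "b \<in> topspace (base X)" for b
  proof -
    obtain W V \<Psi> \<Theta> where W: "openin (base X) W" "b \<in> W"
      and tr: "trivialization X (subtopology (base X) W) (\<lambda>b. b) V \<Psi> \<Theta>"
      by (rule locally_trivial_atE[OF A[rule_format, OF \<open>b \<in> _\<close>]])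
    have V: "V \<in> Obj C" using tr by (simp add: trivialization_def)
    have sub: "W \<subseteq> topspace (base X)" using W(1) openin_subset by blast
    show ?thesis
      by (intro exI[of _ W] exI[of _ V] conjI W V sub subset_refl
          trivialization_imp_F_isomorphic_product[OF X sub tr])
  qed
  then show "F_bundle C X" using X by (simp add: F_bundle_def)
qed

lemma F_bundle_family: "F_bundle C X \<Longrightarrow> F_family C X"
  by (simp add: F_bundle_def)

lemma F_bundle_local:
  assumes "F_bundle C X" and c: "continuous_map T (base X) c" and t: "t \<in> topspace T"
  obtains W V \<Psi> \<Theta> where "openin T W" "t \<in> W" "trivialization X (subtopology T W) c V \<Psi> \<Theta>"
proof -
  have "c t \<in> topspace (base X)" using c t by (auto simp: continuous_map_def)
  then obtain W V \<Psi> \<Theta> where W: "openin (base X) W" "c t \<in> W"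
    and tr: "trivialization X (subtopology (base X) W) (\<lambda>b. b) V \<Psi> \<Theta>"
    using assms(1) unfolding F_bundle_iff by (elim conjE ballE locally_trivial_atE) auto
  let ?W = "{s \<in> topspace T. c s \<in> W}"
  have "continuous_map (subtopology T ?W) (subtopology (base X) W) c"
    using c by (auto simp: continuous_map_in_subtopology intro: continuous_map_from_subtopology)
  from trivialization_pullback[OF tr this, of c]
  have "trivialization X (subtopology T ?W) c V (\<lambda>s. \<Psi> (c s)) (\<lambda>s. \<Theta> (c s))" by simp
  moreover have "openin T ?W" by (rule openin_continuous_map_preimage[OF c W(1)])
  ultimately show thesis using that t W(2) by blast
qed

lemma F_bundle_restrict:
  assumes B: "F_bundle C X"
  shows "F_bundle C (restrict_fam X A)"
  unfolding F_bundle_iff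
proof (intro conjI ballI)
  note X = F_bundle_family[OF B]
  show "F_family C (restrict_fam X A)" by (rule F_family_restrict[OF X])
  fix b assume b: "b \<in> topspace (base (restrict_fam X A))"
  have c: "continuous_map (subtopology (base X) A) (base X) (\<lambda>b. b)"
    by (simp add: continuous_map_from_subtopology)
  have bA: "b \<in> topspace (subtopology (base X) A)" using b by simp
  obtain W V \<Psi> \<Theta> where W: "openin (subtopology (base X) A) W" "b \<in> W"
    and tr: "trivialization X (subtopology (subtopology (base X) A) W) (\<lambda>b. b) V \<Psi> \<Theta>"
    by (rule F_bundle_local[OF B c bA])
  have "W \<subseteq> A" using openin_subset[OF W(1)] by auto
  then have sub: "(\<lambda>b. b) ` topspace (subtopology (subtopology (base X) A) W) \<subseteq> A" by auto
  show "locally_trivial_at (restrict_fam X A) b"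
    by (rule locally_trivial_atI[of _ W])
      (use W tr trivialization_restrict[OF X sub] in \<open>simp_all only: restrict_simps\<close>)
qed

section \<open>Bundles over cubes and disks\<close>

text \<open>Induction on the number \<open>m\<close> of coordinates along which trivializations have
  been joined: every \<open>x\<close> has a trivial neighbourhood constrained only in the
  coordinates from \<open>m\<close> on. For \<open>m = 0\<close> this is local triviality. The next
  coordinate is absorbed by the interval principle \<open>Bolzano\<close>, where two adjacent slabs
  are glued along the hyperplane between them.\<close>

lemma trivialization_cube:
  assumes B: "F_bundle C X" and c: "continuous_map (cube n) (base X) c"
  shows "\<exists>V \<Psi> \<Theta>. trivialization X (cube n) c V \<Psi> \<Theta>"
proof -
  note X = F_bundle_family[OF B]
  define near where "near m e x = {y. \<forall>i. m \<le> i \<and> i < n \<longrightarrow> \<bar>y i - x i\<bar> < e}" for m and e :: real and x :: "nat \<Rightarrow> real"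
  define triv where "triv A \<longleftrightarrow> (\<exists>V \<Psi> \<Theta>. trivialization X (subtopology (cube n) A) c V \<Psi> \<Theta>)" for A
  have triv_sub: "triv B" if "triv A" "B \<inter> topspace (cube n) \<subseteq> A" for A B
  proof -
    have "triv (B \<inter> topspace (cube n))"
      using that trivialization_subset unfolding triv_def by blast
    then show ?thesis unfolding triv_def
      by (metis Int_commute subtopology_restrict)
  qed
  have "\<forall>x\<in>topspace (cube n). \<exists>e>0. triv (near m e x)" if "m \<le> n" for m
    using that
  proof (induction m)
    case 0
    show ?case
    proof
      fix x assume x: "x \<in> topspace (cube n)"
      obtain W V \<Psi> \<Theta> where W: "openin (cube n) W" "x \<in> W" "trivialization X (subtopology (cube n) W) c V \<Psi> \<Theta>"
        by (rule F_bundle_local[OF B c x])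
      obtain e where e: "e > 0" "{y \<in> topspace (cube n). \<forall>i<n. \<bar>y i - x i\<bar> < e} \<subseteq> W"
        using cube_box[OF W(1,2)] by blast
      have "triv W" using W(3) by (auto simp: triv_def)
      then have "triv (near 0 e x)" by (rule triv_sub) (use e in \<open>auto simp: near_def\<close>)
      then show "\<exists>e>0. triv (near 0 e x)" using e(1) by blast
    qed
  next
    case (Suc m)
    then have mn: "m < n" and IH: "\<And>x. x \<in> topspace (cube n) \<Longrightarrow> \<exists>e>0. triv (near m e x)" by auto
    show ?case
    proof
      fix x assume x: "x \<in> topspace (cube n)"
      define slab where "slab a b e = {y. a \<le> y m \<and> y m \<le> b} \<inter> near (Suc m) e x" for a b e
      \<comment> \<open>The guard keeps the cutting value between -1 and 1, so that setting
        coordinate \<open>m\<close> to it maps the cube to itself.\<close>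
      define P where "P a b \<longleftrightarrow> (-1 \<le> a \<and> b \<le> 1 \<longrightarrow> (\<exists>e>0. triv (slab a b e)))" for a b
      have "(-1::real) \<le> 1" by simp
      then have "P (-1) 1"
      proof (induction rule: Bolzano)
        case (trans a b d)
        show ?case
          unfolding P_def
        proof
          assume ad: "-1 \<le> a \<and> d \<le> 1"
          obtain e1 e2 where e: "e1 > 0" "e2 > 0" "triv (slab a b e1)" "triv (slab b d e2)"
            using trans ad unfolding P_def by (meson order_trans)
          let ?e = "min e1 e2"
          let ?T = "subtopology (cube n) (slab a d ?e)"
          let ?T1 = "{y \<in> topspace ?T. y m \<in> {..b}}" and ?T2 = "{y \<in> topspace ?T. y m \<in> {b..}}"
          have b: "\<bar>b\<bar> \<le> 1" using trans(3,4) ad by auto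
          have comp: "continuous_map ?T euclideanreal (\<lambda>y. y m)"
            by (intro continuous_map_from_subtopology continuous_map_cube_component)
          have cl: "closedin ?T ?T1" "closedin ?T ?T2"
            using closedin_continuous_map_preimage[OF comp, of "{..b}"]
              closedin_continuous_map_preimage[OF comp, of "{b..}"] by auto
          have s: "subtopology ?T A = subtopology (cube n) (slab a d ?e \<inter> A)" for A
            by (simp add: subtopology_subtopology)
          have "triv (slab a d ?e \<inter> ?T1)"
            by (rule triv_sub[OF e(3)]) (auto simp: slab_def near_def)
          then obtain V1 \<Psi>1 \<Theta>1 where tr1: "trivialization X (subtopology ?T ?T1) c V1 \<Psi>1 \<Theta>1"
            unfolding triv_def s by blast
          have "triv (slab a d ?e \<inter> ?T2)"
            by (rule triv_sub[OF e(4)]) (auto simp: slab_def near_def)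
          then obtain V2 \<Psi>2 \<Theta>2 where tr2: "trivialization X (subtopology ?T ?T2) c V2 \<Psi>2 \<Theta>2"
            unfolding triv_def s by blast
          \<comment> \<open>Projection to the cutting hyperplane is the retraction of the lower slab
            that \<open>trivialization_glue\<close> asks for.\<close>
          let ?\<rho> = "\<lambda>y. y(m := b)"
          have \<rho>: "continuous_map (subtopology ?T ?T1) (subtopology ?T (?T1 \<inter> ?T2)) ?\<rho>"
          proof -
            have c1: "continuous_map (subtopology ?T ?T1) (cube n) ?\<rho>"
              unfolding s by (intro continuous_map_from_subtopology continuous_map_cube_update b mn)
            have "?\<rho> y \<in> slab a d ?e \<inter> (?T1 \<inter> ?T2)" if y: "y \<in> topspace (subtopology ?T ?T1)" for y
            proof -
              have "?\<rho> y \<in> topspace (cube n)" using c1 y unfolding continuous_map_def by blast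
              moreover have "?\<rho> y \<in> slab a d ?e" using y trans(3,4) by (auto simp: slab_def near_def)
              ultimately show ?thesis by simp
            qed
            then show ?thesis unfolding s[of "?T1 \<inter> ?T2"] by (intro continuous_map_into_subtopology[OF c1]) blast
          qed
          have cT: "continuous_map ?T (base X) c" by (intro continuous_map_from_subtopology c)
          have "\<exists>\<Psi> \<Theta>. trivialization X ?T c V2 \<Psi> \<Theta>"
            by (rule trivialization_glue[OF X cT cl _ tr1 tr2 \<rho>]) (auto simp: fun_eq_iff)
          then show "\<exists>e>0. triv (slab a d e)" using e(1,2) unfolding triv_def
            by (intro exI[of _ ?e]) auto
        qed
      next
        case (local t)
        \<comment> \<open>The induction hypothesis is applied at \<open>x\<close> moved to height
          \<open>t\<close>; a slab around \<open>t\<close> of width below \<open>e\<close> lies in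
          the trivial set obtained there.\<close>
        have "x(m := t) \<in> topspace (cube n)" using x local mn by (auto simp: topspace_cube)
        then obtain e where e: "e > 0" "triv (near m e (x(m := t)))" using IH by blast
        have "triv (slab a b e)" if "a \<le> t" "t \<le> b" "b - a < e" for a b
        proof (rule triv_sub[OF e(2)])
          show "slab a b e \<inter> topspace (cube n) \<subseteq> near m e (x(m := t))"
          proof
            fix y assume y: "y \<in> slab a b e \<inter> topspace (cube n)"
            have "\<bar>y i - (x(m := t)) i\<bar> < e" if "m \<le> i" "i < n" for i
            proof (cases "i = m")
              case True
              then show ?thesis using y \<open>a \<le> t\<close> \<open>t \<le> b\<close> \<open>b - a < e\<close> by (auto simp: slab_def)
            next
              case False
              then show ?thesis using y that by (auto simp: slab_def near_def)
            qed
            then show "y \<in> near m e (x(m := t))" by (simp add: near_def)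
          qed
        qed
        then show ?case using e(1) unfolding P_def by blast
      qed
      then obtain e where e: "e > 0" "triv (slab (-1) 1 e)" by (auto simp: P_def)
      have "triv (near (Suc m) e x)"
        by (rule triv_sub[OF e(2)]) (use mn in \<open>auto simp: slab_def topspace_cube abs_le_iff\<close>)
      then show "\<exists>e>0. triv (near (Suc m) e x)" using e(1) by blast
    qed
  qed
  \<comment> \<open>At \<open>m = n\<close> no coordinate is constrained, so any point, here the
    origin, yields the whole cube.\<close>
  from this[of n] obtain e where "triv (near n e (\<lambda>i. 0))"
    by (auto simp: topspace_cube)
  then have "triv UNIV" by (rule triv_sub) (auto simp: near_def)
  then show ?thesis by (simp add: triv_def)
qed

text \<open>The retraction of the cube onto the disk pulls the bundle back to the cube; the
  trivialization found there restricts to the disk, on which the retraction is the identity.\<close>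

lemma trivialization_disk:
  assumes B: "F_bundle C X" and c: "continuous_map (disk n) (base X) c"
  shows "\<exists>V \<Psi> \<Theta>. trivialization X (disk n) c V \<Psi> \<Theta>"
proof -
  have r: "continuous_map (cube n) (disk n) (disk_retract n)"
    unfolding cube_def by (intro continuous_map_from_subtopology disk_retract)
  have "continuous_map (cube n) (base X) (\<lambda>x. c (disk_retract n x))"
    using continuous_map_compose[OF r c] by (simp add: comp_def)
  from trivialization_cube[OF B this] obtain V \<Psi> \<Theta>
    where tr: "trivialization X (cube n) (\<lambda>x. c (disk_retract n x)) V \<Psi> \<Theta>" by blast
  have "x \<in> topspace (cube n)" if x: "x \<in> topspace (disk n)" for x
  proof -
    have "\<bar>x i\<bar> \<le> 1" if "i < n" for i
    proof -
      have "(x i)\<^sup>2 \<le> (\<Sum>j<n. (x j)\<^sup>2)" using that by (intro member_le_sum) auto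
      also have "\<dots> \<le> 1" using x by (simp add: disk_def)
      finally show ?thesis by (simp add: abs_square_le_1)
    qed
    then show ?thesis using x by (simp add: topspace_cube topspace_disk)
  qed
  then have "continuous_map (disk n) (cube n) (\<lambda>x. x)"
    unfolding cube_def
    by (intro continuous_map_into_subtopology) (auto simp: topspace_cube disk_def intro: continuous_map_from_subtopology)
  from trivialization_pullback[OF tr this, of c] show ?thesis
    using disk_retract(2) by fastforce
qed

end

section \<open>Bundles over cell systems\<close>

definition open_disk :: "nat \<Rightarrow> (nat \<Rightarrow> real) set" where
  "open_disk n = topspace (disk n) - topspace (bdry_sphere n)"

lemma openin_open_disk: "openin (disk n) (open_disk n)"
  unfolding open_disk_def by (intro openin_diff closedin_bdry_sphere openin_topspace)

lemma open_disk_subset: "y \<in> open_disk n \<Longrightarrow> y \<in> topspace (disk n)"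
  by (simp add: open_disk_def)

text \<open>The recursion step for open sets: what is open over the boundary sphere spreads along
  the rays to an open set over the punctured disk, with the coordinate in \<open>T\<close> carried
  along unchanged.\<close>

lemma openin_radial_preimage:
  assumes "openin (prod_topology (bdry_sphere n) T) W"
  shows "openin (prod_topology (disk n) T)
    {p \<in> topspace (disk n) \<times> topspace T. dnorm n (fst p) \<noteq> 0 \<and> (radial n (fst p), snd p) \<in> W}"
proof -
  let ?D = "{y \<in> topspace (disk n). dnorm n y \<noteq> 0}"
  let ?P = "prod_topology (subtopology (disk n) ?D) T"
  have P: "?P = subtopology (prod_topology (disk n) T) (?D \<times> topspace T)"
    by (simp add: subtopology_Times)
  have "continuous_map ?P (prod_topology (bdry_sphere n) T) (\<lambda>p. (radial n (fst p), snd p))"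
    by (intro continuous_map_pairedI continuous_map_snd
        continuous_map_compose[OF continuous_map_fst continuous_map_radial, unfolded comp_def])
  from openin_continuous_map_preimage[OF this assms]
  have "openin (prod_topology (disk n) T) {p \<in> topspace ?P. (radial n (fst p), snd p) \<in> W}"
    unfolding P by (rule openin_trans_full) (simp add: openin_prod_Times_iff openin_disk_punctured)
  moreover have "{p \<in> topspace ?P. (radial n (fst p), snd p) \<in> W}
    = {p \<in> topspace (disk n) \<times> topspace T. dnorm n (fst p) \<noteq> 0 \<and> (radial n (fst p), snd p) \<in> W}"
    by auto
  ultimately show ?thesis by simp
qed

lemma openin_radial_preimage':
  assumes "openin (bdry_sphere n) W"
  shows "openin (disk n) {y \<in> topspace (disk n). dnorm n y \<noteq> 0 \<and> radial n y \<in> W}"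
proof -
  let ?D = "{y \<in> topspace (disk n). dnorm n y \<noteq> 0}"
  have "openin (disk n) {y \<in> topspace (subtopology (disk n) ?D). radial n y \<in> W}"
    by (rule openin_trans_full[OF openin_continuous_map_preimage[OF continuous_map_radial assms]
          openin_disk_punctured])
  moreover have "{y \<in> topspace (subtopology (disk n) ?D). radial n y \<in> W}
    = {y \<in> topspace (disk n). dnorm n y \<noteq> 0 \<and> radial n y \<in> W}" by auto
  ultimately show ?thesis by simp
qed

text \<open>The last four assumptions say that the base and the total space carry the coherent topology and
  that the attaching maps are continuous into the coherent topology of the union of the lower cells.\<close>

locale cell_system = groupoid_structure C
  for C :: "('o, 'a, 'f) structure_category" +
  fixes X :: "('x, 'b, 'o, 'f) family" and J :: "'j set" and lt :: "'j rel" and dim :: "'j \<Rightarrow> nat"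
    and V :: "'j \<Rightarrow> 'o" and c :: "'j \<Rightarrow> (nat \<Rightarrow> real) \<Rightarrow> 'b" and \<Psi> :: "'j \<Rightarrow> (nat \<Rightarrow> real) \<Rightarrow> 'f \<Rightarrow> 'x"
  assumes X: "F_family C X" and wf: "wf lt" and trans: "trans lt"
    and V: "j \<in> J \<Longrightarrow> V j \<in> Obj C"
    and c: "j \<in> J \<Longrightarrow> continuous_map (disk (dim j)) (base X) (c j)"
    and \<Psi>: "j \<in> J \<Longrightarrow> continuous_map (prod_topology (disk (dim j)) (fib C (V j))) (total X) (\<lambda>p. \<Psi> j (fst p) (snd p))"
    and par: "j \<in> J \<Longrightarrow> y \<in> topspace (disk (dim j)) \<Longrightarrow> fibre_param X (c j y) (V j) (\<Psi> j y)"
    and cover: "b \<in> topspace (base X) \<Longrightarrow> \<exists>j\<in>J. b \<in> c j ` open_disk (dim j)"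
    and inj: "j \<in> J \<Longrightarrow> k \<in> J \<Longrightarrow> y \<in> open_disk (dim j) \<Longrightarrow> z \<in> open_disk (dim k) \<Longrightarrow> c j y = c k z
      \<Longrightarrow> j = k \<and> y = z"
    and bdry: "j \<in> J \<Longrightarrow> y \<in> topspace (bdry_sphere (dim j))
      \<Longrightarrow> \<exists>k\<in>J. (k, j) \<in> lt \<and> c j y \<in> c k ` open_disk (dim k)"
    and base_open: "W \<subseteq> topspace (base X) \<Longrightarrow>
      (\<And>j. j \<in> J \<Longrightarrow> openin (disk (dim j)) {y \<in> topspace (disk (dim j)). c j y \<in> W}) \<Longrightarrow> openin (base X) W"
    and base_bdry: "j \<in> J \<Longrightarrow> W \<subseteq> topspace (base X) \<Longrightarrow>
      (\<And>k. k \<in> J \<Longrightarrow> (k, j) \<in> lt \<Longrightarrow> openin (disk (dim k)) {y \<in> topspace (disk (dim k)). c k y \<in> W}) \<Longrightarrow>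
      openin (bdry_sphere (dim j)) {y \<in> topspace (bdry_sphere (dim j)). c j y \<in> W}"
    and total_open: "E \<subseteq> topspace (total X) \<Longrightarrow>
      (\<And>j. j \<in> J \<Longrightarrow> openin (prod_topology (disk (dim j)) (fib C (V j)))
          {p \<in> topspace (disk (dim j)) \<times> topspace (fib C (V j)). \<Psi> j (fst p) (snd p) \<in> E}) \<Longrightarrow>
      openin (total X) E"
    and total_bdry: "j \<in> J \<Longrightarrow> E \<subseteq> topspace (total X) \<Longrightarrow>
      (\<And>k. k \<in> J \<Longrightarrow> (k, j) \<in> lt \<Longrightarrow> openin (prod_topology (disk (dim k)) (fib C (V k)))
          {p \<in> topspace (disk (dim k)) \<times> topspace (fib C (V k)). \<Psi> k (fst p) (snd p) \<in> E}) \<Longrightarrow>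
      openin (prod_topology (bdry_sphere (dim j)) (fib C (V j)))
          {p \<in> topspace (bdry_sphere (dim j)) \<times> topspace (fib C (V j)). \<Psi> j (fst p) (snd p) \<in> E}"
begin

text \<open>Points are pushed radially to the boundary of their cell, over and over, until they hit the
  open cell \<open>j0\<close>. \<open>reach j0\<close> is the set of points for which this succeeds, and \<open>slide j0 x w\<close> says
  that \<open>w\<close> is the coordinate in \<open>F(V j0)\<close> with which the transported point \<open>x\<close> arrives.\<close>

inductive reach :: "'j \<Rightarrow> 'b \<Rightarrow> bool" for j0 where
  reach_here: "y \<in> open_disk (dim j0) \<Longrightarrow> reach j0 (c j0 y)"
| reach_step: "j \<in> J \<Longrightarrow> j \<noteq> j0 \<Longrightarrow> y \<in> open_disk (dim j) \<Longrightarrow> dnorm (dim j) y \<noteq> 0 \<Longrightarrow>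
    reach j0 (c j (radial (dim j) y)) \<Longrightarrow> reach j0 (c j y)"

inductive slide :: "'j \<Rightarrow> 'x \<Rightarrow> 'f \<Rightarrow> bool" for j0 where
  slide_here: "y \<in> open_disk (dim j0) \<Longrightarrow> v \<in> topspace (fib C (V j0)) \<Longrightarrow> slide j0 (\<Psi> j0 y v) v"
| slide_step: "j \<in> J \<Longrightarrow> j \<noteq> j0 \<Longrightarrow> y \<in> open_disk (dim j) \<Longrightarrow> dnorm (dim j) y \<noteq> 0 \<Longrightarrow>
    v \<in> topspace (fib C (V j)) \<Longrightarrow>
    slide j0 (\<Psi> j (radial (dim j) y) v) w \<Longrightarrow> slide j0 (\<Psi> j y v) w"

lemma c_in: "j \<in> J \<Longrightarrow> y \<in> topspace (disk (dim j)) \<Longrightarrow> c j y \<in> topspace (base X)"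
  using c by (auto simp: continuous_map_def)

lemma \<Psi>_in: "j \<in> J \<Longrightarrow> y \<in> topspace (disk (dim j)) \<Longrightarrow> v \<in> topspace (fib C (V j)) \<Longrightarrow> \<Psi> j y v \<in> fibre X (c j y)"
  using par by (auto simp: fibre_param_def)

lemma \<Psi>_bij: "j \<in> J \<Longrightarrow> y \<in> topspace (disk (dim j)) \<Longrightarrow> bij_betw (\<Psi> j y) (topspace (fib C (V j))) (fibre X (c j y))"
  using fibre_param_homeo(2)[OF X c_in par] by blast

lemma radial_in_disk:
  assumes "y \<in> topspace (disk n)" "dnorm n y \<noteq> 0"
  shows "radial n y \<in> topspace (disk n)"
  using radial_in_bdry[OF assms] bdry_sphere_subset_disk by blast

lemma \<Psi>_inj:
  assumes "j \<in> J" "k \<in> J" "y \<in> open_disk (dim j)" "z \<in> open_disk (dim k)"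
    and "v \<in> topspace (fib C (V j))" "u \<in> topspace (fib C (V k))" and eq: "\<Psi> j y v = \<Psi> k z u"
  shows "j = k \<and> y = z \<and> v = u"
proof -
  have 1: "\<Psi> j y v \<in> fibre X (c j y)" "\<Psi> k z u \<in> fibre X (c k z)"
    using \<Psi>_in[OF assms(1) open_disk_subset[OF assms(3)] assms(5)]
      \<Psi>_in[OF assms(2) open_disk_subset[OF assms(4)] assms(6)] .
  then have "c j y = c k z" using eq by (auto simp: fibre_def)
  then have jk: "j = k" "y = z" using inj[OF assms(1-4)] by auto
  have "inj_on (\<Psi> j y) (topspace (fib C (V j)))"
    using \<Psi>_bij[OF assms(1) open_disk_subset[OF assms(3)]] by (simp add: bij_betw_def)
  then show ?thesis using jk eq assms(5,6) by (auto dest: inj_onD)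
qed

section \<open>Pushing points down through the cells\<close>

text \<open>Every point lies in exactly one open cell, at exactly one parameter. The two rules of
  \<open>reach\<close> therefore never compete and can be inverted.\<close>

lemma reach_cell:
  assumes j: "j \<in> J" "j0 \<in> J" "y \<in> open_disk (dim j)"
  shows "reach j0 (c j y) \<longleftrightarrow> j = j0 \<or> dnorm (dim j) y \<noteq> 0 \<and> reach j0 (c j (radial (dim j) y))"
proof
  assume "reach j0 (c j y)"
  then show "j = j0 \<or> dnorm (dim j) y \<noteq> 0 \<and> reach j0 (c j (radial (dim j) y))"
  proof cases
    case (reach_here z)
    then show ?thesis using inj[of j j0 y z] j by auto
  next
    case (reach_step k z)
    then show ?thesis using inj[of j k y z] j by auto
  qed
next
  assume "j = j0 \<or> dnorm (dim j) y \<noteq> 0 \<and> reach j0 (c j (radial (dim j) y))"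
  then show "reach j0 (c j y)"
    using reach_here[of y j0] reach_step[OF j(1) _ j(3), of j0] j(3) by (cases "j = j0") auto
qed

lemma slide_cell:
  assumes j: "j \<in> J" "j0 \<in> J" "y \<in> open_disk (dim j)" "v \<in> topspace (fib C (V j))"
  shows "slide j0 (\<Psi> j y v) w \<longleftrightarrow>
    (if j = j0 then w = v else dnorm (dim j) y \<noteq> 0 \<and> slide j0 (\<Psi> j (radial (dim j) y) v) w)"
proof
  assume "slide j0 (\<Psi> j y v) w"
  then show "if j = j0 then w = v else dnorm (dim j) y \<noteq> 0 \<and> slide j0 (\<Psi> j (radial (dim j) y) v) w"
  proof cases
    case (slide_here z)
    then show ?thesis using \<Psi>_inj[of j j0 y z v w] j by auto
  next
    case (slide_step k z u)
    then show ?thesis using \<Psi>_inj[of j k y z v u] j by auto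
  qed
next
  assume "if j = j0 then w = v else dnorm (dim j) y \<noteq> 0 \<and> slide j0 (\<Psi> j (radial (dim j) y) v) w"
  then show "slide j0 (\<Psi> j y v) w"
    using slide_here[of y j0 v] slide_step[OF j(1) _ j(3) _ j(4), of j0 w] j(3,4) by (cases "j = j0") auto
qed

text \<open>Each push ends in a cell strictly below the one it started from, so by transitivity a
  point arriving in \<open>j0\<close> comes from \<open>j0\<close> or from above it.\<close>

lemma reach_lower:
  assumes "reach j0 b" and j0: "j0 \<in> J"
  shows "\<exists>k\<in>J. b \<in> c k ` open_disk (dim k) \<and> (k = j0 \<or> (j0, k) \<in> lt)"
  using assms(1)
proof induction
  case (reach_here y)
  then show ?case using j0 by blast
next
  case (reach_step j y)
  obtain k where k: "k \<in> J" "c j (radial (dim j) y) \<in> c k ` open_disk (dim k)" "k = j0 \<or> (j0, k) \<in> lt"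
    using reach_step.IH by blast
  have "radial (dim j) y \<in> topspace (bdry_sphere (dim j))"
    using radial_in_bdry[OF open_disk_subset] reach_step.hyps by blast
  then obtain k' where k': "k' \<in> J" "(k', j) \<in> lt" "c j (radial (dim j) y) \<in> c k' ` open_disk (dim k')"
    using bdry reach_step.hyps(1) by blast
  have "k = k'"
  proof -
    obtain z z' where "z \<in> open_disk (dim k)" "z' \<in> open_disk (dim k')" "c k z = c k' z'"
      using k(2) k'(3) by (elim imageE) simp
    then show ?thesis using inj k(1) k'(1) by blast
  qed
  then have "(j0, j) \<in> lt" using k(3) k'(2) trans by (auto dest: transD)
  then show ?case using reach_step.hyps by blast
qed

text \<open>The boundary of \<open>j0\<close> lies in strictly lower cells, while points that reach
  \<open>j0\<close> lie in \<open>j0\<close> or above. A well-founded order is asymmetric, so the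
  two are incompatible.\<close>

lemma not_reach_own_bdry:
  assumes j0: "j0 \<in> J" and y: "y \<in> topspace (bdry_sphere (dim j0))"
  shows "\<not> reach j0 (c j0 y)"
proof
  assume "reach j0 (c j0 y)"
  then obtain k where k: "k \<in> J" "c j0 y \<in> c k ` open_disk (dim k)" "k = j0 \<or> (j0, k) \<in> lt"
    using reach_lower[OF _ j0] by blast
  obtain k' where k': "k' \<in> J" "(k', j0) \<in> lt" "c j0 y \<in> c k' ` open_disk (dim k')"
    using bdry[OF j0 y] by blast
  obtain z z' where "z \<in> open_disk (dim k)" "z' \<in> open_disk (dim k')" "c k z = c k' z'"
    using k(2) k'(3) by (elim imageE) simp
  then have "k = k'" using inj k(1) k'(1) by blast
  then show False using k(3) k'(2) wf by (metis wf_asym)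
qed

text \<open>Coherence is tested on closed disks, so the recursion has to hold up to the boundary.
  There \<open>radial\<close> is the identity and both sides agree, except for
  \<open>j = j0\<close>, which \<open>not_reach_own_bdry\<close> settles.\<close>

lemma reach_disk:
  assumes j: "j \<in> J" "j0 \<in> J" "y \<in> topspace (disk (dim j))"
  shows "reach j0 (c j y) \<longleftrightarrow>
    (if j = j0 then y \<in> open_disk (dim j) else dnorm (dim j) y \<noteq> 0 \<and> reach j0 (c j (radial (dim j) y)))"
proof (cases "y \<in> open_disk (dim j)")
  case True
  then show ?thesis using reach_cell[OF j(1,2) True] by auto
next
  case False
  then have y: "y \<in> topspace (bdry_sphere (dim j))" using j(3) by (simp add: open_disk_def)
  then have "dnorm (dim j) y \<noteq> 0" by (simp add: topspace_bdry_sphere)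
  then show ?thesis using not_reach_own_bdry[OF j(2)] y False radial_on_bdry[OF y] by auto
qed

lemma slide_reach:
  assumes "slide j0 x w" "j0 \<in> J"
  shows "reach j0 (proj X x)" and "x \<in> topspace (total X)"
proof -
  have *: "proj X (\<Psi> j y v) = c j y" "\<Psi> j y v \<in> topspace (total X)"
    if "j \<in> J" "y \<in> topspace (disk (dim j))" "v \<in> topspace (fib C (V j))" for j y v
    using \<Psi>_in[OF that] by (auto simp: fibre_def)
  have "reach j0 (proj X x) \<and> x \<in> topspace (total X)"
    using assms(1)
  proof induction
    case (slide_here y v)
    then show ?case using * open_disk_subset assms(2) reach_here by simp
  next
    case (slide_step j y v w)
    have y: "y \<in> topspace (disk (dim j))" using slide_step.hyps(3) by (rule open_disk_subset)
    show ?case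
      using slide_step *[OF slide_step.hyps(1) y slide_step.hyps(5)]
        *[OF slide_step.hyps(1) radial_in_disk[OF y slide_step.hyps(4)] slide_step.hyps(5)]
      by (auto intro: reach_step)
  qed
  then show "reach j0 (proj X x)" and "x \<in> topspace (total X)" by auto
qed

lemma slide_disk:
  assumes j: "j \<in> J" "j0 \<in> J" "y \<in> topspace (disk (dim j))" "v \<in> topspace (fib C (V j))"
  shows "slide j0 (\<Psi> j y v) w \<longleftrightarrow>
    (if j = j0 then y \<in> open_disk (dim j) \<and> w = v
     else dnorm (dim j) y \<noteq> 0 \<and> slide j0 (\<Psi> j (radial (dim j) y) v) w)"
proof (cases "y \<in> open_disk (dim j)")
  case True
  then show ?thesis using slide_cell[OF j(1,2) True j(4)] by auto
next
  case False
  then have y: "y \<in> topspace (bdry_sphere (dim j))" using j(3) by (simp add: open_disk_def)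
  then have "dnorm (dim j) y \<noteq> 0" by (simp add: topspace_bdry_sphere)
  moreover have "\<not> slide j0 (\<Psi> j y v) w" if "j = j0"
  proof
    assume "slide j0 (\<Psi> j y v) w"
    then have "reach j0 (proj X (\<Psi> j y v))" using slide_reach j(2) by blast
    then have "reach j0 (c j y)" using \<Psi>_in[OF j(1,3,4)] by (simp add: fibre_def)
    then show False using not_reach_own_bdry[OF j(2)] y that by simp
  qed
  ultimately show ?thesis using False radial_on_bdry[OF y] by auto
qed

text \<open>On the fibre over \<open>b\<close>, \<open>slide j0\<close> is the graph of the inverse
  of an admissible parametrization. Going back along one push, a parametrization \<open>q\<close>
  over the pushed point is expressed through \<open>\<Psi> j\<close> by a transition morphism
  \<open>g\<close>, and the same \<open>g\<close> used with \<open>\<Psi> j y\<close> parametrizes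
  the fibre over the original point.\<close>

lemma reach_param:
  assumes "reach j0 b" and j0: "j0 \<in> J"
  shows "b \<in> topspace (base X) \<and> (\<exists>q. fibre_param X b (V j0) q \<and>
    (\<forall>x\<in>fibre X b. \<forall>w. slide j0 x w \<longleftrightarrow> w \<in> topspace (fib C (V j0)) \<and> x = q w))"
  using assms(1)
proof induction
  case (reach_here y)
  have y: "y \<in> topspace (disk (dim j0))" by (rule open_disk_subset[OF reach_here])
  have "slide j0 x w \<longleftrightarrow> w \<in> topspace (fib C (V j0)) \<and> x = \<Psi> j0 y w" if x: "x \<in> fibre X (c j0 y)" for x w
  proof -
    obtain v where v: "v \<in> topspace (fib C (V j0))" "x = \<Psi> j0 y v"
      using x \<Psi>_bij[OF j0 y] unfolding bij_betw_def by (elim conjE) (metis imageE)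
    show ?thesis
      using slide_cell[OF j0 j0 reach_here v(1), of w] v \<Psi>_inj[OF j0 j0 reach_here reach_here v(1), of w] by auto
  qed
  then show ?case using par[OF j0 y] c_in[OF j0 y] by blast
next
  case (reach_step j y)
  let ?y = "radial (dim j) y"
  have y: "y \<in> topspace (disk (dim j))" by (rule open_disk_subset[OF reach_step.hyps(3)])
  have y': "?y \<in> topspace (disk (dim j))" by (rule radial_in_disk[OF y reach_step.hyps(4)])
  obtain q where q: "fibre_param X (c j ?y) (V j0) q"
    "\<And>x w. x \<in> fibre X (c j ?y) \<Longrightarrow> slide j0 x w \<longleftrightarrow> w \<in> topspace (fib C (V j0)) \<and> x = q w"
    using reach_step.IH by blast
  obtain g where g: "arr_map (V j0) (V j) g"
    "\<And>w. w \<in> topspace (fib C (V j0)) \<Longrightarrow> \<Psi> j ?y (g w) = q w"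
    using fibre_param_transition[OF X c_in[OF reach_step.hyps(1) y'] q(1) par[OF reach_step.hyps(1) y']] by blast
  have "slide j0 x w \<longleftrightarrow> w \<in> topspace (fib C (V j0)) \<and> x = \<Psi> j y (g w)" if x: "x \<in> fibre X (c j y)" for x w
  proof -
    obtain v where v: "v \<in> topspace (fib C (V j))" "x = \<Psi> j y v"
      using x \<Psi>_bij[OF reach_step.hyps(1) y] unfolding bij_betw_def by (elim conjE) (metis imageE)
    have i: "inj_on (\<Psi> j y') (topspace (fib C (V j)))" if "y' \<in> topspace (disk (dim j))" for y'
      using \<Psi>_bij[OF reach_step.hyps(1) that] by (simp add: bij_betw_def)
    have gw: "g w \<in> topspace (fib C (V j))" if "w \<in> topspace (fib C (V j0))"
      using arr_map_in[OF g(1) that] .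
    have "slide j0 x w \<longleftrightarrow> slide j0 (\<Psi> j ?y v) w"
      using slide_cell[OF reach_step.hyps(1) j0 reach_step.hyps(3) v(1), of w] reach_step.hyps(2,4) v(2) by simp
    also have "\<dots> \<longleftrightarrow> w \<in> topspace (fib C (V j0)) \<and> \<Psi> j ?y v = q w"
      by (rule q(2)[OF \<Psi>_in[OF reach_step.hyps(1) y' v(1)]])
    also have "\<dots> \<longleftrightarrow> w \<in> topspace (fib C (V j0)) \<and> v = g w"
      using g(2) gw inj_onD[OF i[OF y']] v(1) by metis
    also have "\<dots> \<longleftrightarrow> w \<in> topspace (fib C (V j0)) \<and> x = \<Psi> j y (g w)"
      using gw inj_onD[OF i[OF y]] v by metis
    finally show ?thesis .
  qed
  moreover have "fibre_param X (c j y) (V j0) (\<lambda>w. \<Psi> j y (g w))"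
    by (rule fibre_param_comp[OF par[OF reach_step.hyps(1) y] g(1)])
  ultimately show ?case using c_in[OF reach_step.hyps(1) y] by blast
qed

lemma reach_subset: "j0 \<in> J \<Longrightarrow> {b. reach j0 b} \<subseteq> topspace (base X)"
  using reach_param by blast

section \<open>Openness of the reached set and local triviality\<close>

text \<open>By induction the preimages in lower cells are open; \<open>base_bdry\<close> carries
  this to the boundary sphere of \<open>j\<close>, and the rays spread it over the disk. For
  \<open>j \<noteq> j0\<close> the centre drops out, as it cannot be pushed.\<close>

lemma openin_reach_disk:
  assumes j0: "j0 \<in> J" and j: "j \<in> J"
  shows "openin (disk (dim j)) {y \<in> topspace (disk (dim j)). c j y \<in> {b. reach j0 b}}"
  using j
proof (induction j rule: wf_induct_rule[OF wf])
  case (1 j)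
  show ?case
  proof (cases "j = j0")
    case True
    have "{y \<in> topspace (disk (dim j)). c j y \<in> {b. reach j0 b}} = open_disk (dim j)"
      using reach_disk[OF 1(2) j0] True open_disk_subset by auto
    then show ?thesis using openin_open_disk by simp
  next
    case False
    have "openin (bdry_sphere (dim j)) {y \<in> topspace (bdry_sphere (dim j)). c j y \<in> {b. reach j0 b}}"
      by (rule base_bdry[OF 1(2) reach_subset[OF j0]]) (rule 1(1))
    from openin_radial_preimage'[OF this]
    have "openin (disk (dim j)) {y \<in> topspace (disk (dim j)). dnorm (dim j) y \<noteq> 0 \<and>
      radial (dim j) y \<in> {y \<in> topspace (bdry_sphere (dim j)). c j y \<in> {b. reach j0 b}}}" .
    moreover have "{y \<in> topspace (disk (dim j)). dnorm (dim j) y \<noteq> 0 \<and>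
      radial (dim j) y \<in> {y \<in> topspace (bdry_sphere (dim j)). c j y \<in> {b. reach j0 b}}}
      = {y \<in> topspace (disk (dim j)). c j y \<in> {b. reach j0 b}}"
      using reach_disk[OF 1(2) j0] False radial_in_bdry by auto
    ultimately show ?thesis by simp
  qed
qed

lemma openin_reach: "j0 \<in> J \<Longrightarrow> openin (base X) {b. reach j0 b}"
  by (rule base_open[OF reach_subset]) (auto dest: openin_reach_disk)

text \<open>The recursion of \<open>openin_reach_disk\<close> with a fibre coordinate carried along.
  These sets are the preimages of \<open>G\<close> under the fibre coordinate of the future
  trivialization, so its continuity is exactly this statement.\<close>

lemma openin_slide:
  assumes j0: "j0 \<in> J" and G: "openin (fib C (V j0)) G"
  shows "openin (total X) {x. \<exists>w\<in>G. slide j0 x w}"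
proof (rule total_open)
  let ?S = "{x. \<exists>w\<in>G. slide j0 x w}"
  show sub: "?S \<subseteq> topspace (total X)" using slide_reach(2) j0 by blast
  fix j assume "j \<in> J"
  then show "openin (prod_topology (disk (dim j)) (fib C (V j)))
      {p \<in> topspace (disk (dim j)) \<times> topspace (fib C (V j)). \<Psi> j (fst p) (snd p) \<in> ?S}"
  proof (induction j rule: wf_induct_rule[OF wf])
    case (1 j)
    show ?case
    proof (cases "j = j0")
      case True
      have "{p \<in> topspace (disk (dim j)) \<times> topspace (fib C (V j)). \<Psi> j (fst p) (snd p) \<in> ?S}
        = open_disk (dim j) \<times> G"
        using slide_disk[OF 1(2) j0] True open_disk_subset openin_subset[OF G] by auto
      then show ?thesis using openin_open_disk G True by (simp add: openin_prod_Times_iff)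
    next
      case False
      let ?B = "{p \<in> topspace (bdry_sphere (dim j)) \<times> topspace (fib C (V j)). \<Psi> j (fst p) (snd p) \<in> ?S}"
      have "openin (prod_topology (bdry_sphere (dim j)) (fib C (V j))) ?B"
        by (rule total_bdry[OF 1(2) sub]) (rule 1(1))
      from openin_radial_preimage[OF this]
      have "openin (prod_topology (disk (dim j)) (fib C (V j)))
        {p \<in> topspace (disk (dim j)) \<times> topspace (fib C (V j)). dnorm (dim j) (fst p) \<noteq> 0 \<and> (radial (dim j) (fst p), snd p) \<in> ?B}" .
      moreover have "{p \<in> topspace (disk (dim j)) \<times> topspace (fib C (V j)). dnorm (dim j) (fst p) \<noteq> 0 \<and> (radial (dim j) (fst p), snd p) \<in> ?B}
        = {p \<in> topspace (disk (dim j)) \<times> topspace (fib C (V j)). \<Psi> j (fst p) (snd p) \<in> ?S}"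
        using slide_disk[OF 1(2) j0] False radial_in_bdry by auto
      ultimately show ?thesis by simp
    qed
  qed
qed

text \<open>The fibre coordinate \<open>\<theta>\<close> is continuous by
  \<open>openin_slide\<close>. For \<open>q\<close>, whose source is a product,
  \<open>openin_prod_via_compacts\<close> moves the question to the base, where it can be tested
  cell by cell; on each cell it becomes continuity of a fibrewise inverse over an open part of a
  disk.\<close>

lemma locally_trivial_open_cell:
  assumes j0: "j0 \<in> J" and y0: "y0 \<in> open_disk (dim j0)"
  shows "locally_trivial_at X (c j0 y0)"
proof -
  define U where "U = {b. reach j0 b}"
  let ?V = "fib C (V j0)" and ?U = "subtopology (base X) U"
  have U: "openin (base X) U" unfolding U_def by (rule openin_reach[OF j0])
  then have UB: "U \<subseteq> topspace (base X)" by (rule openin_subset)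
  have "\<forall>b. \<exists>q. b \<in> U \<longrightarrow> fibre_param X b (V j0) q \<and>
    (\<forall>x\<in>fibre X b. \<forall>w. slide j0 x w \<longleftrightarrow> w \<in> topspace ?V \<and> x = q w)"
    using reach_param j0 by (auto simp: U_def)
  then obtain q where q': "\<forall>b. b \<in> U \<longrightarrow> fibre_param X b (V j0) (q b) \<and>
    (\<forall>x\<in>fibre X b. \<forall>w. slide j0 x w \<longleftrightarrow> w \<in> topspace ?V \<and> x = q b w)"
    by (elim choice[THEN exE]) blast
  have q: "fibre_param X b (V j0) (q b)" if "b \<in> U" for b using q' that by blast
  have qs: "slide j0 x w \<longleftrightarrow> w \<in> topspace ?V \<and> x = q b w" if "b \<in> U" "x \<in> fibre X b" for b x w
    using q' that by blast
  have qbij: "bij_betw (q b) (topspace ?V) (fibre X b)" if "b \<in> U" for b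
    using fibre_param_homeo(2)[OF X _ q[OF that]] that UB by blast
  define \<theta> where "\<theta> x = (THE w. slide j0 x w)" for x
  have \<theta>: "\<theta> x \<in> topspace ?V" "q b (\<theta> x) = x" "slide j0 x w \<longleftrightarrow> w = \<theta> x" if bx: "b \<in> U" "x \<in> fibre X b" for b x w
  proof -
    obtain v where v: "v \<in> topspace ?V" "x = q b v"
      using qbij[OF bx(1)] bx(2) unfolding bij_betw_def by (elim conjE) (metis imageE)
    have *: "slide j0 x w \<longleftrightarrow> w = v" for w
      using qs[OF bx] v qbij[OF bx(1)] unfolding bij_betw_def by (auto dest: inj_onD)
    then have "\<theta> x = v" by (simp add: \<theta>_def)
    then show "\<theta> x \<in> topspace ?V" "q b (\<theta> x) = x" "slide j0 x w \<longleftrightarrow> w = \<theta> x" using v * by auto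
  qed
  have q_in: "q b v \<in> fibre X b" if "b \<in> U" "v \<in> topspace ?V" for b v
    using qbij that unfolding bij_betw_def by blast
  have \<theta>q: "\<theta> (q b v) = v" if "b \<in> U" "v \<in> topspace ?V" for b v
  proof -
    have "slide j0 (q b v) v" using qs[OF that(1) q_in[OF that]] that(2) by simp
    then show ?thesis using \<theta>(3)[OF that(1) q_in[OF that]] by simp
  qed
  let ?XU = "subtopology (total X) {x \<in> topspace (total X). proj X x \<in> U}"
  have \<theta>c: "continuous_map ?XU ?V \<theta>"
    unfolding continuous_map_def
  proof (intro conjI funcsetI allI impI)
    fix x assume "x \<in> topspace ?XU"
    then show "\<theta> x \<in> topspace ?V" using \<theta>(1)[of "proj X x" x] by (simp add: fibre_def)
  next
    fix G assume G: "openin ?V G"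
    have "{x \<in> topspace ?XU. \<theta> x \<in> G} = {x. \<exists>w\<in>G. slide j0 x w} \<inter> {x \<in> topspace (total X). proj X x \<in> U}"
      using \<theta>(3)[of "proj X _"] by (auto simp: fibre_def)
    then show "openin ?XU {x \<in> topspace ?XU. \<theta> x \<in> G}"
      using openin_slide[OF j0 G] by (simp add: openin_subtopology_Int)
  qed
  have V0: "V j0 \<in> Obj C" by (rule V[OF j0])
  have qc: "continuous_map (prod_topology ?U ?V) (total X) (\<lambda>p. q (fst p) (snd p))"
    unfolding continuous_map_def
  proof (intro conjI funcsetI allI impI)
    fix p assume "p \<in> topspace (prod_topology ?U ?V)"
    then show "q (fst p) (snd p) \<in> topspace (total X)" using q_in[of "fst p" "snd p"] by (auto simp: fibre_def)
  next
    fix W assume W: "openin (total X) W"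
    let ?W = "{p \<in> topspace (prod_topology ?U ?V). q (fst p) (snd p) \<in> W}"
    show "openin (prod_topology ?U ?V) ?W"
    proof (rule openin_prod_via_compacts[OF fib_props[OF V0]])
      show "?W \<subseteq> topspace ?U \<times> topspace ?V" by auto
      fix b assume "b \<in> topspace ?U"
      then have b: "b \<in> U" "b \<in> topspace (base X)" by auto
      have "continuous_map ?V (total X) (q b)"
        using homeomorphic_imp_continuous_map[OF fibre_param_homeo(1)[OF X b(2) q[OF b(1)]]]
        by (simp add: continuous_map_in_subtopology)
      from openin_continuous_map_preimage[OF this W]
      show "openin ?V {v. (b, v) \<in> ?W}" using b by simp
    next
      fix K assume K: "compactin ?V K"
      let ?N = "{b \<in> topspace ?U. {b} \<times> K \<subseteq> ?W}"
      have "openin (base X) ?N"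
      proof (rule base_open)
        fix j assume j: "j \<in> J"
        let ?D = "disk (dim j)"
        let ?A = "{y \<in> topspace ?D. c j y \<in> U}"
        let ?T = "subtopology ?D ?A"
        have A: "openin ?D ?A" using openin_reach_disk[OF j0 j] by (simp add: U_def)
        have T: "locally_connected_space ?T"
          by (rule locally_connected_space_open_subset[OF locally_connected_disk A])
        have tT: "topspace ?T = ?A" by auto
        \<comment> \<open>Over cell \<open>j\<close> the map \<open>q\<close> differs from the
          continuous \<open>\<Psi> j\<close> by a morphism \<open>g y\<close>, which is merely
          chosen for each \<open>y\<close>.\<close>
        have "\<forall>y. \<exists>g. y \<in> ?A \<longrightarrow> arr_map (V j0) (V j) g \<and> (\<forall>w\<in>topspace ?V. \<Psi> j y (g w) = q (c j y) w)"
        proof (intro allI)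
          fix y
          show "\<exists>g. y \<in> ?A \<longrightarrow> arr_map (V j0) (V j) g \<and> (\<forall>w\<in>topspace ?V. \<Psi> j y (g w) = q (c j y) w)"
          proof (cases "y \<in> ?A")
            case True
            then have y: "y \<in> topspace ?D" "c j y \<in> U" by auto
            obtain g where "arr_map (V j0) (V j) g" "\<And>w. w \<in> topspace ?V \<Longrightarrow> \<Psi> j y (g w) = q (c j y) w"
              using fibre_param_transition[OF X c_in[OF j y(1)] q[OF y(2)] par[OF j y(1)]] by blast
            then show ?thesis by blast
          next
            case False
            then show ?thesis by blast
          qed
        qed
        then obtain g where g': "\<forall>y. y \<in> ?A \<longrightarrow> arr_map (V j0) (V j) (g y) \<and> (\<forall>w\<in>topspace ?V. \<Psi> j y (g y w) = q (c j y) w)"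
          by (elim choice[THEN exE]) blast
        have g: "arr_map (V j0) (V j) (g y)" if "y \<in> ?A" for y
          by (rule g'[THEN spec, THEN mp, OF that, THEN conjunct1])
        have gq: "\<Psi> j y (g y w) = q (c j y) w" if "y \<in> ?A" "w \<in> topspace ?V" for y w
          by (rule g'[THEN spec, THEN mp, OF that(1), THEN conjunct2, THEN bspec, OF that(2)])
        have hc: "continuous_map (prod_topology ?T (fib C (V j))) ?V (\<lambda>(y, v). \<theta> (\<Psi> j y v))"
        proof -
          have "prod_topology ?T (fib C (V j)) = subtopology (prod_topology ?D (fib C (V j))) (?A \<times> topspace (fib C (V j)))"
            by (simp add: subtopology_Times)
          then have "continuous_map (prod_topology ?T (fib C (V j))) (total X) (\<lambda>p. \<Psi> j (fst p) (snd p))"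
            using \<Psi>[OF j] by (simp add: continuous_map_from_subtopology)
          moreover have "proj X (\<Psi> j (fst p) (snd p)) \<in> U \<and> \<Psi> j (fst p) (snd p) \<in> topspace (total X)"
            if "p \<in> topspace (prod_topology ?T (fib C (V j)))" for p
            using \<Psi>_in[OF j, of "fst p" "snd p"] that by (auto simp: fibre_def)
          ultimately have "continuous_map (prod_topology ?T (fib C (V j))) ?XU (\<lambda>p. \<Psi> j (fst p) (snd p))"
            by (intro continuous_map_into_subtopology) auto
          from continuous_map_compose[OF this \<theta>c] show ?thesis by (simp add: comp_def case_prod_unfold)
        qed
        \<comment> \<open>\<open>g y\<close> is the fibrewise inverse of
          \<open>\<theta> (\<Psi> j y v)\<close>, a map already known to be jointly continuous.
          Local connectedness of the open part \<open>?T\<close> of the disk transfers this to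
          \<open>g\<close>.\<close>
        have "continuous_map (prod_topology ?T ?V) (fib C (V j)) (\<lambda>(y, w). g y w)"
        proof (rule continuous_map_fibrewise_inverse[OF T fib_props[OF V[OF j]] hc])
          fix y assume "y \<in> topspace ?T"
          then have y: "y \<in> ?A" by (simp only: tT)
          obtain g' where g': "arr_map (V j) (V j0) g'" "homeomorphic_maps ?V (fib C (V j)) (g y) g'"
            using arr_map_inverse[OF g[OF y]] by blast
          have "\<theta> (\<Psi> j y v) = g' v" if v: "v \<in> topspace (fib C (V j))" for v
          proof -
            have w: "g' v \<in> topspace ?V" using arr_map_in[OF g'(1) v] .
            have "g y (g' v) = v" using g'(2) v by (simp add: homeomorphic_maps_def)
            then show ?thesis using gq[OF y w] \<theta>q[of "c j y", OF _ w] y by simp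
          qed
          then show "homeomorphic_maps (fib C (V j)) ?V (\<lambda>v. \<theta> (\<Psi> j y v)) (g y)"
            by (intro homeomorphic_maps_eq[OF homeomorphic_maps_sym[THEN iffD1, OF g'(2)]]) simp_all
        qed
        then have "continuous_map (prod_topology ?T ?V) (prod_topology ?D (fib C (V j))) (\<lambda>p. (fst p, g (fst p) (snd p)))"
          using continuous_map_compose[OF continuous_map_fst continuous_map_from_subtopology[OF continuous_map_id, of ?D ?A]]
          by (auto intro!: continuous_map_pairedI simp: case_prod_unfold comp_def)
        from continuous_map_compose[OF this \<Psi>[OF j]]
        have "continuous_map (prod_topology ?T ?V) (total X) (\<lambda>p. \<Psi> j (fst p) (g (fst p) (snd p)))"
          by (simp add: comp_def)
        then have "continuous_map (prod_topology ?T ?V) (total X) (\<lambda>p. q (c j (fst p)) (snd p))"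
          by (rule continuous_map_eq) (use gq in auto)
        from openin_tube[OF openin_continuous_map_preimage[OF this W] K]
        have "openin ?T {y \<in> topspace ?T. {y} \<times> K \<subseteq> {p \<in> topspace (prod_topology ?T ?V). q (c j (fst p)) (snd p) \<in> W}}" .
        then have "openin ?D {y \<in> topspace ?T. {y} \<times> K \<subseteq> {p \<in> topspace (prod_topology ?T ?V). q (c j (fst p)) (snd p) \<in> W}}"
          using A openin_trans_full by blast
        moreover have "{y \<in> topspace ?T. {y} \<times> K \<subseteq> {p \<in> topspace (prod_topology ?T ?V). q (c j (fst p)) (snd p) \<in> W}}
          = {y \<in> topspace ?D. c j y \<in> ?N}"
          using UB compactin_subset_topspace[OF K] by auto
        ultimately show "openin ?D {y \<in> topspace ?D. c j y \<in> ?N}" by simp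
      qed auto
      then show "openin ?U ?N" by (simp add: openin_open_subtopology[OF U] subset_iff)
    qed
  qed
  have "trivialization X ?U (\<lambda>b. b) (V j0) q (\<lambda>b. \<theta>)"
    unfolding trivialization_def
  proof (intro conjI ballI)
    show "continuous_map ?U (base X) (\<lambda>b. b)" by (simp add: continuous_map_from_subtopology)
    have "continuous_map (subtopology (prod_topology ?U (total X)) {p. proj X (snd p) = fst p}) ?XU snd"
      by (intro continuous_map_into_subtopology continuous_map_from_subtopology continuous_map_snd) auto
    from continuous_map_compose[OF this \<theta>c]
    show "continuous_map (subtopology (prod_topology ?U (total X)) {p. proj X (snd p) = fst p}) ?V (\<lambda>p. \<theta> (snd p))"
      by (simp add: comp_def)
  qed (use V0 qc q \<theta>q in auto)
  moreover have "c j0 y0 \<in> U" using reach_here[OF y0] by (simp add: U_def)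
  ultimately show ?thesis using U by (intro locally_trivial_atI)
qed

theorem F_bundle_cell_system: "F_bundle C X"
  unfolding F_bundle_iff
proof (intro conjI ballI X)
  fix b assume "b \<in> topspace (base X)"
  then obtain j y where "j \<in> J" "y \<in> open_disk (dim j)" "b = c j y" using cover by blast
  then show "locally_trivial_at X b" using locally_trivial_open_cell by simp
qed

end

section \<open>Push-outs and colimits of bundles\<close>

text \<open>Because the second leg is an inclusion, classes have normal forms: a point of
  \<open>A\<close> is replaced by its image under \<open>f\<close>. The function \<open>nf\<close>
  is constant on classes, so points identified in the push-out have equal normal forms, which gives
  injectivity and disjointness.\<close>

lemma top_pushout_inclusionD:
  assumes P: "top_pushout A X Y f (\<lambda>x. x) g k P"
  shows "inj_on g (topspace X)" and "inj_on k (topspace Y - topspace A)"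
    and "g ` topspace X \<inter> k ` (topspace Y - topspace A) = {}"
    and "\<And>a. a \<in> topspace A \<Longrightarrow> g (f a) = k a"
    and "topspace P = g ` topspace X \<union> k ` topspace Y"
    and "\<And>U. U \<subseteq> topspace P \<Longrightarrow> openin P U \<longleftrightarrow>
        openin X {x \<in> topspace X. g x \<in> U} \<and> openin Y {y \<in> topspace Y. k y \<in> U}"
proof -
  let ?G = "glue_rel (topspace A) f (\<lambda>x. x)"
  define nf where "nf u = (case u of Inl x \<Rightarrow> Inl x | Inr y \<Rightarrow> if y \<in> topspace A then Inl (f y) else Inr y)" for u
  have nf: "nf u = nf v" if "(u, v) \<in> (?G \<union> ?G\<inverse>)\<^sup>*" for u v
    using that by (induction rule: rtrancl_induct) (auto simp: glue_rel_def nf_def)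
  have eq: "nf u = nf v" if "u \<in> topspace X <+> topspace Y" "v \<in> topspace X <+> topspace Y" "case_sum g k u = case_sum g k v" for u v
  proof -
    have "case_sum g k u = case_sum g k v \<longleftrightarrow> (u, v) \<in> (?G \<union> ?G\<inverse>)\<^sup>*"
      using P that(1,2) unfolding top_pushout_def by blast
    then show ?thesis using that(3) nf by blast
  qed
  show "inj_on g (topspace X)"
  proof (rule inj_onI)
    fix x y assume "x \<in> topspace X" "y \<in> topspace X" "g x = g y"
    then have "nf (Inl x) = nf (Inl y)" by (intro eq) auto
    then show "x = y" by (simp add: nf_def)
  qed
  show "inj_on k (topspace Y - topspace A)"
  proof (rule inj_onI)
    fix x y assume "x \<in> topspace Y - topspace A" "y \<in> topspace Y - topspace A" "k x = k y"
    moreover from this have "nf (Inr x) = nf (Inr y)" by (intro eq) auto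
    ultimately show "x = y" by (simp add: nf_def)
  qed
  have "g x \<noteq> k y" if "x \<in> topspace X" "y \<in> topspace Y" "y \<notin> topspace A" for x y
  proof
    assume "g x = k y"
    then have "nf (Inl x) = nf (Inr y)" using that by (intro eq) auto
    then show False using that by (simp add: nf_def)
  qed
  then show "g ` topspace X \<inter> k ` (topspace Y - topspace A) = {}" by blast
  show "g (f a) = k a" if "a \<in> topspace A" for a
    using top_pushout_maps(3)[OF P that] .
  show "topspace P = g ` topspace X \<union> k ` topspace Y"
    using P by (simp add: top_pushout_def)
  show "openin P U \<longleftrightarrow> openin X {x \<in> topspace X. g x \<in> U} \<and> openin Y {y \<in> topspace Y. k y \<in> U}"
    if "U \<subseteq> topspace P" for U
    using P that by (simp add: top_pushout_def)
qed

text \<open>Every point is related to its normal form, and on normal forms the map to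
  \<open>P\<close> is injective; so two points with the same image are related.\<close>

lemma top_pushout_inclusionI:
  assumes f: "continuous_map A X f" and i: "continuous_map A Y (\<lambda>x. x)"
    and cov: "g ` topspace X \<union> k ` topspace Y = topspace P"
    and opn: "\<And>U. U \<subseteq> topspace P \<Longrightarrow> openin P U \<longleftrightarrow>
        openin X {x \<in> topspace X. g x \<in> U} \<and> openin Y {y \<in> topspace Y. k y \<in> U}"
    and g: "inj_on g (topspace X)" and k: "inj_on k (topspace Y - topspace A)"
    and disj: "g ` topspace X \<inter> k ` (topspace Y - topspace A) = {}"
    and gf: "\<And>a. a \<in> topspace A \<Longrightarrow> g (f a) = k a"
  shows "top_pushout A X Y f (\<lambda>x. x) g k P"
proof -
  let ?G = "glue_rel (topspace A) f (\<lambda>x. x)" and ?D = "topspace X <+> topspace Y"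
  let ?R = "(?G \<union> ?G\<inverse>)\<^sup>*"
  define nf where "nf u = (case u of Inl x \<Rightarrow> Inl x | Inr y \<Rightarrow> if y \<in> topspace A then Inl (f y) else Inr y)" for u
  have fX: "f a \<in> topspace X" if "a \<in> topspace A" for a using f that by (auto simp: continuous_map_def)
  have 1: "case_sum g k u = case_sum g k v" if "(u, v) \<in> ?R" for u v
    using that by (induction rule: rtrancl_induct) (auto simp: glue_rel_def gf)
  have symR: "(v, u) \<in> ?R" if "(u, v) \<in> ?R" for u v
  proof -
    have "sym (?G \<union> ?G\<inverse>)" by (auto simp: sym_def)
    then show ?thesis using that sym_rtrancl symD by metis
  qed
  have nfR: "(u, nf u) \<in> ?R" for u
    by (auto simp: nf_def glue_rel_def split: sum.splits intro!: r_into_rtrancl)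
  have nfD: "nf u \<in> Inl ` topspace X \<union> Inr ` (topspace Y - topspace A)" if "u \<in> ?D" for u
    using that fX by (auto simp: nf_def split: sum.splits)
  have inj: "u = v" if "u \<in> Inl ` topspace X \<union> Inr ` (topspace Y - topspace A)"
    "v \<in> Inl ` topspace X \<union> Inr ` (topspace Y - topspace A)" "case_sum g k u = case_sum g k v" for u v
  proof -
    have "g x \<noteq> k y \<and> k y \<noteq> g x" if "x \<in> topspace X" "y \<in> topspace Y" "y \<notin> topspace A" for x y
      using disj that by fastforce
    then show ?thesis using that g k by (auto dest: inj_onD)
  qed
  have 2: "(u, v) \<in> ?R" if "u \<in> ?D" "v \<in> ?D" "case_sum g k u = case_sum g k v" for u v
  proof -
    have "case_sum g k (nf u) = case_sum g k (nf v)" using 1[OF nfR] that(3) by metis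
    then have "nf u = nf v" using inj[OF nfD[OF that(1)] nfD[OF that(2)]] by blast
    then show ?thesis using nfR[of u] symR[OF nfR[of v]] rtrancl_trans by metis
  qed
  show ?thesis
    unfolding top_pushout_def
  proof (intro conjI ballI allI impI)
    fix u v assume "u \<in> ?D" "v \<in> ?D"
    then show "case_sum g k u = case_sum g k v \<longleftrightarrow> (u, v) \<in> ?R" using 1 2 by metis
  qed (use f i cov opn in simp_all)
qed

section \<open>Topology of a bundle detected by maps into the base\<close>

context groupoid_structure
begin

text \<open>\<open>L\<close> witnesses that \<open>E \<rightarrow> Y \<times>\<^bsub>base X\<^esub> X\<close> (induced by \<open>e\<close>) has a continuous right inverse.\<close>

definition cartesian_lift ::
  "('x, 'b, 'o, 'f) family \<Rightarrow> 'y topology \<Rightarrow> 'e topology \<Rightarrow> ('y \<Rightarrow> 'b) \<Rightarrow> ('e \<Rightarrow> 'x) \<Rightarrow> ('y \<Rightarrow> 'x \<Rightarrow> 'e) \<Rightarrow> bool" where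
  "cartesian_lift X Y E k e L \<longleftrightarrow> continuous_map Y (base X) k \<and>
     continuous_map (subtopology (prod_topology Y (total X)) {p. proj X (snd p) = k (fst p)}) E
       (\<lambda>p. L (fst p) (snd p)) \<and>
     (\<forall>y\<in>topspace Y. \<forall>x\<in>fibre X (k y). e (L y x) = x)"

lemma cartesian_lift_continuous:
  assumes l: "cartesian_lift X Y E k e L" and a: "continuous_map S Y a" and d: "continuous_map S (total X) d"
    and ad: "\<And>s. s \<in> topspace S \<Longrightarrow> proj X (d s) = k (a s)"
  shows "continuous_map S E (\<lambda>s. L (a s) (d s))"
proof -
  have "continuous_map S (subtopology (prod_topology Y (total X)) {p. proj X (snd p) = k (fst p)}) (\<lambda>s. (a s, d s))"
    using a d ad by (auto intro!: continuous_map_into_subtopology continuous_map_pairedI)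
  from continuous_map_compose[OF this] l show ?thesis by (fastforce simp: cartesian_lift_def comp_def)
qed

lemma cartesian_lift_trivialization:
  assumes X: "F_family C X" and tr: "trivialization X T c V \<Psi> \<Theta>"
  shows "cartesian_lift X T (prod_topology T (fib C V)) c (\<lambda>p. \<Psi> (fst p) (snd p)) (\<lambda>t x. (t, \<Theta> t x))"
  unfolding cartesian_lift_def
proof (intro conjI ballI)
  show "continuous_map T (base X) c" using tr by (simp add: trivialization_def)
  show "continuous_map (subtopology (prod_topology T (total X)) {p. proj X (snd p) = c (fst p)})
     (prod_topology T (fib C V)) (\<lambda>p. (fst p, \<Theta> (fst p) (snd p)))"
    using tr by (intro continuous_map_pairedI continuous_map_from_subtopology[OF continuous_map_fst])
      (simp add: trivialization_def)
qed (use trivialization_inverse(2)[OF X tr] in auto)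

lemma cartesian_lift_restrict:
  assumes "A \<subseteq> B"
  shows "cartesian_lift (restrict_fam X B) (subtopology (base X) A) (total (restrict_fam X A)) (\<lambda>b. b) (\<lambda>x. x) (\<lambda>b x. x)"
  unfolding cartesian_lift_def
proof (intro conjI ballI)
  show "continuous_map (subtopology (base X) A) (base (restrict_fam X B)) (\<lambda>b. b)"
    using assms by (auto simp: continuous_map_in_subtopology intro: continuous_map_from_subtopology)
  have "continuous_map (prod_topology (subtopology (base X) A) (total (restrict_fam X B))) (total X) snd"
    using continuous_map_snd[of "subtopology (base X) A" "total (restrict_fam X B)"] by (simp add: continuous_map_in_subtopology)
  then show "continuous_map (subtopology (prod_topology (subtopology (base X) A) (total (restrict_fam X B)))
      {p. proj (restrict_fam X B) (snd p) = fst p}) (total (restrict_fam X A)) (\<lambda>p. snd p)"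
    by (simp only: restrict_simps, intro continuous_map_into_subtopology[OF continuous_map_from_subtopology]) auto
qed auto

lemma cartesian_lift_into_restrict:
  assumes l: "cartesian_lift X Y E k e L" and k: "k ` topspace Y \<subseteq> B"
  shows "cartesian_lift (restrict_fam X B) Y E k e L"
  unfolding cartesian_lift_def
proof (intro conjI ballI)
  show "continuous_map Y (base (restrict_fam X B)) k"
    using l k by (auto simp: cartesian_lift_def continuous_map_in_subtopology)
  let ?S = "subtopology (prod_topology Y (total (restrict_fam X B))) {p. proj (restrict_fam X B) (snd p) = k (fst p)}"
  have "continuous_map (prod_topology Y (total (restrict_fam X B))) (total X) snd"
    using continuous_map_snd[of Y "total (restrict_fam X B)"] by (simp add: continuous_map_in_subtopology)
  then show "continuous_map ?S E (\<lambda>p. L (fst p) (snd p))"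
    by (intro cartesian_lift_continuous[OF l] continuous_map_from_subtopology continuous_map_fst) auto
next
  fix y x assume "y \<in> topspace Y" "x \<in> fibre (restrict_fam X B) (k y)"
  then show "e (L y x) = x" using l k by (auto simp: cartesian_lift_def fibre_restrict)
qed

text \<open>Over the part of \<open>Y\<close> above \<open>U\<close> the map
  \<open>L y (\<Psi> (k y) v)\<close> is continuous into \<open>E\<close>, and \<open>e\<close>
  returns \<open>\<Psi> (k y) v\<close>. So openness of the preimage of \<open>W\<close> in
  \<open>E\<close> can be pulled back to a product with the fibre, and the tube lemma disposes of
  \<open>K\<close>.\<close>

lemma openin_lift_compacts:
  assumes X: "F_family C X" and l: "cartesian_lift X Y E k e L"
    and W: "openin E {m \<in> topspace E. e m \<in> W}"
    and U: "openin (base X) U" and tr: "trivialization X (subtopology (base X) U) (\<lambda>b. b) V \<Psi> \<Theta>"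
    and K: "compactin (fib C V) K"
  shows "openin Y {y \<in> topspace Y. k y \<in> U \<and> \<Psi> (k y) ` K \<subseteq> W}"
proof -
  let ?A = "{y \<in> topspace Y. k y \<in> U}"
  let ?T = "subtopology Y ?A"
  have kc: "continuous_map Y (base X) k" using l by (simp add: cartesian_lift_def)
  have A: "openin Y ?A" by (rule openin_continuous_map_preimage[OF kc U])
  have UB: "U \<subseteq> topspace (base X)" by (rule openin_subset[OF U])
  have kT: "continuous_map ?T (subtopology (base X) U) k"
    by (intro continuous_map_into_subtopology[OF continuous_map_from_subtopology] kc) auto
  let ?P = "prod_topology ?T (fib C V)"
  have fst': "continuous_map ?P Y fst"
    using continuous_map_fst[of ?T "fib C V"] by (simp add: continuous_map_in_subtopology)
  have \<Psi>c: "continuous_map ?P (total X) (\<lambda>p. \<Psi> (k (fst p)) (snd p))"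
    by (intro trivialization_continuous(1)[OF tr] continuous_map_snd
        continuous_map_compose[OF continuous_map_fst kT, unfolded comp_def])
  have \<Psi>f: "\<Psi> (k (fst p)) (snd p) \<in> fibre X (k (fst p))" if "p \<in> topspace ?P" for p
    using that UB by (intro trivialization_in_fibre[OF tr]) auto
  have Lc: "continuous_map ?P E (\<lambda>p. L (fst p) (\<Psi> (k (fst p)) (snd p)))"
    by (rule cartesian_lift_continuous[OF l fst' \<Psi>c]) (use \<Psi>f in \<open>simp add: fibre_def\<close>)
  from openin_tube[OF openin_continuous_map_preimage[OF Lc W] K]
  have "openin ?T {y \<in> topspace ?T. {y} \<times> K \<subseteq> {p \<in> topspace ?P.
    L (fst p) (\<Psi> (k (fst p)) (snd p)) \<in> {m \<in> topspace E. e m \<in> W}}}" (is "openin ?T ?N") .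
  then have "openin Y ?N" using A openin_trans_full by blast
  moreover have "?N = {y \<in> topspace Y. k y \<in> U \<and> \<Psi> (k y) ` K \<subseteq> W}"
  proof -
    have KV: "K \<subseteq> topspace (fib C V)" using compactin_subset_topspace[OF K] .
    have "L y (\<Psi> (k y) v) \<in> topspace E \<and> e (L y (\<Psi> (k y) v)) = \<Psi> (k y) v"
      if "y \<in> ?A" "v \<in> K" for y v
    proof -
      have p: "(y, v) \<in> topspace ?P" using that KV by auto
      have "L y (\<Psi> (k y) v) \<in> topspace E"
        using Pi_mem[OF continuous_map_funspace[OF Lc] p] by simp
      then show ?thesis using l \<Psi>f[OF p] that by (simp add: cartesian_lift_def)
    qed
    then show ?thesis using KV by (auto 0 4)
  qed
  ultimately show ?thesis by simp
qed

text \<open>For a fixed \<open>y\<close> the map \<open>L y\<close> is a continuous section of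
  \<open>e\<close> over the fibre, along which openness of the preimage of \<open>W\<close> is
  pulled back.\<close>

lemma openin_lift_fibre:
  assumes l: "cartesian_lift X Y E k e L" and W: "openin E {m \<in> topspace E. e m \<in> W}" and y: "y \<in> topspace Y"
  shows "openin (subtopology (total X) (fibre X (k y))) (W \<inter> fibre X (k y))"
proof -
  let ?F = "subtopology (total X) (fibre X (k y))"
  have c: "continuous_map ?F E (\<lambda>x. L y x)"
    by (rule cartesian_lift_continuous[OF l]) (use y in \<open>auto simp: fibre_def continuous_map_from_subtopology\<close>)
  have "{x \<in> topspace ?F. L y x \<in> {m \<in> topspace E. e m \<in> W}} = W \<inter> fibre X (k y)"
  proof -
    have "L y x \<in> topspace E \<and> e (L y x) = x \<and> x \<in> topspace ?F" if "x \<in> fibre X (k y)" for x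
    proof -
      have "x \<in> topspace ?F" using that by (auto simp: fibre_def)
      then show ?thesis using c l y that by (auto simp: continuous_map_def cartesian_lift_def)
    qed
    then show ?thesis by auto
  qed
  then show ?thesis using openin_continuous_map_preimage[OF c W] by simp
qed

text \<open>The pull-back of a quotient map along the projection of a bundle is a quotient map, because the
  fibres are locally compact. The quotient map is given by two families of maps into the base, which
  may come from spaces of different types.\<close>

lemma openin_total_via_lifts:
  assumes B: "F_bundle C X" and W: "W \<subseteq> topspace (total X)"
    and l1: "\<And>i. i \<in> I \<Longrightarrow> cartesian_lift X (Y i) (E i) (k i) (e i) (L i)"
    and o1: "\<And>i. i \<in> I \<Longrightarrow> openin (E i) {m \<in> topspace (E i). e i m \<in> W}"
    and l2: "\<And>i. i \<in> I' \<Longrightarrow> cartesian_lift X (Y' i) (E' i) (k' i) (e' i) (L' i)"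
    and o2: "\<And>i. i \<in> I' \<Longrightarrow> openin (E' i) {m \<in> topspace (E' i). e' i m \<in> W}"
    and cov: "\<And>b. b \<in> topspace (base X) \<Longrightarrow> (\<exists>i\<in>I. b \<in> k i ` topspace (Y i)) \<or> (\<exists>i\<in>I'. b \<in> k' i ` topspace (Y' i))"
    and detect: "\<And>N. N \<subseteq> topspace (base X) \<Longrightarrow> (\<And>i. i \<in> I \<Longrightarrow> openin (Y i) {y \<in> topspace (Y i). k i y \<in> N}) \<Longrightarrow>
       (\<And>i. i \<in> I' \<Longrightarrow> openin (Y' i) {y \<in> topspace (Y' i). k' i y \<in> N}) \<Longrightarrow> openin (base X) N"
  shows "openin (total X) W"
proof (subst openin_subopen, intro ballI)
  note X = F_bundle_family[OF B]
  have pr: "continuous_map (total X) (base X) (proj X)" using X by (simp add: F_family_def)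
  fix x assume x: "x \<in> W"
  then have xX: "x \<in> topspace (total X)" using W by blast
  then have b: "proj X x \<in> topspace (base X)" using pr by (auto simp: continuous_map_def)
  have "locally_trivial_at X (proj X x)" using B b by (simp add: F_bundle_iff)
  then obtain U V \<Psi> \<Theta> where U: "openin (base X) U" "proj X x \<in> U"
    and tr: "trivialization X (subtopology (base X) U) (\<lambda>b. b) V \<Psi> \<Theta>"
    by (rule locally_trivial_atE)
  have V: "V \<in> Obj C" using tr by (simp add: trivialization_def)
  have UB: "U \<subseteq> topspace (base X)" by (rule openin_subset[OF U(1)])
  let ?U = "subtopology (base X) U" and ?XU = "subtopology (total X) {x \<in> topspace (total X). proj X x \<in> U}"
  have tU: "topspace ?U = U" using UB by auto
  let ?W = "{p \<in> U \<times> topspace (fib C V). \<Psi> (fst p) (snd p) \<in> W}"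
  have oW: "openin (prod_topology ?U (fib C V)) ?W"
  proof (rule openin_prod_via_compacts[OF fib_props[OF V]])
    show "?W \<subseteq> topspace ?U \<times> topspace (fib C V)" using tU by auto
    fix b assume "b \<in> topspace ?U"
    then have b: "b \<in> U" "b \<in> topspace (base X)" by auto
    have "fibre_param X b V (\<Psi> b)" using tr b(1) tU by (simp add: trivialization_def)
    then have \<Psi>c: "continuous_map (fib C V) (subtopology (total X) (fibre X b)) (\<Psi> b)"
      using fibre_param_homeo(1)[OF X b(2)] homeomorphic_imp_continuous_map by blast
    have "openin (subtopology (total X) (fibre X b)) (W \<inter> fibre X b)"
      using cov[OF b(2)] openin_lift_fibre[OF l1 o1] openin_lift_fibre[OF l2 o2] by blast
    from openin_continuous_map_preimage[OF \<Psi>c this]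
    have "openin (fib C V) {v \<in> topspace (fib C V). \<Psi> b v \<in> W \<inter> fibre X b}" .
    moreover have "{v \<in> topspace (fib C V). \<Psi> b v \<in> W \<inter> fibre X b} = {v. (b, v) \<in> ?W}"
      using b trivialization_in_fibre[OF tr, of b] by auto
    ultimately show "openin (fib C V) {v. (b, v) \<in> ?W}" by simp
  next
    fix K assume K: "compactin (fib C V) K"
    have KV: "K \<subseteq> topspace (fib C V)" using compactin_subset_topspace[OF K] .
    \<comment> \<open>Only a set of base points is left, and \<open>detect\<close> tests it through
      the maps \<open>k i\<close> and \<open>k' i\<close>.\<close>
    have "openin (base X) {b \<in> U. \<Psi> b ` K \<subseteq> W}"
    proof (rule detect)
      show "{b \<in> U. \<Psi> b ` K \<subseteq> W} \<subseteq> topspace (base X)" using UB by blast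
      show "openin (Y i) {y \<in> topspace (Y i). k i y \<in> {b \<in> U. \<Psi> b ` K \<subseteq> W}}" if "i \<in> I" for i
        using openin_lift_compacts[OF X l1[OF that] o1[OF that] U(1) tr K] by simp
      show "openin (Y' i) {y \<in> topspace (Y' i). k' i y \<in> {b \<in> U. \<Psi> b ` K \<subseteq> W}}" if "i \<in> I'" for i
        using openin_lift_compacts[OF X l2[OF that] o2[OF that] U(1) tr K] by simp
    qed
    moreover have "{b \<in> topspace ?U. {b} \<times> K \<subseteq> ?W} = {b \<in> U. \<Psi> b ` K \<subseteq> W}"
      using KV UB by auto
    ultimately show "openin ?U {b \<in> topspace ?U. {b} \<times> K \<subseteq> ?W}"
      by (simp add: openin_open_subtopology[OF U(1)] subset_iff)
  qed
  have pU: "continuous_map ?XU ?U (proj X)"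
    by (intro continuous_map_into_subtopology[OF continuous_map_from_subtopology] pr) auto
  have "continuous_map ?XU (fib C V) (\<lambda>x. \<Theta> (proj X x) x)"
    by (rule trivialization_continuous(2)[OF tr pU]) (auto intro: continuous_map_from_subtopology)
  with pU have "continuous_map ?XU (prod_topology ?U (fib C V)) (\<lambda>x. (proj X x, \<Theta> (proj X x) x))"
    by (rule continuous_map_pairedI)
  from openin_continuous_map_preimage[OF this oW]
  have "openin ?XU {x \<in> topspace ?XU. (proj X x, \<Theta> (proj X x) x) \<in> ?W}" .
  then have "openin (total X) {x \<in> topspace ?XU. (proj X x, \<Theta> (proj X x) x) \<in> ?W}"
    using openin_continuous_map_preimage[OF pr U(1)] openin_trans_full by blast
  moreover have "\<Theta> (proj X x) x \<in> topspace (fib C V) \<and> \<Psi> (proj X x) (\<Theta> (proj X x) x) = x"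
    if "x \<in> topspace ?XU" for x
    using trivialization_inverse[OF X tr, of "proj X x" x] that tU by (auto simp: fibre_def)
  ultimately show "\<exists>T. openin (total X) T \<and> x \<in> T \<and> T \<subseteq> W"
    using x xX U(2) by (intro exI[of _ "{x \<in> topspace ?XU. (proj X x, \<Theta> (proj X x) x) \<in> ?W}"] conjI) auto
qed

text \<open>\<open>fb'\<close> is separate from \<open>fb\<close> because an attaching map and the
  canonical map of a push-out agree only over the glued part \<open>A\<close>.\<close>

lemma F_map_restrict:
  assumes f: "F_map C M X f fb" and img: "\<And>b. b \<in> topspace (base M) \<Longrightarrow> b \<in> A \<Longrightarrow> fb b \<in> B \<and> fb' b = fb b"
    and M: "F_family C M"
  shows "F_map C (restrict_fam M A) (restrict_fam X B) f fb'"
  unfolding F_map_def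
proof (intro conjI ballI)
  have prM: "proj M m \<in> topspace (base M)" if "m \<in> topspace (total M)" for m
    using M that by (auto simp: F_family_def continuous_map_def)
  have pr: "proj X (f m) = fb (proj M m)" if "m \<in> topspace (total M)" for m
    using f that by (simp add: F_map_def)
  have fc: "continuous_map (total M) (total X) f" "continuous_map (base M) (base X) fb"
    using f by (simp_all add: F_map_def)
  have fX: "f m \<in> topspace (total X)" if "m \<in> topspace (total M)" for m
    using fc(1) that by (auto simp: continuous_map_def)
  show "continuous_map (total (restrict_fam M A)) (total (restrict_fam X B)) f"
    unfolding restrict_simps
    by (rule continuous_map_into_subtopology[OF continuous_map_from_subtopology[OF fc(1)]])
      (use prM pr img fX in auto)
  have "continuous_map (subtopology (base M) A) (base X) fb'"
    by (rule continuous_map_eq[OF continuous_map_from_subtopology[OF fc(2)]]) (use img in auto)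
  then show "continuous_map (base (restrict_fam M A)) (base (restrict_fam X B)) fb'"
    unfolding restrict_simps by (rule continuous_map_into_subtopology) (use img in auto)
  show "proj (restrict_fam X B) (f m) = fb' (proj (restrict_fam M A) m)"
    if "m \<in> topspace (total (restrict_fam M A))" for m
    using that pr prM img by simp
  fix b assume "b \<in> topspace (base (restrict_fam M A))"
  then have b: "b \<in> topspace (base M)" "b \<in> A" by auto
  then obtain \<phi> where "represents C M X f fb b \<phi>" using f by (auto simp: F_map_def)
  then have "represents C (restrict_fam M A) (restrict_fam X B) f fb' b \<phi>"
    using img[OF b] b by (simp add: represents_def fibre_restrict)
  then show "\<exists>\<phi>. represents C (restrict_fam M A) (restrict_fam X B) f fb' b \<phi>" by blast
qed

lemma restrict_fam_UNIV: "restrict_fam X UNIV = X"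
  by (simp add: restrict_fam_def)

lemma F_map_id:
  assumes X: "F_family C X"
  shows "F_map C X X (\<lambda>x. x) (\<lambda>b. b)"
  by (rule F_mapI[OF X]) (use fibre_param_chart_inverse[OF X] in \<open>auto intro!: exI\<close>)

lemma F_map_fibre_iso:
  assumes "F_map C X Y f fb" and "b \<in> topspace (base X)"
  shows "fibre_iso C X Y f fb b"
proof -
  obtain \<phi> where "represents C X Y f fb b \<phi>" using assms by (auto simp: F_map_def)
  then show ?thesis by (rule fibre_isoI)
qed

text \<open>The assumptions on \<open>L\<close> say that \<open>M\<close> is isomorphic to the pull-back of \<open>X\<close> along \<open>k\<close>.\<close>

lemma F_pushout_of_base_pushout:
  assumes B: "F_bundle C X" and M: "F_family C M" and kt: "F_map C M X kt k"
    and lift: "cartesian_lift X (base M) (total M) k kt L"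
    and Lk: "\<And>m. m \<in> topspace (total M) \<Longrightarrow> L (proj M m) (kt m) = m"
    and A: "closedin (base M) A" and B1: "B1 \<subseteq> P" and P: "P \<subseteq> topspace (base X)"
    and po: "top_pushout (subtopology (base M) A) (subtopology (base X) B1) (base M) ab (\<lambda>x. x) (\<lambda>x. x) k
        (subtopology (base X) P)"
  shows "F_pushout C (restrict_fam M A) (restrict_fam X B1) M kt ab (\<lambda>x. x) (\<lambda>b. b) kt k (restrict_fam X P)"
proof -
  note X = F_bundle_family[OF B]
  note po' = top_pushout_inclusionD[OF po]
  have AM: "A \<subseteq> topspace (base M)" by (rule closedin_subset[OF A])
  have tops: "topspace (subtopology (base M) A) = A" "topspace (subtopology (base X) B1) = B1"
    "topspace (subtopology (base X) P) = P" using AM B1 P by auto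
  have attB: "ab a \<in> B1" and kA: "ab a = k a" if "a \<in> A" for a
    using po'(4)[of a] po that AM tops unfolding top_pushout_def continuous_map_def by auto
  have cov: "P = B1 \<union> k ` topspace (base M)" using po'(5) tops by simp
  have kP: "k m \<in> P" if "m \<in> topspace (base M)" for m using cov that by blast
  have prM: "proj M m \<in> topspace (base M)" if "m \<in> topspace (total M)" for m
    using M that by (auto simp: F_family_def continuous_map_def)
  have pr: "proj X (kt m) = k (proj M m)" "kt m \<in> topspace (total X)" if "m \<in> topspace (total M)" for m
    using kt that by (auto simp: F_map_def continuous_map_def)
  have XP: "F_family C (restrict_fam X P)" and BP: "F_bundle C (restrict_fam X P)"
    using F_family_restrict[OF X] F_bundle_restrict[OF B] by auto
  have h: "F_map C (restrict_fam M A) (restrict_fam X B1) kt ab"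
    by (rule F_map_restrict[OF kt _ M]) (use attB kA in auto)
  have g: "F_map C (restrict_fam X B1) (restrict_fam X P) (\<lambda>x. x) (\<lambda>b. b)"
    by (rule F_map_restrict[OF F_map_id[OF X] _ X]) (use B1 in auto)
  have k: "F_map C M (restrict_fam X P) kt k"
    using F_map_restrict[OF kt _ M, of UNIV P k] kP by (simp add: restrict_fam_UNIV)
  have cl: "closed_inclusion (restrict_fam M A) M"
    using A tops AM by (simp add: closed_inclusion_def Int_absorb1)
  have Lt: "L y x \<in> topspace (total M) \<and> kt (L y x) = x" if "y \<in> topspace (base M)" "x \<in> fibre X (k y)" for x y
  proof -
    have "continuous_map (subtopology (prod_topology (base M) (total X)) {p. proj X (snd p) = k (fst p)}) (total M)
       (\<lambda>p. L (fst p) (snd p))"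
      using lift by (simp add: cartesian_lift_def)
    from Pi_mem[OF continuous_map_funspace[OF this], of "(y, x)"]
    show ?thesis using lift that by (auto simp: cartesian_lift_def fibre_def)
  qed
  have top: "top_pushout (total (restrict_fam M A)) (total (restrict_fam X B1)) (total M) kt (\<lambda>x. x) (\<lambda>x. x) kt
      (total (restrict_fam X P))"
  proof (rule top_pushout_inclusionI)
    show "continuous_map (total (restrict_fam M A)) (total (restrict_fam X B1)) kt"
      using h by (simp add: F_map_def)
    show "continuous_map (total (restrict_fam M A)) (total M) (\<lambda>x. x)"
      by (simp add: continuous_map_from_subtopology)
    show "(\<lambda>x. x) ` topspace (total (restrict_fam X B1)) \<union> kt ` topspace (total M) = topspace (total (restrict_fam X P))"
    proof
      show "(\<lambda>x. x) ` topspace (total (restrict_fam X B1)) \<union> kt ` topspace (total M) \<subseteq> topspace (total (restrict_fam X P))"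
        using B1 pr prM kP by auto
      show "topspace (total (restrict_fam X P)) \<subseteq> (\<lambda>x. x) ` topspace (total (restrict_fam X B1)) \<union> kt ` topspace (total M)"
      proof
        fix x assume "x \<in> topspace (total (restrict_fam X P))"
        then have x: "x \<in> topspace (total X)" "proj X x \<in> P" by auto
        show "x \<in> (\<lambda>x. x) ` topspace (total (restrict_fam X B1)) \<union> kt ` topspace (total M)"
        proof (cases "proj X x \<in> B1")
          case True
          then show ?thesis using x by simp
        next
          case False
          then obtain y where y: "y \<in> topspace (base M)" "proj X x = k y" using x(2) cov by blast
          then show ?thesis using Lt[of y x] x by (force simp: fibre_def)
        qed
      qed
    qed
    fix U assume U: "U \<subseteq> topspace (total (restrict_fam X P))"
    show "openin (total (restrict_fam X P)) U \<longleftrightarrow> openin (total (restrict_fam X B1)) {x \<in> topspace (total (restrict_fam X B1)). x \<in> U} \<and>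
      openin (total M) {y \<in> topspace (total M). kt y \<in> U}"
    proof (intro iffI conjI)
      assume o: "openin (total (restrict_fam X P)) U"
      show "openin (total (restrict_fam X B1)) {x \<in> topspace (total (restrict_fam X B1)). x \<in> U}"
        by (rule openin_continuous_map_preimage[OF _ o]) (use g in \<open>simp add: F_map_def\<close>)
      show "openin (total M) {y \<in> topspace (total M). kt y \<in> U}"
        by (rule openin_continuous_map_preimage[OF _ o]) (use k in \<open>simp add: F_map_def\<close>)
    next
      assume o: "openin (total (restrict_fam X B1)) {x \<in> topspace (total (restrict_fam X B1)). x \<in> U} \<and>
        openin (total M) {y \<in> topspace (total M). kt y \<in> U}"
      show "openin (total (restrict_fam X P)) U"
      \<comment> \<open>The part of \<open>X\<close> over \<open>P\<close> is tested by two lifts,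
        the identity over \<open>B1\<close> and \<open>L\<close> over the base of \<open>M\<close>;
        hence the one-point index sets.\<close>
      proof (rule openin_total_via_lifts[OF BP U, where I = "{()}" and I' = "{()}"])
        show "cartesian_lift (restrict_fam X P) (subtopology (base X) B1) (total (restrict_fam X B1)) (\<lambda>b. b) (\<lambda>x. x) (\<lambda>b x. x)"
          by (rule cartesian_lift_restrict[OF B1])
        show "cartesian_lift (restrict_fam X P) (base M) (total M) k kt L"
          by (rule cartesian_lift_into_restrict[OF lift]) (use kP in blast)
        fix b assume "b \<in> topspace (base (restrict_fam X P))"
        then have "b \<in> B1 \<union> k ` topspace (base M)" using cov by auto
        then show "(\<exists>i\<in>{()}. b \<in> (\<lambda>b. b) ` topspace (subtopology (base X) B1)) \<or> (\<exists>i\<in>{()}. b \<in> k ` topspace (base M))"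
          unfolding tops by simp
      next
        fix N assume N: "N \<subseteq> topspace (base (restrict_fam X P))"
          and "\<And>i. i \<in> {()} \<Longrightarrow> openin (subtopology (base X) B1) {y \<in> topspace (subtopology (base X) B1). y \<in> N}"
          and "\<And>i. i \<in> {()} \<Longrightarrow> openin (base M) {y \<in> topspace (base M). k y \<in> N}"
        then show "openin (base (restrict_fam X P)) N" using po'(6)[of N] by simp
      qed (use o in auto)
    qed
  next
    show "inj_on (\<lambda>x. x) (topspace (total (restrict_fam X B1)))" by simp
    show "inj_on kt (topspace (total M) - topspace (total (restrict_fam M A)))"
    proof (rule inj_onI)
      fix m m' assume m: "m \<in> topspace (total M) - topspace (total (restrict_fam M A))"
        "m' \<in> topspace (total M) - topspace (total (restrict_fam M A))" and eq: "kt m = kt m'"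
      then have mm: "m \<in> topspace (total M)" "m' \<in> topspace (total M)" "proj M m \<notin> A" "proj M m' \<notin> A" by auto
      \<comment> \<open>Off \<open>A\<close> the map \<open>k\<close> is injective, which identifies
        the base points. A point of \<open>M\<close> is recovered by \<open>L\<close> from its base
        point and its image.\<close>
      have "k (proj M m) = k (proj M m')" using pr(1) mm eq by metis
      then have "proj M m = proj M m'"
        using inj_onD[OF po'(2)] mm prM tops by simp
      then show "m = m'" using Lk mm eq by metis
    qed
    show "(\<lambda>x. x) ` topspace (total (restrict_fam X B1)) \<inter> kt ` (topspace (total M) - topspace (total (restrict_fam M A))) = {}"
    proof -
      have "proj X (kt m) \<notin> B1" if "m \<in> topspace (total M)" "proj M m \<notin> A" for m
      proof -
        have "proj M m \<in> topspace (base M) - topspace (subtopology (base M) A)" using that prM tops by simp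
        then show ?thesis using po'(3) pr(1)[OF that(1)] unfolding tops by auto
      qed
      then show ?thesis by auto
    qed
  qed simp
  show ?thesis
    unfolding F_pushout_def
  proof (intro conjI ballI)
    show "F_family C (restrict_fam M A)" "F_family C (restrict_fam X B1)"
      using F_family_restrict M X by auto
    show "fibre_iso C (restrict_fam X B1) (restrict_fam X P) (\<lambda>x. x) (\<lambda>b. b) b"
      if "b \<in> topspace (base (restrict_fam X B1))" for b
      by (rule F_map_fibre_iso[OF g that])
    show "fibre_iso C M (restrict_fam X P) kt k b"
      if "b \<in> topspace (base M) - topspace (base (restrict_fam M A))" for b
      using F_map_fibre_iso[OF k] that by blast
    show "top_pushout (base (restrict_fam M A)) (base (restrict_fam X B1)) (base M) ab (\<lambda>x. x) (\<lambda>b. b) k (base (restrict_fam X P))"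
      using po by simp
  qed (use M XP cl h g k top in auto)
qed

text \<open>The inclusion of each stage into the base is lifted by the identity of \<open>X\<close>,
  so the colimit topology of the base passes to the total space.\<close>

lemma fam_colimit_of_base:
  assumes B: "F_bundle C X" and co: "seq_colimit (base X) S"
  shows "fam_colimit X S"
  unfolding fam_colimit_def
proof (intro conjI co)
  let ?E = "\<lambda>n. {x \<in> topspace (total X). proj X x \<in> S n}"
  note X = F_bundle_family[OF B]
  have prX: "proj X x \<in> topspace (base X)" if "x \<in> topspace (total X)" for x
    using X that by (auto simp: F_family_def continuous_map_def)
  have S: "\<And>n. S n \<subseteq> S (Suc n)" "(\<Union>n. S n) = topspace (base X)"
    "\<And>U. U \<subseteq> topspace (base X) \<Longrightarrow> openin (base X) U \<longleftrightarrow> (\<forall>n. openin (subtopology (base X) (S n)) (U \<inter> S n))"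
    using co unfolding seq_colimit_def by auto
  show "seq_colimit (total X) ?E"
    unfolding seq_colimit_def
  proof (intro conjI allI impI)
    show "?E n \<subseteq> ?E (Suc n)" for n using S(1) by auto
    show "(\<Union>n. ?E n) = topspace (total X)" using prX S(2) by blast
    fix U assume U: "U \<subseteq> topspace (total X)"
    show "openin (total X) U \<longleftrightarrow> (\<forall>n. openin (subtopology (total X) (?E n)) (U \<inter> ?E n))"
    proof
      assume "openin (total X) U"
      then show "\<forall>n. openin (subtopology (total X) (?E n)) (U \<inter> ?E n)"
        by (simp add: openin_subtopology_Int)
    next
      assume o: "\<forall>n. openin (subtopology (total X) (?E n)) (U \<inter> ?E n)"
      show "openin (total X) U"
      \<comment> \<open>The second family of lifts is empty here. The type \<open>unit\<close> and
        the constant \<open>undefined\<close> below merely fill its slots.\<close>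
      proof (rule openin_total_via_lifts[OF B U, where I = "UNIV" and I' = "{} :: unit set"])
        fix n
        have "cartesian_lift (restrict_fam X UNIV) (subtopology (base X) (S n)) (total (restrict_fam X (S n))) (\<lambda>b. b) (\<lambda>x. x) (\<lambda>b x. x)"
          by (rule cartesian_lift_restrict) simp
        then show "cartesian_lift X (subtopology (base X) (S n)) (total (restrict_fam X (S n))) (\<lambda>b. b) (\<lambda>x. x) (\<lambda>b x. x)"
          by (simp only: restrict_fam_UNIV)
        have "{m \<in> topspace (total (restrict_fam X (S n))). m \<in> U} = U \<inter> ?E n" by auto
        then show "openin (total (restrict_fam X (S n))) {m \<in> topspace (total (restrict_fam X (S n))). m \<in> U}"
          using o by simp
      next
        fix b assume "b \<in> topspace (base X)"
        then show "(\<exists>n\<in>UNIV. b \<in> (\<lambda>b. b) ` topspace (subtopology (base X) (S n))) \<or> (\<exists>i\<in>{}. b \<in> undefined i ` topspace (undefined i))"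
          using S(2) by auto
      next
        fix N assume N: "N \<subseteq> topspace (base X)"
          and o: "\<And>n. n \<in> UNIV \<Longrightarrow> openin (subtopology (base X) (S n)) {y \<in> topspace (subtopology (base X) (S n)). y \<in> N}"
        have "{y \<in> topspace (subtopology (base X) (S n)). y \<in> N} = N \<inter> S n" for n using N by auto
        then show "openin (base X) N" using S(3)[OF N] o by simp
      qed auto
    qed
  qed
qed

section \<open>Pull-back of bundles and the bundles over the pieces of a stratification\<close>

definition pullback_fam :: "('x, 'b, 'o, 'f) family \<Rightarrow> 't topology \<Rightarrow> ('t \<Rightarrow> 'b) \<Rightarrow> ('t \<times> 'x, 't, 'o, 'f) family" where
  "pullback_fam X T c =
     \<lparr>total = subtopology (prod_topology T (total X)) {p. proj X (snd p) = c (fst p)}, base = T,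
      proj = fst, obj = obj X \<circ> c, chart = (\<lambda>t p. chart X (c t) (snd p))\<rparr>"

lemma pullback_simps [simp]:
  "total (pullback_fam X T c) = subtopology (prod_topology T (total X)) {p. proj X (snd p) = c (fst p)}"
  "base (pullback_fam X T c) = T" "proj (pullback_fam X T c) = fst"
  "obj (pullback_fam X T c) = obj X \<circ> c" "chart (pullback_fam X T c) = (\<lambda>t p. chart X (c t) (snd p))"
  by (auto simp: pullback_fam_def)

lemma fibre_pullback: "t \<in> topspace T \<Longrightarrow> fibre (pullback_fam X T c) t = Pair t ` fibre X (c t)"
  by (auto simp: fibre_def)

lemma F_family_pullback:
  assumes X: "F_family C X" and c: "continuous_map T (base X) c"
  shows "F_family C (pullback_fam X T c)"
  unfolding F_family_def
proof (intro conjI ballI)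
  show "continuous_map (total (pullback_fam X T c)) (base (pullback_fam X T c)) (proj (pullback_fam X T c))"
    by (simp add: continuous_map_from_subtopology continuous_map_fst)
next
  fix t assume "t \<in> topspace (base (pullback_fam X T c))"
  then have t: "t \<in> topspace T" by simp
  then have ct: "c t \<in> topspace (base X)" using c by (auto simp: continuous_map_def)
  then show "obj (pullback_fam X T c) t \<in> Obj C" using X by (simp add: F_family_def)
  let ?F = "subtopology (total X) (fibre X (c t))" and ?G = "subtopology (total (pullback_fam X T c)) (fibre (pullback_fam X T c) t)"
  have s: "continuous_map (total (pullback_fam X T c)) (total X) snd"
    by (simp add: continuous_map_from_subtopology continuous_map_snd)
  have "continuous_map ?G ?F snd"
    by (rule continuous_map_into_subtopology[OF continuous_map_from_subtopology[OF s]])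
      (use t in \<open>auto simp: fibre_pullback\<close>)
  moreover have "continuous_map ?F ?G (Pair t)"
  proof (rule continuous_map_into_subtopology)
    show "continuous_map ?F (total (pullback_fam X T c)) (Pair t)"
      unfolding pullback_simps
      by (intro continuous_map_into_subtopology continuous_map_pairedI)
        (use t in \<open>auto simp: fibre_def continuous_map_from_subtopology\<close>)
  qed (use t in \<open>auto simp: fibre_pullback\<close>)
  ultimately have "homeomorphic_maps ?G ?F snd (Pair t)"
    using t by (auto simp: homeomorphic_maps_def fibre_pullback)
  then have "homeomorphic_map ?G ?F snd" by (auto simp: homeomorphic_map_maps)
  from homeomorphic_map_compose[OF this chart_homeo(1)[OF X ct]]
  show "homeomorphic_map ?G (fib C (obj (pullback_fam X T c) t)) (chart (pullback_fam X T c) t)"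
    by (simp add: comp_def)
qed

lemma fibre_param_pullback:
  assumes "t \<in> topspace T" and "fibre_param X (c t) V p"
  shows "fibre_param (pullback_fam X T c) t V (\<lambda>v. (t, p v))"
  using assms unfolding fibre_param_def by (auto simp: fibre_pullback)

lemma F_bundle_pullback:
  assumes B: "F_bundle C X" and c: "continuous_map T (base X) c"
  shows "F_bundle C (pullback_fam X T c)"
  unfolding F_bundle_iff
proof (intro conjI ballI)
  note X = F_bundle_family[OF B]
  let ?P = "pullback_fam X T c"
  show P: "F_family C ?P" by (rule F_family_pullback[OF X c])
  fix t assume "t \<in> topspace (base ?P)"
  then have t: "t \<in> topspace T" by simp
  obtain W V \<Psi> \<Theta> where W: "openin T W" "t \<in> W" and tr: "trivialization X (subtopology T W) c V \<Psi> \<Theta>"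
    by (rule F_bundle_local[OF B c t])
  let ?T = "subtopology T W"
  have WT: "W \<subseteq> topspace T" by (rule openin_subset[OF W(1)])
  have "trivialization ?P ?T (\<lambda>t. t) V (\<lambda>t v. (t, \<Psi> t v)) (\<lambda>t p. \<Theta> t (snd p))"
    unfolding trivialization_def
  proof (intro conjI ballI)
    show "V \<in> Obj C" using tr by (simp add: trivialization_def)
    show "continuous_map ?T (base ?P) (\<lambda>t. t)" by (simp add: continuous_map_from_subtopology)
    have "continuous_map (prod_topology ?T (fib C V)) T fst"
      using continuous_map_fst[of ?T "fib C V"] by (simp add: continuous_map_in_subtopology)
    moreover have "continuous_map (prod_topology ?T (fib C V)) (total X) (\<lambda>p. \<Psi> (fst p) (snd p))"
      using tr by (simp add: trivialization_def)
    ultimately show "continuous_map (prod_topology ?T (fib C V)) (total ?P) (\<lambda>p. (fst p, \<Psi> (fst p) (snd p)))"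
      unfolding pullback_simps
      by (intro continuous_map_into_subtopology continuous_map_pairedI)
        (use trivialization_in_fibre[OF tr] in \<open>auto simp: fibre_def\<close>)
    let ?R = "subtopology (prod_topology ?T (total ?P)) {p. proj ?P (snd p) = fst p}"
    have s: "continuous_map ?R (total X) (\<lambda>p. snd (snd p))"
    proof -
      have "continuous_map (total ?P) (total X) snd" by (simp add: continuous_map_from_subtopology continuous_map_snd)
      then have "continuous_map (prod_topology ?T (total ?P)) (total X) (\<lambda>p. snd (snd p))"
        using continuous_map_compose[OF continuous_map_snd] by (fastforce simp only: comp_def)
      then show ?thesis by (rule continuous_map_from_subtopology)
    qed
    show "continuous_map ?R (fib C V) (\<lambda>p. \<Theta> (fst p) (snd (snd p)))"
      by (rule trivialization_continuous(2)[OF tr _ s]) (auto intro: continuous_map_from_subtopology continuous_map_fst)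
  next
    fix s assume "s \<in> topspace ?T"
    then have s: "s \<in> topspace T" "s \<in> topspace ?T" by auto
    show "fibre_param ?P s V (\<lambda>v. (s, \<Psi> s v))"
      by (rule fibre_param_pullback[OF s(1)]) (use tr s in \<open>simp add: trivialization_def\<close>)
    show "\<Theta> s (snd (s, \<Psi> s v)) = v" if "v \<in> topspace (fib C V)" for v
      using tr s(2) that by (simp add: trivialization_def)
  qed
  then show "locally_trivial_at ?P t"
    using W by (intro locally_trivial_atI[of ?P W t]) simp_all
qed

lemma F_map_pullback:
  assumes X: "F_family C X" and c: "continuous_map T (base X) c"
  shows "F_map C (pullback_fam X T c) X snd c"
proof (rule F_mapI[OF F_family_pullback[OF X c]])
  show "continuous_map (total (pullback_fam X T c)) (total X) snd"
    by (simp add: continuous_map_from_subtopology continuous_map_snd)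
  show "continuous_map (base (pullback_fam X T c)) (base X) c" using c by simp
  fix t assume "t \<in> topspace (base (pullback_fam X T c))"
  then have t: "t \<in> topspace T" "c t \<in> topspace (base X)" using c by (auto simp: continuous_map_def)
  show "\<exists>V p. fibre_param (pullback_fam X T c) t V p \<and> fibre_param X (c t) V (\<lambda>v. snd (p v))"
    using fibre_param_pullback[where c = c, OF t(1) fibre_param_chart_inverse[OF X t(2)]]
      fibre_param_chart_inverse[OF X t(2)]
    by (intro exI[of _ "obj X (c t)"] exI[of _ "\<lambda>v. (t, inv_into (fibre X (c t)) (chart X (c t)) v)"]) simp
qed

text \<open>The bundle over a piece is the pull-back of \<open>X\<close> along its characteristic
  map. The attaching map and the canonical map upstairs are both the projection to \<open>X\<close>,
  and the total space is literally a fibre product, so \<open>Pair\<close> is the required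
  lift.\<close>

lemma stratified_bundle_of_F_bundle:
  assumes S: "stratified_space S" and B: "F_bundle C X" and bX: "base X = whole S"
  shows "F_stratified_fibre_bundle C S X (\<lambda>i. pullback_fam X (piece S i) (char_map S i)) (\<lambda>i. snd) (\<lambda>i. snd)"
  unfolding F_stratified_fibre_bundle_def
proof (intro conjI allI impI)
  note X = F_bundle_family[OF B]
  have sf: "stratified_filtration S" using S by (simp add: stratified_space_def)
  then have co: "seq_colimit (base X) (stage S)" by (simp add: stratified_filtration_def bX)
  show "fam_colimit X (stage S)" by (rule fam_colimit_of_base[OF B co])
  have stB: "stage S n \<subseteq> topspace (base X)" for n using co by (auto simp: seq_colimit_def)
  fix i :: nat assume i: "i \<ge> 1"
  have cw: "CW_pair (piece S i) (piece_sub S i)"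
    and po: "top_pushout (subtopology (piece S i) (piece_sub S i)) (subtopology (base X) (stage S (i - 1)))
          (piece S i) (att S i) (\<lambda>x. x) (\<lambda>x. x) (char_map S i) (subtopology (base X) (stage S i))"
    using sf i by (auto simp: stratified_filtration_def bX)
  have c: "continuous_map (piece S i) (base X) (char_map S i)"
    using top_pushout_maps(2)[OF po] by (simp add: continuous_map_in_subtopology)
  show "F_bundle C (pullback_fam X (piece S i) (char_map S i))" by (rule F_bundle_pullback[OF B c])
  have sub: "stage S (i - 1) \<subseteq> stage S i"
    using co i unfolding seq_colimit_def by (metis Suc_pred' less_le_trans zero_less_one)
  show "F_pushout C (restrict_fam (pullback_fam X (piece S i) (char_map S i)) (piece_sub S i))
      (restrict_fam X (stage S (i - 1))) (pullback_fam X (piece S i) (char_map S i)) snd (att S i)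
      (\<lambda>x. x) (\<lambda>b. b) snd (char_map S i) (restrict_fam X (stage S i))"
  proof (rule F_pushout_of_base_pushout[OF B F_family_pullback[OF X c] F_map_pullback[OF X c], where L = Pair])
    show "cartesian_lift X (base (pullback_fam X (piece S i) (char_map S i)))
       (total (pullback_fam X (piece S i) (char_map S i))) (char_map S i) snd Pair"
      using c by (simp add: cartesian_lift_def)
    show "closedin (base (pullback_fam X (piece S i) (char_map S i))) (piece_sub S i)"
      using cw by (auto simp: CW_pair_def subcomplex_def)
  qed (use po sub stB in auto)
qed (use S B bX F_bundle_family[OF B] F_bundle_restrict[OF B] in auto)

end

section \<open>CW-complexes and complexes of families\<close>

text \<open>Shared by the skeleta of a CW-complex and by the base and total spaces of a complex of
  families. \<open>B n\<close> is the stage to which \<open>E n\<close> is attached, so the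
  numbering starts with the empty stage \<open>B 0\<close>.\<close>

locale pushout_tower =
  fixes T :: "'t topology" and B :: "nat \<Rightarrow> 't set" and A E :: "nat \<Rightarrow> 'e topology"
    and f k :: "nat \<Rightarrow> 'e \<Rightarrow> 't"
  assumes po: "\<And>n. top_pushout (A n) (subtopology T (B n)) (E n) (f n) (\<lambda>x. x) (\<lambda>x. x) (k n) (subtopology T (B (Suc n)))"
    and colim: "seq_colimit T B" and B0: "B 0 = {}"
begin

lemma B_sub: "B n \<subseteq> topspace T" and B_Suc: "B n \<subseteq> B (Suc n)" and B_cover: "(\<Union>n. B n) = topspace T"
  using colim by (auto simp: seq_colimit_def)

lemma B_mono: "m \<le> n \<Longrightarrow> B m \<subseteq> B n"
  using B_Suc by (rule lift_Suc_mono_le)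

lemma topspace_B: "topspace (subtopology T (B n)) = B n"
  using B_sub by auto

lemmas poD = top_pushout_inclusionD[OF po, unfolded topspace_B]

lemma k_continuous: "continuous_map (E n) T (k n)" and k_in: "e \<in> topspace (E n) \<Longrightarrow> k n e \<in> B (Suc n)"
  using top_pushout_maps(2)[OF po, of n] by (auto simp: continuous_map_in_subtopology)

text \<open>On \<open>A n\<close> the canonical map agrees with the attaching map
  \<open>f n\<close>, so later statements about boundaries can be phrased with
  \<open>k\<close>.\<close>

lemma k_on_A: "a \<in> topspace (A n) \<Longrightarrow> k n a \<in> B n" and k_A_continuous: "continuous_map (A n) (subtopology T (B n)) (k n)"
proof -
  have f: "continuous_map (A n) (subtopology T (B n)) (f n)" for n
    using po[of n] by (simp add: top_pushout_def)
  have eq: "f n a = k n a" if "a \<in> topspace (A n)" for n a using poD(4)[OF that] .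
  show "k n a \<in> B n" if "a \<in> topspace (A n)"
    using Pi_mem[OF continuous_map_funspace[OF f] that] eq[OF that] by simp
  show "continuous_map (A n) (subtopology T (B n)) (k n)"
    by (rule continuous_map_eq[OF f eq])
qed

lemma k_off_A: "e \<in> topspace (E n) \<Longrightarrow> e \<notin> topspace (A n) \<Longrightarrow> k n e \<notin> B n"
  using poD(3)[of n] by auto

lemma openin_stage:
  assumes "\<And>m. m < n \<Longrightarrow> openin (E m) {e \<in> topspace (E m). k m e \<in> W}"
  shows "openin (subtopology T (B n)) (W \<inter> B n)"
  using assms
proof (induction n)
  case 0
  then show ?case by (simp add: B0)
next
  case (Suc n)
  then have IH: "openin (subtopology T (B n)) (W \<inter> B n)" by simp
  have 1: "{x \<in> B n. x \<in> W \<inter> B (Suc n)} = W \<inter> B n"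
    using B_Suc by auto
  have 2: "{e \<in> topspace (E n). k n e \<in> W \<inter> B (Suc n)} = {e \<in> topspace (E n). k n e \<in> W}"
    using k_in by auto
  show ?case using poD(6)[of "W \<inter> B (Suc n)" n] IH Suc.prems[of n] 1 2 by auto
qed

lemma openin_total_space:
  assumes "W \<subseteq> topspace T" and "\<And>m. openin (E m) {e \<in> topspace (E m). k m e \<in> W}"
  shows "openin T W"
proof -
  have "openin (subtopology T (B n)) (W \<inter> B n)" for n
    by (rule openin_stage) (rule assms(2))
  then show ?thesis using colim assms(1) by (simp add: seq_colimit_def)
qed

text \<open>The attaching map is continuous into stage \<open>n\<close>, whose topology is coherent
  for everything attached earlier. This is the form in which \<open>base_bdry\<close> and
  \<open>total_bdry\<close> of a cell system are verified.\<close>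

lemma openin_attaching:
  assumes "\<And>m. m < n \<Longrightarrow> openin (E m) {e \<in> topspace (E m). k m e \<in> W}"
  shows "openin (A n) {a \<in> topspace (A n). k n a \<in> W}"
proof -
  have "openin (A n) {a \<in> topspace (A n). k n a \<in> W \<inter> B n}"
    by (rule openin_continuous_map_preimage[OF k_A_continuous openin_stage[OF assms]])
  moreover have "{a \<in> topspace (A n). k n a \<in> W \<inter> B n} = {a \<in> topspace (A n). k n a \<in> W}"
    using k_on_A by auto
  ultimately show ?thesis by simp
qed

lemma stage_cover: "t \<in> B n \<Longrightarrow> \<exists>m<n. \<exists>e\<in>topspace (E m) - topspace (A m). t = k m e"
proof (induction n)
  case 0
  then show ?case by (simp add: B0)
next
  case (Suc n)
  show ?case
  proof (cases "t \<in> B n")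
    case True
    then show ?thesis using Suc.IH less_SucI by blast
  next
    case False
    then obtain e where "e \<in> topspace (E n)" "t = k n e" using poD(5)[of n] Suc.prems by auto
    then show ?thesis using k_on_A False by (intro exI[of _ n]) auto
  qed
qed

text \<open>The image of \<open>E m\<close> lies in all later stages, whereas the part of
  \<open>E n\<close> off \<open>A n\<close> avoids stage \<open>n\<close>; so different levels
  cannot meet. Within one level the push-out is injective off \<open>A n\<close>.\<close>

lemma cell_unique:
  assumes e: "e \<in> topspace (E m)" "e \<notin> topspace (A m)" and e': "e' \<in> topspace (E n)" "e' \<notin> topspace (A n)"
    and eq: "k m e = k n e'"
  shows "m = n \<and> e = e'"
proof -
  have "\<not> m < n"
  proof
    assume "m < n"
    then have "k m e \<in> B n" using k_in[OF e(1)] B_mono[of "Suc m" n] by auto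
    then show False using k_off_A[OF e'] eq by simp
  qed
  moreover have "\<not> n < m"
  proof
    assume "n < m"
    then have "k n e' \<in> B m" using k_in[OF e'(1)] B_mono[of "Suc n" m] by auto
    then show False using k_off_A[OF e] eq by simp
  qed
  ultimately have "m = n" by simp
  moreover from this have "e = e'" using inj_onD[OF poD(2), of n e e'] e e' eq by simp
  ultimately show ?thesis by simp
qed

end

section \<open>Products with discrete spaces and disjoint unions\<close>

lemma openin_prod_discrete:
  "openin (prod_topology (discrete_topology Z) D) W \<longleftrightarrow>
    W \<subseteq> Z \<times> topspace D \<and> (\<forall>z\<in>Z. openin D {y. (z, y) \<in> W})"
proof safe
  fix z y assume "openin (prod_topology (discrete_topology Z) D) W" and zy: "(z, y) \<in> W"
  from openin_subset[OF this(1)] zy have "(z, y) \<in> Z \<times> topspace D" by auto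
  then show "z \<in> Z" "y \<in> topspace D" by simp_all
next
  fix z assume W: "openin (prod_topology (discrete_topology Z) D) W" and z: "z \<in> Z"
  have "continuous_map D (prod_topology (discrete_topology Z) D) (Pair z)"
    using z by (intro continuous_map_pairedI) auto
  from openin_continuous_map_preimage[OF this W]
  have "openin D {y \<in> topspace D. (z, y) \<in> W}" .
  moreover have "{y \<in> topspace D. (z, y) \<in> W} = {y. (z, y) \<in> W}" using openin_subset[OF W] by auto
  ultimately show "openin D {y. (z, y) \<in> W}" by simp
next
  assume sub: "W \<subseteq> Z \<times> topspace D" and o: "\<forall>z\<in>Z. openin D {y. (z, y) \<in> W}"
  show "openin (prod_topology (discrete_topology Z) D) W"
  proof (subst openin_subopen, safe)
    fix z y assume zy: "(z, y) \<in> W"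
    then have z: "z \<in> Z" using sub by auto
    show "\<exists>T. openin (prod_topology (discrete_topology Z) D) T \<and> (z, y) \<in> T \<and> T \<subseteq> W"
      by (intro exI[of _ "{z} \<times> {y. (z, y) \<in> W}"]) (use o z zy in \<open>auto simp: openin_prod_Times_iff\<close>)
  qed
qed

lemma openin_sum_component:
  assumes "z \<in> Z" and "openin (F z) G"
  shows "openin (sum_topology F Z) ({z} \<times> G)"
proof -
  have "{z} \<times> G = Sigma Z (\<lambda>i. if i = z then G else {})"
    using assms(1) by (auto split: if_splits)
  then show ?thesis using assms(2) by (simp add: openin_disjoint_union)
qed

lemma continuous_map_sum_index: "continuous_map (sum_topology F Z) (discrete_topology Z) fst"
proof -
  have "openin (F i) {x \<in> topspace (F i). i \<in> U}" for i U
    by (cases "i \<in> U") simp_all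
  then show ?thesis by (auto simp: continuous_map_def openin_sum_topology)
qed

text \<open>Besides splitting by the index \<open>z\<close>, this exchanges the factors: families of
  cells put the disk last, trivializations put it first.\<close>

lemma openin_prod_sum:
  "openin (prod_topology (sum_topology F Z) D) W \<longleftrightarrow>
    W \<subseteq> Sigma Z (\<lambda>z. topspace (F z)) \<times> topspace D \<and>
    (\<forall>z\<in>Z. openin (prod_topology D (F z)) {p. ((z, snd p), fst p) \<in> W})"
proof safe
  fix z v y assume "openin (prod_topology (sum_topology F Z) D) W" and p: "((z, v), y) \<in> W"
  from openin_subset[OF this(1)] p have "((z, v), y) \<in> Sigma Z (\<lambda>z. topspace (F z)) \<times> topspace D"
    by auto
  then show "z \<in> Z" "v \<in> topspace (F z)" "y \<in> topspace D" by auto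
next
  fix z assume W: "openin (prod_topology (sum_topology F Z) D) W" and z: "z \<in> Z"
  have "continuous_map (F z) (sum_topology F Z) (Pair z)"
    using z by (rule continuous_map_component_injection)
  then have "continuous_map (prod_topology D (F z)) (prod_topology (sum_topology F Z) D) (\<lambda>p. ((z, snd p), fst p))"
    using continuous_map_compose[OF continuous_map_snd] by (fastforce intro!: continuous_map_pairedI continuous_map_fst simp: comp_def)
  from openin_continuous_map_preimage[OF this W]
  have "openin (prod_topology D (F z)) {p \<in> topspace (prod_topology D (F z)). ((z, snd p), fst p) \<in> W}" .
  moreover have "{p \<in> topspace (prod_topology D (F z)). ((z, snd p), fst p) \<in> W} = {p. ((z, snd p), fst p) \<in> W}"
    using openin_subset[OF W] by auto
  ultimately show "openin (prod_topology D (F z)) {p. ((z, snd p), fst p) \<in> W}" by simp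
next
  assume sub: "W \<subseteq> Sigma Z (\<lambda>z. topspace (F z)) \<times> topspace D"
    and o: "\<forall>z\<in>Z. openin (prod_topology D (F z)) {p. ((z, snd p), fst p) \<in> W}"
  show "openin (prod_topology (sum_topology F Z) D) W"
  proof (subst openin_subopen, safe)
    fix z v y assume p: "((z, v), y) \<in> W"
    then have z: "z \<in> Z" using sub by auto
    have "(y, v) \<in> {p. ((z, snd p), fst p) \<in> W}" using p by simp
    then obtain U G where U: "openin D U" "openin (F z) G" "y \<in> U" "v \<in> G" "U \<times> G \<subseteq> {p. ((z, snd p), fst p) \<in> W}"
      by (rule openin_prod_box[OF bspec[OF o z]])
    have "openin (sum_topology F Z) ({z} \<times> G)"
      using z U(2) by (rule openin_sum_component)
    then show "\<exists>T. openin (prod_topology (sum_topology F Z) D) T \<and> ((z, v), y) \<in> T \<and> T \<subseteq> W"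
      by (intro exI[of _ "({z} \<times> G) \<times> U"]) (use U in \<open>auto simp: openin_prod_Times_iff\<close>)
  qed
qed

lemma zero_in_open_disk: "(\<lambda>i. 0) \<in> open_disk n"
  by (auto simp: open_disk_def topspace_disk topspace_bdry_sphere dnorm_def)

lemma CW_tower:
  assumes "CW_complex T Z \<Phi>"
  shows "\<exists>f. pushout_tower T (skel Z \<Phi>) (\<lambda>n. prod_topology (discrete_topology (Z n)) (bdry_sphere n))
    (\<lambda>n. prod_topology (discrete_topology (Z n)) (disk n)) f \<Phi>"
proof -
  have "\<forall>n. \<exists>f. top_pushout (prod_topology (discrete_topology (Z n)) (bdry_sphere n))
        (subtopology T (skel Z \<Phi> n)) (prod_topology (discrete_topology (Z n)) (disk n))
        f (\<lambda>x. x) (\<lambda>x. x) (\<Phi> n) (subtopology T (skel Z \<Phi> (Suc n)))"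
    using assms by (simp add: CW_complex_def)
  then obtain f where "\<forall>n. top_pushout (prod_topology (discrete_topology (Z n)) (bdry_sphere n))
        (subtopology T (skel Z \<Phi> n)) (prod_topology (discrete_topology (Z n)) (disk n))
        (f n) (\<lambda>x. x) (\<lambda>x. x) (\<Phi> n) (subtopology T (skel Z \<Phi> (Suc n)))"
    by (rule choice[THEN exE])
  then have "pushout_tower T (skel Z \<Phi>) (\<lambda>n. prod_topology (discrete_topology (Z n)) (bdry_sphere n))
    (\<lambda>n. prod_topology (discrete_topology (Z n)) (disk n)) f \<Phi>"
    using assms by unfold_locales (auto simp: CW_complex_def skel_def)
  then show ?thesis by blast
qed

section \<open>A bundle over a CW-complex as a complex of families\<close>

context groupoid_structure
begin

abbreviation cells :: "'z set \<Rightarrow> ('z \<Rightarrow> 'o) \<Rightarrow> (nat \<Rightarrow> real) topology \<Rightarrow>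
    (('z \<times> 'f) \<times> (nat \<Rightarrow> real), 'z \<times> (nat \<Rightarrow> real), 'o, 'f) family" where
  "cells Z V D \<equiv> times_fam (F_set C Z V) D"

lemma cells_simps:
  "total (cells Z V D) = prod_topology (sum_topology (\<lambda>z. fib C (V z)) Z) D"
  "base (cells Z V D) = prod_topology (discrete_topology Z) D"
  "proj (cells Z V D) = map_prod fst id" "obj (cells Z V D) = V \<circ> fst"
  "chart (cells Z V D) = (\<lambda>b x. snd (fst x))"
  by (auto simp: times_fam_def F_set_def fun_eq_iff)

lemma fibre_param_cells:
  assumes "V z \<in> Obj C" "z \<in> Z" "y \<in> topspace D"
  shows "fibre_param (cells Z V D) (z, y) (V z) (\<lambda>v. ((z, v), y))"
  unfolding fibre_param_def
  using assms arr_map_id[of "V z"]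
  by (intro exI[of _ "\<lambda>v. v"]) (auto simp: cells_simps fibre_def)

lemma F_family_cells:
  assumes V: "V ` Z \<subseteq> Obj C"
  shows "F_family C (cells Z V D)"
  unfolding F_family_def
proof (intro conjI ballI)
  show "continuous_map (total (cells Z V D)) (base (cells Z V D)) (proj (cells Z V D))"
    unfolding cells_simps map_prod_def id_def case_prod_unfold
    by (intro continuous_map_pairedI continuous_map_snd
        continuous_map_compose[OF continuous_map_fst continuous_map_sum_index, unfolded comp_def])
next
  fix b assume "b \<in> topspace (base (cells Z V D))"
  then obtain z y where b: "b = (z, y)" "z \<in> Z" "y \<in> topspace D" by (auto simp: cells_simps)
  then show "obj (cells Z V D) b \<in> Obj C" using V by (auto simp: cells_simps)
  let ?F = "subtopology (total (cells Z V D)) (fibre (cells Z V D) b)"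
  have fb: "fibre (cells Z V D) b = ({z} \<times> topspace (fib C (V z))) \<times> {y}"
    using b by (auto simp: fibre_def cells_simps)
  have 1: "continuous_map (fib C (V z)) ?F (\<lambda>v. ((z, v), y))"
  proof (rule continuous_map_into_subtopology)
    show "continuous_map (fib C (V z)) (total (cells Z V D)) (\<lambda>v. ((z, v), y))"
      unfolding cells_simps
      using continuous_map_component_injection[OF b(2), of "\<lambda>z. fib C (V z)"] b(3)
      by (intro continuous_map_pairedI) auto
  qed (simp add: fb)
  have 2: "continuous_map ?F (fib C (V z)) (\<lambda>x. snd (fst x))"
    unfolding continuous_map_def
  proof (intro conjI funcsetI allI impI)
    fix G assume G: "openin (fib C (V z)) G"
    have "openin (sum_topology (\<lambda>z. fib C (V z)) Z) ({z} \<times> G)"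
      using b(2) G by (rule openin_sum_component)
    then have "openin (total (cells Z V D)) (({z} \<times> G) \<times> topspace D)"
      by (simp add: cells_simps openin_prod_Times_iff)
    then have "openin ?F ((({z} \<times> G) \<times> topspace D) \<inter> fibre (cells Z V D) b)"
      by (rule openin_subtopology_Int)
    moreover have "(({z} \<times> G) \<times> topspace D) \<inter> fibre (cells Z V D) b = {x \<in> topspace ?F. snd (fst x) \<in> G}"
      using b openin_subset[OF G] by (auto simp: fb[unfolded b(1)] cells_simps)
    ultimately show "openin ?F {x \<in> topspace ?F. snd (fst x) \<in> G}" by simp
  qed (auto simp: fb)
  have "homeomorphic_maps ?F (fib C (V z)) (\<lambda>x. snd (fst x)) (\<lambda>v. ((z, v), y))"
    unfolding homeomorphic_maps_def using 1 2 by (auto simp: fb)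
  then show "homeomorphic_map ?F (fib C (obj (cells Z V D) b)) (chart (cells Z V D) b)"
    by (auto simp: cells_simps b(1) homeomorphic_map_maps)
qed

text \<open>The cells are indexed by their centres \<open>\<Phi> n (z, 0)\<close>.\<close>

lemma F_complex_of_F_bundle:
  assumes CW: "CW_complex (base X) Z \<Phi>" and B: "F_bundle C X"
  shows "F_complex C X"
proof -
  note X = F_bundle_family[OF B]
  obtain f where "pushout_tower (base X) (skel Z \<Phi>) (\<lambda>n. prod_topology (discrete_topology (Z n)) (bdry_sphere n))
    (\<lambda>n. prod_topology (discrete_topology (Z n)) (disk n)) f \<Phi>"
    using CW_tower[OF CW] by blast
  then interpret t: pushout_tower "base X" "skel Z \<Phi>" "\<lambda>n. prod_topology (discrete_topology (Z n)) (bdry_sphere n)"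
    "\<lambda>n. prod_topology (discrete_topology (Z n)) (disk n)" f \<Phi> .
  have \<Phi>c: "continuous_map (disk n) (base X) (\<lambda>y. \<Phi> n (z, y))" if "z \<in> Z n" for n z
  proof -
    have "continuous_map (disk n) (prod_topology (discrete_topology (Z n)) (disk n)) (Pair z)"
      using that by (intro continuous_map_pairedI) auto
    from continuous_map_compose[OF this t.k_continuous] show ?thesis by (simp add: comp_def)
  qed
  have att: "attach_cells C n (restrict_fam X (skel Z \<Phi> n)) (restrict_fam X (skel Z \<Phi> (Suc n)))" for n
  proof -
    let ?ctr = "\<lambda>z. \<Phi> n (z, \<lambda>i. 0)"
    \<comment> \<open>\<open>attach_cells\<close> wants the cells indexed by points of the base;
      \<open>\<iota>\<close> translates a centre back to the original index.\<close>
    define Z' where "Z' = ?ctr ` Z n"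
    define \<iota> where "\<iota> = inv_into (Z n) ?ctr"
    have z0: "(\<lambda>i. 0) \<in> topspace (disk n)" "(\<lambda>i. 0) \<notin> topspace (bdry_sphere n)"
      using zero_in_open_disk[of n] by (auto simp: open_disk_def)
    have inj: "inj_on ?ctr (Z n)"
      by (rule inj_onI) (use t.cell_unique[of _ n _ n] z0 in auto)
    have \<iota>: "\<iota> z \<in> Z n" if "z \<in> Z'" for z
      using that by (simp add: \<iota>_def Z'_def inv_into_into)
    have \<iota>_inj: "z = z'" if "z \<in> Z'" "z' \<in> Z'" "\<iota> z = \<iota> z'" for z z'
      using that by (metis \<iota>_def Z'_def f_inv_into_f)
    have \<iota>_surj: "\<exists>z'\<in>Z'. \<iota> z' = z" if "z \<in> Z n" for z
      using that inv_into_f_f[OF inj that] by (intro bexI[of _ "?ctr z"]) (simp_all add: \<iota>_def Z'_def)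
    have "\<forall>z. \<exists>V \<Psi> \<Theta>. z \<in> Z' \<longrightarrow> trivialization X (disk n) (\<lambda>y. \<Phi> n (\<iota> z, y)) V \<Psi> \<Theta>"
      using trivialization_disk[OF B \<Phi>c[OF \<iota>]] by blast
    then obtain V where "\<forall>z. \<exists>\<Psi> \<Theta>. z \<in> Z' \<longrightarrow> trivialization X (disk n) (\<lambda>y. \<Phi> n (\<iota> z, y)) (V z) \<Psi> \<Theta>"
      by (rule choice[THEN exE])
    then obtain \<Psi> where "\<forall>z. \<exists>\<Theta>. z \<in> Z' \<longrightarrow> trivialization X (disk n) (\<lambda>y. \<Phi> n (\<iota> z, y)) (V z) (\<Psi> z) \<Theta>"
      by (rule choice[THEN exE])
    then obtain \<Theta> where "\<forall>z. z \<in> Z' \<longrightarrow> trivialization X (disk n) (\<lambda>y. \<Phi> n (\<iota> z, y)) (V z) (\<Psi> z) (\<Theta> z)"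
      by (rule choice[THEN exE])
    then have tr: "trivialization X (disk n) (\<lambda>y. \<Phi> n (\<iota> z, y)) (V z) (\<Psi> z) (\<Theta> z)" if "z \<in> Z'" for z
      using that by blast
    have V: "V z \<in> Obj C" if "z \<in> Z'" for z using tr[OF that] by (simp add: trivialization_def)
    let ?M = "cells Z' V (disk n)"
    let ?k = "\<lambda>p. \<Psi> (fst (fst p)) (snd p) (snd (fst p))" and ?kb = "\<lambda>b. \<Phi> n (\<iota> (fst b), snd b)"
    \<comment> \<open>\<open>?L\<close> is the inverse trivialization of the cell containing the
      given base parameter, placed in the summand of that cell.\<close>
    let ?L = "\<lambda>b x. ((fst b, \<Theta> (fst b) (snd b) x), snd b)"
    let ?A = "topspace (base (cells Z' V (bdry_sphere n)))"
    have cl: "closed_inclusion (cells Z' V (bdry_sphere n)) ?M" by (rule cells_closed_inclusion)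
    have M: "F_family C ?M" by (rule F_family_cells) (use V in auto)
    have kc: "continuous_map (total ?M) (total X) ?k"
      unfolding continuous_map_def
    proof (intro conjI funcsetI allI impI)
      fix p assume p: "p \<in> topspace (total ?M)"
      then show "?k p \<in> topspace (total X)"
        using trivialization_in_fibre[OF tr, of "fst (fst p)" "snd p" "snd (fst p)"] by (auto simp: cells_simps fibre_def)
    next
      fix W assume W: "openin (total X) W"
      have "openin (prod_topology (disk n) (fib C (V z))) {p. ((z, snd p), fst p) \<in> {p \<in> topspace (total ?M). ?k p \<in> W}}"
        if z: "z \<in> Z'" for z
      proof -
        have "continuous_map (prod_topology (disk n) (fib C (V z))) (total X) (\<lambda>p. \<Psi> z (fst p) (snd p))"
          using tr[OF z] by (simp add: trivialization_def)
        from openin_continuous_map_preimage[OF this W]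
        have "openin (prod_topology (disk n) (fib C (V z))) {p \<in> topspace (prod_topology (disk n) (fib C (V z))). \<Psi> z (fst p) (snd p) \<in> W}" .
        moreover have "{p \<in> topspace (prod_topology (disk n) (fib C (V z))). \<Psi> z (fst p) (snd p) \<in> W}
          = {p. ((z, snd p), fst p) \<in> {p \<in> topspace (total ?M). ?k p \<in> W}}"
          using z by (auto simp: cells_simps)
        ultimately show ?thesis by simp
      qed
      then show "openin (total ?M) {p \<in> topspace (total ?M). ?k p \<in> W}"
        unfolding cells_simps(1) openin_prod_sum by auto
    qed
    have kbc: "continuous_map (base ?M) (base X) ?kb"
      unfolding cells_simps
    proof -
      have "continuous_map (discrete_topology Z') (discrete_topology (Z n)) \<iota>" using \<iota> by auto
      then have "continuous_map (prod_topology (discrete_topology Z') (disk n)) (prod_topology (discrete_topology (Z n)) (disk n)) (\<lambda>b. (\<iota> (fst b), snd b))"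
        by (intro continuous_map_pairedI continuous_map_snd continuous_map_compose[OF continuous_map_fst, unfolded comp_def])
      from continuous_map_compose[OF this t.k_continuous]
      show "continuous_map (prod_topology (discrete_topology Z') (disk n)) (base X) ?kb" by (simp add: comp_def)
    qed
    have k: "F_map C ?M X ?k ?kb"
    proof (rule F_mapI[OF M kc kbc])
      fix b assume "b \<in> topspace (base ?M)"
      then obtain z y where b: "b = (z, y)" "z \<in> Z'" "y \<in> topspace (disk n)" by (auto simp: cells_simps)
      have "fibre_param X (\<Phi> n (\<iota> z, y)) (V z) (\<Psi> z y)" using tr[OF b(2)] b(3) by (simp add: trivialization_def)
      then show "\<exists>V' p. fibre_param ?M b V' p \<and> fibre_param X (?kb b) V' (\<lambda>v. ?k (p v))"
        using fibre_param_cells[where V = V, OF V[OF b(2)] b(2,3)] unfolding b(1)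
        by (intro exI[of _ "V z"] exI[of _ "\<lambda>v. ((z, v), y)"]) simp
    qed
    have lift: "cartesian_lift X (base ?M) (total ?M) ?kb ?k ?L"
      unfolding cartesian_lift_def
    proof (intro conjI ballI kbc)
      let ?R = "subtopology (prod_topology (base ?M) (total X)) {p. proj X (snd p) = ?kb (fst p)}"
      let ?T = "\<lambda>z. {p \<in> topspace ?R. fst (fst p) = z}"
      have ff: "continuous_map ?R (discrete_topology Z') (\<lambda>p. fst (fst p))"
        and sf: "continuous_map ?R (disk n) (\<lambda>p. snd (fst p))" and s: "continuous_map ?R (total X) snd"
      proof -
        have "continuous_map (prod_topology (base ?M) (total X)) (discrete_topology Z') (\<lambda>p. fst (fst p))"
          unfolding cells_simps by (rule continuous_map_compose[OF continuous_map_fst continuous_map_fst, unfolded comp_def])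
        moreover have "continuous_map (prod_topology (base ?M) (total X)) (disk n) (\<lambda>p. snd (fst p))"
          unfolding cells_simps by (rule continuous_map_compose[OF continuous_map_fst continuous_map_snd, unfolded comp_def])
        ultimately show "continuous_map ?R (discrete_topology Z') (\<lambda>p. fst (fst p))"
          "continuous_map ?R (disk n) (\<lambda>p. snd (fst p))" "continuous_map ?R (total X) snd"
          by (auto intro: continuous_map_from_subtopology continuous_map_snd)
      qed
      show "continuous_map ?R (total ?M) (\<lambda>p. ?L (fst p) (snd p))"
      \<comment> \<open>The index of the cell is locally constant on the fibre product, so the lift
        is pasted from the open parts with fixed index \<open>z\<close>.\<close>
      proof (rule pasting_lemma[where I = Z' and T = ?T and f = "\<lambda>z p. ((z, \<Theta> z (snd (fst p)) (snd p)), snd (fst p))"])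
        fix z assume z: "z \<in> Z'"
        show "openin ?R (?T z)"
          using openin_continuous_map_preimage[OF ff, of "{z}"] z by simp
        have "continuous_map (subtopology ?R (?T z)) (fib C (V z)) (\<lambda>p. \<Theta> z (snd (fst p)) (snd p))"
          by (intro trivialization_continuous(2)[OF tr[OF z]] continuous_map_from_subtopology[OF sf]
              continuous_map_from_subtopology[OF s]) auto
        from continuous_map_compose[OF this continuous_map_component_injection[OF z, of "\<lambda>z. fib C (V z)"]]
        show "continuous_map (subtopology ?R (?T z)) (total ?M) (\<lambda>p. ((z, \<Theta> z (snd (fst p)) (snd p)), snd (fst p)))"
          unfolding cells_simps(1) comp_def
          by (intro continuous_map_pairedI) (auto intro: continuous_map_from_subtopology[OF sf])
      next
        fix p assume "p \<in> topspace ?R"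
        then show "\<exists>z. z \<in> Z' \<and> p \<in> ?T z \<and> ?L (fst p) (snd p) = ((z, \<Theta> z (snd (fst p)) (snd p)), snd (fst p))"
          by (auto simp: cells_simps)
      qed auto
    next
      fix b x assume "b \<in> topspace (base ?M)" "x \<in> fibre X (?kb b)"
      then show "?k (?L b x) = x"
        using trivialization_inverse(2)[OF X tr, of "fst b" "snd b" x] by (auto simp: cells_simps)
    qed
    have po: "top_pushout (subtopology (base ?M) ?A) (subtopology (base X) (skel Z \<Phi> n)) (base ?M) ?kb (\<lambda>x. x) (\<lambda>x. x) ?kb
      (subtopology (base X) (skel Z \<Phi> (Suc n)))"
    proof (rule top_pushout_inclusionI)
      have tA: "topspace (subtopology (base ?M) ?A) = Z' \<times> topspace (bdry_sphere n)"
        using bdry_sphere_subset_disk by (auto simp: cells_simps)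
      have tM: "topspace (base ?M) = Z' \<times> topspace (disk n)" by (simp add: cells_simps)
      show "continuous_map (subtopology (base ?M) ?A) (subtopology (base X) (skel Z \<Phi> n)) ?kb"
        by (rule continuous_map_into_subtopology[OF continuous_map_from_subtopology[OF kbc]])
          (use t.k_on_A \<iota> in \<open>auto simp: cells_simps\<close>)
      show "continuous_map (subtopology (base ?M) ?A) (base ?M) (\<lambda>x. x)" by (simp add: continuous_map_from_subtopology)
      have img: "?kb ` (Z' \<times> S) = \<Phi> n ` (Z n \<times> S)" for S
        using \<iota> \<iota>_surj by force
      show "(\<lambda>x. x) ` topspace (subtopology (base X) (skel Z \<Phi> n)) \<union> ?kb ` topspace (base ?M)
        = topspace (subtopology (base X) (skel Z \<Phi> (Suc n)))"
        unfolding t.topspace_B tM img using t.poD(5)[of n] by simp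
      show "inj_on (\<lambda>x. x) (topspace (subtopology (base X) (skel Z \<Phi> n)))" by simp
      show "inj_on ?kb (topspace (base ?M) - topspace (subtopology (base ?M) ?A))"
      proof (rule inj_onI)
        fix b b' assume "b \<in> topspace (base ?M) - topspace (subtopology (base ?M) ?A)"
          "b' \<in> topspace (base ?M) - topspace (subtopology (base ?M) ?A)" and eq: "?kb b = ?kb b'"
        then have "fst b \<in> Z'" "fst b' \<in> Z'" "snd b \<in> topspace (disk n)" "snd b' \<in> topspace (disk n)"
          "snd b \<notin> topspace (bdry_sphere n)" "snd b' \<notin> topspace (bdry_sphere n)"
          unfolding tA tM by auto
        then have "(\<iota> (fst b), snd b) = (\<iota> (fst b'), snd b')" "fst b \<in> Z'" "fst b' \<in> Z'"
          using t.cell_unique[OF _ _ _ _ eq] \<iota> by auto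
        then show "b = b'" using \<iota>_inj by (auto intro: prod_eqI)
      qed
      show "(\<lambda>x. x) ` topspace (subtopology (base X) (skel Z \<Phi> n)) \<inter> ?kb ` (topspace (base ?M) - topspace (subtopology (base ?M) ?A)) = {}"
      proof -
        have "y \<in> topspace (bdry_sphere n)"
          if "z \<in> Z'" "y \<in> topspace (disk n)" "\<Phi> n (\<iota> z, y) \<in> skel Z \<Phi> n" for z y
          using t.k_off_A[of "(\<iota> z, y)" n] \<iota>[OF that(1)] that by auto
        then show ?thesis unfolding t.topspace_B tM tA by auto
      qed
      fix U assume U: "U \<subseteq> topspace (subtopology (base X) (skel Z \<Phi> (Suc n)))"
      \<comment> \<open>The map \<open>\<iota>\<close> takes \<open>Z'\<close> onto
        \<open>Z n\<close>, and openness is tested disk by disk, so re-indexing preserves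
        it.\<close>
      have "openin (base ?M) {y \<in> topspace (base ?M). ?kb y \<in> U} \<longleftrightarrow>
        openin (prod_topology (discrete_topology (Z n)) (disk n)) {e \<in> topspace (prod_topology (discrete_topology (Z n)) (disk n)). \<Phi> n e \<in> U}"
        (is "?l \<longleftrightarrow> ?r")
      proof -
        have "?l \<longleftrightarrow> (\<forall>z\<in>Z'. openin (disk n) {y \<in> topspace (disk n). \<Phi> n (\<iota> z, y) \<in> U})"
          unfolding cells_simps(2) openin_prod_discrete by (auto simp: Collect_conj_eq)
        also have "\<dots> \<longleftrightarrow> (\<forall>z\<in>Z n. openin (disk n) {y \<in> topspace (disk n). \<Phi> n (z, y) \<in> U})"
        proof -
          have "Z n = \<iota> ` Z'" using \<iota> \<iota>_surj by blast
          then show ?thesis by simp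
        qed
        also have "\<dots> \<longleftrightarrow> ?r"
          unfolding openin_prod_discrete by (auto simp: Collect_conj_eq)
        finally show ?thesis .
      qed
      then show "openin (subtopology (base X) (skel Z \<Phi> (Suc n))) U \<longleftrightarrow>
        openin (subtopology (base X) (skel Z \<Phi> n)) {x \<in> topspace (subtopology (base X) (skel Z \<Phi> n)). x \<in> U} \<and>
        openin (base ?M) {y \<in> topspace (base ?M). ?kb y \<in> U}"
        using t.poD(6)[of U n] U unfolding t.topspace_B by simp
    qed simp
    have "F_pushout C (restrict_fam ?M ?A) (restrict_fam X (skel Z \<Phi> n)) ?M ?k ?kb (\<lambda>x. x) (\<lambda>b. b) ?k ?kb
      (restrict_fam X (skel Z \<Phi> (Suc n)))"
    proof (rule F_pushout_of_base_pushout[OF B M k lift _ _ t.B_Suc t.B_sub po])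
      show "closedin (base ?M) ?A" using cl by (simp add: closed_inclusion_def)
      fix m assume "m \<in> topspace (total ?M)"
      then show "?L (proj ?M m) (?k m) = m"
        using tr[of "fst (fst m)"] by (auto simp: cells_simps trivialization_def)
    qed
    moreover have "restrict_fam ?M ?A = cells Z' V (bdry_sphere n)"
      using cl by (simp add: closed_inclusion_def)
    ultimately show ?thesis
      unfolding attach_cells_def using V
      by (intro exI[of _ Z'] exI[of _ V] exI[of _ ?k] exI[of _ ?kb] conjI) auto
  qed
  have "fam_colimit X (skel Z \<Phi>)" by (rule fam_colimit_of_base[OF B t.colim])
  moreover have "skel Z \<Phi> 0 = {}" by (simp add: skel_def)
  ultimately show ?thesis
    unfolding F_complex_def relative_F_complex_def using X att by (intro conjI exI[of _ "skel Z \<Phi>"]) auto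
qed

end

lemma openin_prod_discrete_preimage:
  "openin (prod_topology (discrete_topology Z) D) {e \<in> topspace (prod_topology (discrete_topology Z) D). h e \<in> W} \<longleftrightarrow>
    (\<forall>z\<in>Z. openin D {y \<in> topspace D. h (z, y) \<in> W})"
  unfolding openin_prod_discrete by (auto simp: Collect_conj_eq)

lemma openin_prod_sum_preimage:
  "openin (prod_topology (sum_topology F Z) D) {e \<in> topspace (prod_topology (sum_topology F Z) D). h e \<in> W} \<longleftrightarrow>
    (\<forall>z\<in>Z. openin (prod_topology D (F z)) {p \<in> topspace D \<times> topspace (F z). h ((z, snd p), fst p) \<in> W})"
proof -
  have "{p. ((z, snd p), fst p) \<in> {e \<in> topspace (prod_topology (sum_topology F Z) D). h e \<in> W}}
    = {p \<in> topspace D \<times> topspace (F z). h ((z, snd p), fst p) \<in> W}" if "z \<in> Z" for z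
    using that by auto
  moreover have "{e \<in> topspace (prod_topology (sum_topology F Z) D). h e \<in> W} \<subseteq> Sigma Z (\<lambda>z. topspace (F z)) \<times> topspace D"
    by auto
  ultimately show ?thesis unfolding openin_prod_sum by simp
qed

section \<open>Complexes of families are bundles\<close>

context groupoid_structure
begin

text \<open>The families attached are products over each cell by construction, and base and total
  spaces both form towers of push-outs. The two towers supply the coherence conditions of a cell
  system whose cells are ordered by dimension alone.\<close>

lemma F_bundle_of_F_complex:
  fixes X :: "('x, 'b, 'o, 'f) family"
  assumes "F_complex C X"
  shows "F_bundle C X"
proof -
  have X: "F_family C X" using assms by (simp add: F_complex_def relative_F_complex_def)
  obtain B where D: "restrict_fam X {} = restrict_fam X (B 0)"
    and att: "\<And>n. attach_cells C n (restrict_fam X (B n)) (restrict_fam X (B (Suc n)))"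
    and co: "fam_colimit X B"
    using assms unfolding F_complex_def relative_F_complex_def by blast
  have cob: "seq_colimit (base X) B" and cot: "seq_colimit (total X) (\<lambda>n. {x \<in> topspace (total X). proj X x \<in> B n})"
    using co by (auto simp: fam_colimit_def)
  \<comment> \<open>The restricted base only shows that \<open>B 0\<close> misses the base space;
    that it lies inside the base space comes from \<open>seq_colimit\<close>.\<close>
  have B0: "B 0 = {}"
  proof -
    have "topspace (base (restrict_fam X {})) = topspace (base (restrict_fam X (B 0)))" by (simp only: D)
    then have "topspace (base X) \<inter> B 0 = {}" by simp
    moreover have "B 0 \<subseteq> topspace (base X)" using cob by (auto simp: seq_colimit_def)
    ultimately show ?thesis by blast
  qed
  define P where "P n Z V f fb k kb \<longleftrightarrow> V ` Z \<subseteq> Obj C \<and>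
    F_pushout C (cells Z V (bdry_sphere n)) (restrict_fam X (B n)) (cells Z V (disk n)) f fb (\<lambda>x. x) (\<lambda>b. b) k kb
      (restrict_fam X (B (Suc n)))"
    for n and Z :: "'b set" and V f fb k kb
  have "\<forall>n. \<exists>Z V f fb k kb. P n Z V f fb k kb"
    using att unfolding attach_cells_def P_def by blast
  then obtain Z where "\<forall>n. \<exists>V f fb k kb. P n (Z n) V f fb k kb" by (rule choice[THEN exE])
  then obtain V where "\<forall>n. \<exists>f fb k kb. P n (Z n) (V n) f fb k kb" by (rule choice[THEN exE])
  then obtain f where "\<forall>n. \<exists>fb k kb. P n (Z n) (V n) (f n) fb k kb" by (rule choice[THEN exE])
  then obtain fb where "\<forall>n. \<exists>k kb. P n (Z n) (V n) (f n) (fb n) k kb" by (rule choice[THEN exE])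
  then obtain k where "\<forall>n. \<exists>kb. P n (Z n) (V n) (f n) (fb n) (k n) kb" by (rule choice[THEN exE])
  then obtain kb where P: "\<forall>n. P n (Z n) (V n) (f n) (fb n) (k n) (kb n)" by (rule choice[THEN exE])
  have V: "V n z \<in> Obj C" if "z \<in> Z n" for n z using P that by (auto simp: P_def)
  have kmap: "F_map C (cells (Z n) (V n) (disk n)) (restrict_fam X (B (Suc n))) (k n) (kb n)" for n
    using P by (auto simp: P_def F_pushout_def)
  have "pushout_tower (base X) B (\<lambda>n. base (cells (Z n) (V n) (bdry_sphere n)))
    (\<lambda>n. base (cells (Z n) (V n) (disk n))) fb kb"
    using P cob B0 by unfold_locales (auto simp: P_def F_pushout_def)
  then interpret b: pushout_tower "base X" B "\<lambda>n. prod_topology (discrete_topology (Z n)) (bdry_sphere n)"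
    "\<lambda>n. prod_topology (discrete_topology (Z n)) (disk n)" fb kb
    by (simp only: cells_simps)
  have "pushout_tower (total X) (\<lambda>n. {x \<in> topspace (total X). proj X x \<in> B n})
    (\<lambda>n. total (cells (Z n) (V n) (bdry_sphere n))) (\<lambda>n. total (cells (Z n) (V n) (disk n))) f k"
    using P cot B0 by unfold_locales (auto simp: P_def F_pushout_def)
  then interpret t: pushout_tower "total X" "\<lambda>n. {x \<in> topspace (total X). proj X x \<in> B n}"
    "\<lambda>n. prod_topology (sum_topology (\<lambda>z. fib C (V n z)) (Z n)) (bdry_sphere n)"
    "\<lambda>n. prod_topology (sum_topology (\<lambda>z. fib C (V n z)) (Z n)) (disk n)" f k
    by (simp only: cells_simps)
  let ?J = "Sigma UNIV Z" and ?lt = "inv_image less_than (fst :: nat \<times> 'b \<Rightarrow> nat)"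
  interpret cell_system C X ?J ?lt fst "\<lambda>j. V (fst j) (snd j)" "\<lambda>j y. kb (fst j) (snd j, y)"
    "\<lambda>j y v. k (fst j) ((snd j, v), y)"
  proof unfold_locales
    show "F_family C X" by (rule X)
    show "wf ?lt" "trans ?lt" by (auto intro: trans_inv_image)
  next
    fix j assume "j \<in> ?J"
    then obtain n z where j: "j = (n, z)" "z \<in> Z n" by auto
    show "V (fst j) (snd j) \<in> Obj C" using V j by simp
    have "continuous_map (disk n) (prod_topology (discrete_topology (Z n)) (disk n)) (Pair z)"
      using j by (intro continuous_map_pairedI) auto
    from continuous_map_compose[OF this b.k_continuous]
    show "continuous_map (disk (fst j)) (base X) (\<lambda>y. kb (fst j) (snd j, y))" by (simp add: comp_def j)
    have "continuous_map (prod_topology (disk n) (fib C (V n z))) (sum_topology (\<lambda>z. fib C (V n z)) (Z n)) (\<lambda>p. (z, snd p))"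
      using continuous_map_compose[OF continuous_map_snd continuous_map_component_injection[OF j(2), of "\<lambda>z. fib C (V n z)"]]
      by (simp add: comp_def)
    then have "continuous_map (prod_topology (disk n) (fib C (V n z)))
        (prod_topology (sum_topology (\<lambda>z. fib C (V n z)) (Z n)) (disk n)) (\<lambda>p. ((z, snd p), fst p))"
      by (intro continuous_map_pairedI continuous_map_fst)
    from continuous_map_compose[OF this t.k_continuous]
    show "continuous_map (prod_topology (disk (fst j)) (fib C (V (fst j) (snd j)))) (total X)
        (\<lambda>p. k (fst j) ((snd j, snd p), fst p))" by (simp add: comp_def j)
    fix y
    show "fibre_param X (kb (fst j) (snd j, y)) (V (fst j) (snd j)) (\<lambda>v. k (fst j) ((snd j, v), y))"
      if "y \<in> topspace (disk (fst j))"
    proof -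
      have y: "y \<in> topspace (disk n)" using that j by simp
      have "F_family C (cells (Z n) (V n) (disk n))" by (rule F_family_cells) (use V in auto)
      from fibre_param_F_map[OF this kmap _ fibre_param_cells[where V = "V n", OF V[OF j(2)] j(2) y]]
      have "fibre_param (restrict_fam X (B (Suc n))) (kb n (z, y)) (V n z) (\<lambda>v. k n ((z, v), y))"
        using j y by (simp add: cells_simps)
      then show ?thesis using b.k_in[of "(z, y)" n] j y by (simp add: fibre_param_restrict)
    qed
    show "\<exists>i\<in>?J. (i, j) \<in> ?lt \<and> kb (fst j) (snd j, y) \<in> (\<lambda>y. kb (fst i) (snd i, y)) ` open_disk (fst i)"
      if "y \<in> topspace (bdry_sphere (fst j))"
    proof -
      have "kb n (z, y) \<in> B n" using b.k_on_A[of "(z, y)" n] that j by simp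
      then obtain m e where m: "m < n" "e \<in> topspace (prod_topology (discrete_topology (Z m)) (disk m)) -
          topspace (prod_topology (discrete_topology (Z m)) (bdry_sphere m))" "kb n (z, y) = kb m e"
        using b.stage_cover by blast
      then have "fst e \<in> Z m" "snd e \<in> open_disk m" by (auto simp: open_disk_def)
      then show ?thesis using m j by (intro bexI[of _ "(m, fst e)"]) (auto intro!: image_eqI[of _ _ "snd e"])
    qed
    fix i y' assume "i \<in> ?J" and y: "y \<in> open_disk (fst j)" "y' \<in> open_disk (fst i)"
      and eq: "kb (fst j) (snd j, y) = kb (fst i) (snd i, y')"
    then obtain m z' where i: "i = (m, z')" "z' \<in> Z m" by auto
    show "j = i \<and> y = y'"
      using b.cell_unique[of "(z, y)" n "(z', y')" m] y eq i j by (auto simp: open_disk_def)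
  next
    fix b assume "b \<in> topspace (base X)"
    then obtain n where "b \<in> B n" using b.B_cover by blast
    then obtain m e where m: "e \<in> topspace (prod_topology (discrete_topology (Z m)) (disk m)) -
          topspace (prod_topology (discrete_topology (Z m)) (bdry_sphere m))" "b = kb m e"
      using b.stage_cover by blast
    then have "fst e \<in> Z m" "snd e \<in> open_disk m" by (auto simp: open_disk_def)
    then show "\<exists>j\<in>?J. b \<in> (\<lambda>y. kb (fst j) (snd j, y)) ` open_disk (fst j)"
      using m(2) by (intro bexI[of _ "(m, fst e)"]) (auto intro!: image_eqI[of _ _ "snd e"])
  next
    fix W assume W: "W \<subseteq> topspace (base X)"
      "\<And>j. j \<in> ?J \<Longrightarrow> openin (disk (fst j)) {y \<in> topspace (disk (fst j)). kb (fst j) (snd j, y) \<in> W}"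
    show "openin (base X) W"
      by (rule b.openin_total_space[OF W(1)]) (use W(2) in \<open>auto simp only: openin_prod_discrete_preimage fst_conv snd_conv mem_Sigma_iff UNIV_I\<close>)
  next
    fix j W assume j: "j \<in> ?J" and W: "\<And>i. i \<in> ?J \<Longrightarrow> (i, j) \<in> ?lt \<Longrightarrow>
        openin (disk (fst i)) {y \<in> topspace (disk (fst i)). kb (fst i) (snd i, y) \<in> W}"
    have "openin (prod_topology (discrete_topology (Z (fst j))) (bdry_sphere (fst j)))
      {a \<in> topspace (prod_topology (discrete_topology (Z (fst j))) (bdry_sphere (fst j))). kb (fst j) a \<in> W}"
      by (rule b.openin_attaching, unfold openin_prod_discrete_preimage) (use W[of "(_, _)"] in auto)
    then show "openin (bdry_sphere (fst j)) {y \<in> topspace (bdry_sphere (fst j)). kb (fst j) (snd j, y) \<in> W}"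
      unfolding openin_prod_discrete_preimage using j by auto
  next
    fix W assume W: "W \<subseteq> topspace (total X)"
      "\<And>j. j \<in> ?J \<Longrightarrow> openin (prod_topology (disk (fst j)) (fib C (V (fst j) (snd j))))
         {p \<in> topspace (disk (fst j)) \<times> topspace (fib C (V (fst j) (snd j))). k (fst j) ((snd j, snd p), fst p) \<in> W}"
    show "openin (total X) W"
      by (rule t.openin_total_space[OF W(1)], unfold openin_prod_sum_preimage) (use W(2)[of "(_, _)"] in auto)
  next
    fix j W assume j: "j \<in> ?J" and W: "\<And>i. i \<in> ?J \<Longrightarrow> (i, j) \<in> ?lt \<Longrightarrow>
        openin (prod_topology (disk (fst i)) (fib C (V (fst i) (snd i))))
         {p \<in> topspace (disk (fst i)) \<times> topspace (fib C (V (fst i) (snd i))). k (fst i) ((snd i, snd p), fst p) \<in> W}"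
    have "openin (prod_topology (sum_topology (\<lambda>z. fib C (V (fst j) z)) (Z (fst j))) (bdry_sphere (fst j)))
      {a \<in> topspace (prod_topology (sum_topology (\<lambda>z. fib C (V (fst j) z)) (Z (fst j))) (bdry_sphere (fst j))). k (fst j) a \<in> W}"
      by (rule t.openin_attaching, unfold openin_prod_sum_preimage) (use W[of "(_, _)"] in auto)
    then show "openin (prod_topology (bdry_sphere (fst j)) (fib C (V (fst j) (snd j))))
        {p \<in> topspace (bdry_sphere (fst j)) \<times> topspace (fib C (V (fst j) (snd j))). k (fst j) ((snd j, snd p), fst p) \<in> W}"
      unfolding openin_prod_sum_preimage using j by auto
  qed
  show ?thesis by (rule F_bundle_cell_system)
qed

end

section \<open>Stratified bundles\<close>

text \<open>Instantiated with the base spaces and with the total spaces of a stratified bundle. The cells of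
  \<open>Q i\<close> indexed by \<open>Z' i\<close> lie in the glued part \<open>A i\<close>; only the others are cells of \<open>T\<close>.\<close>

locale stratum_cells =
  fixes T :: "'t topology" and B :: "nat \<Rightarrow> 't set" and Q :: "nat \<Rightarrow> 'q topology" and A :: "nat \<Rightarrow> 'q set"
    and h k :: "nat \<Rightarrow> 'q \<Rightarrow> 't"
    and Z0 :: "nat \<Rightarrow> 'z0 set" and E0 :: "nat \<Rightarrow> 'z0 \<Rightarrow> 'e topology" and \<xi>0 :: "nat \<Rightarrow> 'z0 \<Rightarrow> 'e \<Rightarrow> 't"
    and Z Z' :: "nat \<Rightarrow> nat \<Rightarrow> 'z set" and E bE :: "nat \<Rightarrow> nat \<Rightarrow> 'z \<Rightarrow> 'e topology"
    and \<xi> :: "nat \<Rightarrow> nat \<Rightarrow> 'z \<Rightarrow> 'e \<Rightarrow> 'q"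
  assumes colim: "seq_colimit T B"
    and open0: "(\<And>n z. z \<in> Z0 n \<Longrightarrow> openin (E0 n z) {e \<in> topspace (E0 n z). \<xi>0 n z e \<in> W}) \<Longrightarrow>
      openin (subtopology T (B 0)) (W \<inter> B 0)"
    and po: "i \<ge> 1 \<Longrightarrow> top_pushout (subtopology (Q i) (A i)) (subtopology T (B (i - 1))) (Q i) (h i) (\<lambda>x. x) (\<lambda>x. x) (k i)
      (subtopology T (B i))"
    and openQ: "i \<ge> 1 \<Longrightarrow> N \<subseteq> topspace (Q i) \<Longrightarrow>
      (\<And>n z. z \<in> Z i n \<Longrightarrow> openin (E i n z) {e \<in> topspace (E i n z). \<xi> i n z e \<in> N}) \<Longrightarrow> openin (Q i) N"
    and attQ: "i \<ge> 1 \<Longrightarrow> N \<subseteq> topspace (Q i) \<Longrightarrow>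
      (\<And>m z. m < n \<Longrightarrow> z \<in> Z i m \<Longrightarrow> openin (E i m z) {e \<in> topspace (E i m z). \<xi> i m z e \<in> N}) \<Longrightarrow>
      y \<in> Z i n \<Longrightarrow> openin (bE i n y) {e \<in> topspace (bE i n y). \<xi> i n y e \<in> N}"
    and \<xi>: "i \<ge> 1 \<Longrightarrow> z \<in> Z i n \<Longrightarrow> continuous_map (E i n z) (Q i) (\<xi> i n z)"
    and bE: "i \<ge> 1 \<Longrightarrow> z \<in> Z i n \<Longrightarrow> topspace (bE i n z) \<subseteq> topspace (E i n z)"
    and sub: "i \<ge> 1 \<Longrightarrow> z \<in> Z' i n \<Longrightarrow> e \<in> topspace (E i n z) \<Longrightarrow> \<xi> i n z e \<in> A i"
begin

text \<open>On a cell lying in \<open>A i\<close> the canonical map factors through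
  \<open>h i\<close> into the previous stage, where \<open>W\<close> is already known to be open.
  The remaining cells are covered by the hypothesis.\<close>

lemma openin_char_cell:
  assumes i: "i \<ge> 1" and W: "openin (subtopology T (B (i - 1))) (W \<inter> B (i - 1))" and z: "z \<in> Z i n"
    and o: "z \<notin> Z' i n \<Longrightarrow> openin (E i n z) {e \<in> topspace (E i n z). k i (\<xi> i n z e) \<in> W}"
  shows "openin (E i n z) {e \<in> topspace (E i n z). \<xi> i n z e \<in> {q \<in> topspace (Q i). k i q \<in> W}}"
proof -
  have \<xi>Q: "\<xi> i n z e \<in> topspace (Q i)" if "e \<in> topspace (E i n z)" for e
    using \<xi>[OF i z] that by (auto simp: continuous_map_def)
  have eq: "{e \<in> topspace (E i n z). \<xi> i n z e \<in> {q \<in> topspace (Q i). k i q \<in> W}}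
    = {e \<in> topspace (E i n z). k i (\<xi> i n z e) \<in> W}" using \<xi>Q by auto
  show ?thesis
  proof (cases "z \<in> Z' i n")
    case False
    then show ?thesis using o eq by simp
  next
    case True
    have c: "continuous_map (E i n z) (subtopology (Q i) (A i)) (\<xi> i n z)"
      by (rule continuous_map_into_subtopology[OF \<xi>[OF i z]]) (use sub[OF i True] in auto)
    have hc: "continuous_map (subtopology (Q i) (A i)) (subtopology T (B (i - 1))) (h i)"
      using po[OF i] by (simp add: top_pushout_def)
    have "continuous_map (E i n z) (subtopology T (B (i - 1))) (\<lambda>e. h i (\<xi> i n z e))"
      using continuous_map_compose[OF c hc] by (simp add: comp_def)
    from openin_continuous_map_preimage[OF this W]
    have "openin (E i n z) {e \<in> topspace (E i n z). h i (\<xi> i n z e) \<in> W \<inter> B (i - 1)}" .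
    moreover have "h i (\<xi> i n z e) = k i (\<xi> i n z e) \<and> h i (\<xi> i n z e) \<in> B (i - 1)" if e: "e \<in> topspace (E i n z)" for e
    proof -
      have "\<xi> i n z e \<in> topspace (subtopology (Q i) (A i))" using sub[OF i True e] \<xi>Q[OF e] by simp
      then show ?thesis
        using top_pushout_inclusionD(4)[OF po[OF i]] Pi_mem[OF continuous_map_funspace[OF hc]] by fastforce
    qed
    ultimately show ?thesis unfolding eq by (simp cong: conj_cong)
  qed
qed

lemma openin_stratum:
  assumes "\<And>n z. z \<in> Z0 n \<Longrightarrow> openin (E0 n z) {e \<in> topspace (E0 n z). \<xi>0 n z e \<in> W}"
    and "\<And>j n z. 1 \<le> j \<Longrightarrow> j \<le> i \<Longrightarrow> z \<in> Z j n \<Longrightarrow> z \<notin> Z' j n \<Longrightarrow>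
      openin (E j n z) {e \<in> topspace (E j n z). k j (\<xi> j n z e) \<in> W}"
  shows "openin (subtopology T (B i)) (W \<inter> B i)"
  using assms(2)
proof (induction i)
  case 0
  show ?case by (rule open0[OF assms(1)])
next
  case (Suc i)
  have IH: "openin (subtopology T (B (Suc i - 1))) (W \<inter> B (Suc i - 1))"
    using Suc by simp
  note D = top_pushout_inclusionD[OF po[of "Suc i"]]
  have BT: "B n \<subseteq> topspace T" for n using colim by (auto simp: seq_colimit_def)
  have kB: "k (Suc i) q \<in> B (Suc i)" if "q \<in> topspace (Q (Suc i))" for q
    using D(5) that BT by auto
  have "openin (Q (Suc i)) {q \<in> topspace (Q (Suc i)). k (Suc i) q \<in> W}"
  proof (rule openQ)
    fix n z assume z: "z \<in> Z (Suc i) n"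
    show "openin (E (Suc i) n z) {e \<in> topspace (E (Suc i) n z). \<xi> (Suc i) n z e \<in> {q \<in> topspace (Q (Suc i)). k (Suc i) q \<in> W}}"
      by (rule openin_char_cell[OF _ IH z]) (use Suc.prems z in auto)
  qed auto
  moreover have "{q \<in> topspace (Q (Suc i)). k (Suc i) q \<in> W \<inter> B (Suc i)} = {q \<in> topspace (Q (Suc i)). k (Suc i) q \<in> W}"
    using kB by auto
  moreover have "{x \<in> topspace (subtopology T (B (Suc i - 1))). x \<in> W \<inter> B (Suc i)} = W \<inter> B (Suc i - 1)"
    using BT colim by (auto simp: seq_colimit_def)
  ultimately show ?case
    using D(6)[of "W \<inter> B (Suc i)"] IH BT by auto
qed

lemma openin_strata:
  assumes "W \<subseteq> topspace T" and "\<And>n z. z \<in> Z0 n \<Longrightarrow> openin (E0 n z) {e \<in> topspace (E0 n z). \<xi>0 n z e \<in> W}"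
    and "\<And>j n z. 1 \<le> j \<Longrightarrow> z \<in> Z j n \<Longrightarrow> z \<notin> Z' j n \<Longrightarrow>
      openin (E j n z) {e \<in> topspace (E j n z). k j (\<xi> j n z e) \<in> W}"
  shows "openin T W"
proof -
  have "openin (subtopology T (B i)) (W \<inter> B i)" for i
    by (rule openin_stratum) (use assms in auto)
  then show ?thesis using colim assms(1) by (simp add: seq_colimit_def)
qed

text \<open>The boundary of a cell of stratum \<open>i\<close> meets smaller-dimensional cells of
  the same piece and, through \<open>h i\<close>, the previous stage with cells of arbitrary
  dimension. Hence strata are compared before dimensions.\<close>

lemma openin_stratum_attaching:
  assumes i: "i \<ge> 1" and "\<And>n z. z \<in> Z0 n \<Longrightarrow> openin (E0 n z) {e \<in> topspace (E0 n z). \<xi>0 n z e \<in> W}"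
    and lower: "\<And>j n z. 1 \<le> j \<Longrightarrow> j < i \<Longrightarrow> z \<in> Z j n \<Longrightarrow> z \<notin> Z' j n \<Longrightarrow>
      openin (E j n z) {e \<in> topspace (E j n z). k j (\<xi> j n z e) \<in> W}"
    and same: "\<And>m z. m < n \<Longrightarrow> z \<in> Z i m \<Longrightarrow> z \<notin> Z' i m \<Longrightarrow>
      openin (E i m z) {e \<in> topspace (E i m z). k i (\<xi> i m z e) \<in> W}"
    and y: "y \<in> Z i n"
  shows "openin (bE i n y) {e \<in> topspace (bE i n y). k i (\<xi> i n y e) \<in> W}"
proof -
  have W: "openin (subtopology T (B (i - 1))) (W \<inter> B (i - 1))"
    by (rule openin_stratum) (use assms in auto)
  let ?N = "{q \<in> topspace (Q i). k i q \<in> W}"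
  have "openin (bE i n y) {e \<in> topspace (bE i n y). \<xi> i n y e \<in> ?N}"
  proof (rule attQ[OF i _ _ y])
    fix m z assume "m < n" "z \<in> Z i m"
    then show "openin (E i m z) {e \<in> topspace (E i m z). \<xi> i m z e \<in> ?N}"
      using openin_char_cell[OF i W] same by blast
  qed auto
  moreover have "\<xi> i n y e \<in> topspace (Q i)" if "e \<in> topspace (bE i n y)" for e
    using \<xi>[OF i y] bE[OF i y] that by (auto simp: continuous_map_def)
  ultimately show ?thesis by (simp cong: conj_cong)
qed

end

section \<open>Coherence of bundles over CW-complexes\<close>

context groupoid_structure
begin

text \<open>Trivializations over the closed cells are lifts in the sense of
  \<open>cartesian_lift\<close>, so the coherent topology of the base passes to the total
  space.\<close>

lemma CW_bundle_cells:
  fixes N :: "('n, 'c, 'o, 'f) family"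
  assumes B: "F_bundle C N" and CW: "CW_complex (base N) Z \<Phi>"
    and tr: "\<And>n z. z \<in> Z n \<Longrightarrow> trivialization N (disk n) (\<lambda>y. \<Phi> n (z, y)) (V n z) (\<Psi> n z) (\<Theta> n z)"
  shows openin_total_of_cells: "\<lbrakk>W \<subseteq> topspace (total N);
      \<And>n z. z \<in> Z n \<Longrightarrow> openin (prod_topology (disk n) (fib C (V n z)))
        {p \<in> topspace (prod_topology (disk n) (fib C (V n z))). \<Psi> n z (fst p) (snd p) \<in> W}\<rbrakk> \<Longrightarrow> openin (total N) W"
    and openin_bdry_of_cells: "\<lbrakk>W \<subseteq> topspace (total N);
      \<And>m z. m < n \<Longrightarrow> z \<in> Z m \<Longrightarrow> openin (prod_topology (disk m) (fib C (V m z)))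
        {p \<in> topspace (prod_topology (disk m) (fib C (V m z))). \<Psi> m z (fst p) (snd p) \<in> W}; z \<in> Z n\<rbrakk> \<Longrightarrow>
      openin (prod_topology (bdry_sphere n) (fib C (V n z)))
        {p \<in> topspace (prod_topology (bdry_sphere n) (fib C (V n z))). \<Psi> n z (fst p) (snd p) \<in> W}"
proof -
  note N = F_bundle_family[OF B]
  obtain f where "pushout_tower (base N) (skel Z \<Phi>) (\<lambda>n. prod_topology (discrete_topology (Z n)) (bdry_sphere n))
    (\<lambda>n. prod_topology (discrete_topology (Z n)) (disk n)) f \<Phi>"
    using CW_tower[OF CW] by blast
  then interpret t: pushout_tower "base N" "skel Z \<Phi>" "\<lambda>n. prod_topology (discrete_topology (Z n)) (bdry_sphere n)"
    "\<lambda>n. prod_topology (discrete_topology (Z n)) (disk n)" f \<Phi> .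
  have lift: "cartesian_lift N (disk n) (prod_topology (disk n) (fib C (V n z))) (\<lambda>y. \<Phi> n (z, y))
      (\<lambda>p. \<Psi> n z (fst p) (snd p)) (\<lambda>y x. (y, \<Theta> n z y x))" if "z \<in> Z n" for n z
    by (rule cartesian_lift_trivialization[OF N tr[OF that]])
  show "openin (total N) W" if W: "W \<subseteq> topspace (total N)"
    "\<And>n z. z \<in> Z n \<Longrightarrow> openin (prod_topology (disk n) (fib C (V n z)))
        {p \<in> topspace (prod_topology (disk n) (fib C (V n z))). \<Psi> n z (fst p) (snd p) \<in> W}"
  proof (rule openin_total_via_lifts[OF B W(1), where I = "Sigma UNIV Z" and I' = "{} :: unit set"
        and Y = "\<lambda>j. disk (fst j)" and E = "\<lambda>j. prod_topology (disk (fst j)) (fib C (V (fst j) (snd j)))"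
        and k = "\<lambda>j y. \<Phi> (fst j) (snd j, y)" and e = "\<lambda>j p. \<Psi> (fst j) (snd j) (fst p) (snd p)"
        and L = "\<lambda>j y x. (y, \<Theta> (fst j) (snd j) y x)"])
    fix b assume "b \<in> topspace (base N)"
    then obtain n where "b \<in> skel Z \<Phi> n" using t.B_cover by blast
    then obtain m e where "e \<in> topspace (prod_topology (discrete_topology (Z m)) (disk m))" "b = \<Phi> m e"
      using t.stage_cover by blast
    then show "(\<exists>j\<in>Sigma UNIV Z. b \<in> (\<lambda>y. \<Phi> (fst j) (snd j, y)) ` topspace (disk (fst j))) \<or>
        (\<exists>i\<in>{}. b \<in> undefined i ` topspace (undefined i))"
      by (intro disjI1 bexI[of _ "(m, fst e)"]) (auto intro!: image_eqI[of _ _ "snd e"])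
  next
    fix N' assume N': "N' \<subseteq> topspace (base N)" "\<And>j. j \<in> Sigma UNIV Z \<Longrightarrow>
      openin (disk (fst j)) {y \<in> topspace (disk (fst j)). \<Phi> (fst j) (snd j, y) \<in> N'}"
    show "openin (base N) N'"
      by (rule t.openin_total_space[OF N'(1)], unfold openin_prod_discrete_preimage) (use N'(2)[of "(_, _)"] in auto)
  qed (use lift W(2) in auto)
  show "openin (prod_topology (bdry_sphere n) (fib C (V n z)))
        {p \<in> topspace (prod_topology (bdry_sphere n) (fib C (V n z))). \<Psi> n z (fst p) (snd p) \<in> W}"
    if W: "W \<subseteq> topspace (total N)"
      "\<And>m z. m < n \<Longrightarrow> z \<in> Z m \<Longrightarrow> openin (prod_topology (disk m) (fib C (V m z)))
        {p \<in> topspace (prod_topology (disk m) (fib C (V m z))). \<Psi> m z (fst p) (snd p) \<in> W}" and z: "z \<in> Z n" for n z W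
  proof -
    \<comment> \<open>The lifting argument is repeated over the skeleton below dimension
      \<open>n\<close>. The trivialization over the cell maps the part over the boundary sphere
      continuously into the bundle over that skeleton.\<close>
    let ?S = "skel Z \<Phi> n"
    let ?NS = "restrict_fam N ?S"
    let ?J = "Sigma {..<n} Z"
    have m: "\<Phi> m (z, y) \<in> ?S" if "m < n" "z \<in> Z m" "y \<in> topspace (disk m)" for m z y
      using t.k_in[of "(z, y)" m] t.B_mono[of "Suc m" n] that by auto
    have "openin (total ?NS) (W \<inter> topspace (total ?NS))"
    proof (rule openin_total_via_lifts[OF F_bundle_restrict[OF B], where I = ?J and I' = "{} :: unit set"
        and Y = "\<lambda>j. disk (fst j)" and E = "\<lambda>j. prod_topology (disk (fst j)) (fib C (V (fst j) (snd j)))"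
        and k = "\<lambda>j y. \<Phi> (fst j) (snd j, y)" and e = "\<lambda>j p. \<Psi> (fst j) (snd j) (fst p) (snd p)"
        and L = "\<lambda>j y x. (y, \<Theta> (fst j) (snd j) y x)"])
      fix j assume "j \<in> ?J"
      then obtain i y where j: "j = (i, y)" "i < n" "y \<in> Z i" by auto
      show "cartesian_lift ?NS (disk (fst j)) (prod_topology (disk (fst j)) (fib C (V (fst j) (snd j))))
        (\<lambda>y. \<Phi> (fst j) (snd j, y)) (\<lambda>p. \<Psi> (fst j) (snd j) (fst p) (snd p)) (\<lambda>y x. (y, \<Theta> (fst j) (snd j) y x))"
        using cartesian_lift_into_restrict[OF lift[OF j(3)], of ?S] m[OF j(2,3)] j by auto
      have "\<Psi> i y (fst p) (snd p) \<in> topspace (total ?NS)"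
        if "p \<in> topspace (prod_topology (disk i) (fib C (V i y)))" for p
        using trivialization_in_fibre[OF tr[OF j(3)], of "fst p" "snd p"] m[OF j(2,3), of "fst p"] that
        by (auto simp: fibre_def)
      then have "{p \<in> topspace (prod_topology (disk i) (fib C (V i y))). \<Psi> i y (fst p) (snd p) \<in> W \<inter> topspace (total ?NS)}
        = {p \<in> topspace (prod_topology (disk i) (fib C (V i y))). \<Psi> i y (fst p) (snd p) \<in> W}" by blast
      then show "openin (prod_topology (disk (fst j)) (fib C (V (fst j) (snd j))))
         {p \<in> topspace (prod_topology (disk (fst j)) (fib C (V (fst j) (snd j)))).
          \<Psi> (fst j) (snd j) (fst p) (snd p) \<in> W \<inter> topspace (total ?NS)}"
        using W(2)[OF j(2,3)] j by simp
    next
      fix b assume "b \<in> topspace (base ?NS)"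
      then obtain m e where "m < n" "e \<in> topspace (prod_topology (discrete_topology (Z m)) (disk m))" "b = \<Phi> m e"
        using t.stage_cover[of b n] by auto
      then show "(\<exists>j\<in>?J. b \<in> (\<lambda>y. \<Phi> (fst j) (snd j, y)) ` topspace (disk (fst j))) \<or>
          (\<exists>i\<in>{}. b \<in> undefined i ` topspace (undefined i))"
        by (intro disjI1 bexI[of _ "(m, fst e)"]) (auto intro!: image_eqI[of _ _ "snd e"])
    next
      fix N' assume N': "N' \<subseteq> topspace (base ?NS)" "\<And>j. j \<in> ?J \<Longrightarrow>
        openin (disk (fst j)) {y \<in> topspace (disk (fst j)). \<Phi> (fst j) (snd j, y) \<in> N'}"
      have "openin (subtopology (base N) ?S) (N' \<inter> ?S)"
        by (rule t.openin_stage, unfold openin_prod_discrete_preimage) (use N'(2)[of "(_, _)"] in auto)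
      moreover have "N' \<inter> ?S = N'" using N'(1) by auto
      ultimately show "openin (base ?NS) N'" by simp
    qed auto
    moreover have "continuous_map (prod_topology (bdry_sphere n) (fib C (V n z))) (total ?NS) (\<lambda>p. \<Psi> n z (fst p) (snd p))"
    proof -
      have e: "prod_topology (bdry_sphere n) (fib C (V n z))
        = subtopology (prod_topology (disk n) (fib C (V n z))) (topspace (bdry_sphere n) \<times> topspace (fib C (V n z)))"
        by (subst bdry_sphere_eq_subtopology) (simp add: subtopology_Times)
      have c: "continuous_map (prod_topology (bdry_sphere n) (fib C (V n z))) (total N) (\<lambda>p. \<Psi> n z (fst p) (snd p))"
        unfolding e using tr[OF z] by (intro continuous_map_from_subtopology) (simp add: trivialization_def)
      have "\<Psi> n z y v \<in> fibre N (\<Phi> n (z, y)) \<and> \<Phi> n (z, y) \<in> ?S" if "y \<in> topspace (bdry_sphere n)" "v \<in> topspace (fib C (V n z))" for y v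
        using trivialization_in_fibre[OF tr[OF z]] bdry_sphere_subset_disk t.k_on_A[of "(z, y)" n] that z by auto
      then show ?thesis unfolding restrict_simps
        by (intro continuous_map_into_subtopology[OF c]) (auto simp: fibre_def)
    qed
    ultimately have "openin (prod_topology (bdry_sphere n) (fib C (V n z)))
        {p \<in> topspace (prod_topology (bdry_sphere n) (fib C (V n z))). \<Psi> n z (fst p) (snd p) \<in> W \<inter> topspace (total ?NS)}"
      using openin_continuous_map_preimage by blast
    moreover have "{p \<in> topspace (prod_topology (bdry_sphere n) (fib C (V n z))). \<Psi> n z (fst p) (snd p) \<in> W \<inter> topspace (total ?NS)}
      = {p \<in> topspace (prod_topology (bdry_sphere n) (fib C (V n z))). \<Psi> n z (fst p) (snd p) \<in> W}"
      using Pi_mem[OF continuous_map_funspace[OF \<open>continuous_map (prod_topology (bdry_sphere n) _) (total ?NS) _\<close>]] by blast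
    ultimately show ?thesis by simp
  qed
qed

end

text \<open>The facts about \<open>pushout_tower\<close>, read off one cell at a time: the slices of
  the discrete index set are single disks.\<close>

lemma CW_base_cells:
  assumes CW: "CW_complex T Z \<Phi>"
  shows CW_cell_continuous: "z \<in> Z n \<Longrightarrow> continuous_map (disk n) T (\<lambda>y. \<Phi> n (z, y))"
    and CW_openin: "\<lbrakk>W \<subseteq> topspace T; \<And>n z. z \<in> Z n \<Longrightarrow> openin (disk n) {y \<in> topspace (disk n). \<Phi> n (z, y) \<in> W}\<rbrakk> \<Longrightarrow> openin T W"
    and CW_openin_bdry: "\<lbrakk>\<And>m z. m < n \<Longrightarrow> z \<in> Z m \<Longrightarrow> openin (disk m) {y \<in> topspace (disk m). \<Phi> m (z, y) \<in> W}; z \<in> Z n\<rbrakk> \<Longrightarrow>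
       openin (bdry_sphere n) {y \<in> topspace (bdry_sphere n). \<Phi> n (z, y) \<in> W}"
    and CW_cover: "t \<in> topspace T \<Longrightarrow> \<exists>n. \<exists>z\<in>Z n. \<exists>y\<in>open_disk n. t = \<Phi> n (z, y)"
    and CW_bdry: "z \<in> Z n \<Longrightarrow> y \<in> topspace (bdry_sphere n) \<Longrightarrow> \<exists>m<n. \<exists>z'\<in>Z m. \<exists>y'\<in>open_disk m. \<Phi> n (z, y) = \<Phi> m (z', y')"
    and CW_inj: "z \<in> Z n \<Longrightarrow> y \<in> open_disk n \<Longrightarrow> z' \<in> Z m \<Longrightarrow> y' \<in> open_disk m \<Longrightarrow> \<Phi> n (z, y) = \<Phi> m (z', y') \<Longrightarrow>
       n = m \<and> z = z' \<and> y = y'"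
proof -
  obtain f where "pushout_tower T (skel Z \<Phi>) (\<lambda>n. prod_topology (discrete_topology (Z n)) (bdry_sphere n))
    (\<lambda>n. prod_topology (discrete_topology (Z n)) (disk n)) f \<Phi>"
    using CW_tower[OF CW] by blast
  then interpret t: pushout_tower T "skel Z \<Phi>" "\<lambda>n. prod_topology (discrete_topology (Z n)) (bdry_sphere n)"
    "\<lambda>n. prod_topology (discrete_topology (Z n)) (disk n)" f \<Phi> .
  show "continuous_map (disk n) T (\<lambda>y. \<Phi> n (z, y))" if "z \<in> Z n"
  proof -
    have "continuous_map (disk n) (prod_topology (discrete_topology (Z n)) (disk n)) (Pair z)"
      using that by (intro continuous_map_pairedI) auto
    from continuous_map_compose[OF this t.k_continuous] show ?thesis by (simp add: comp_def)
  qed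
  show "openin T W" if W: "W \<subseteq> topspace T" "\<And>n z. z \<in> Z n \<Longrightarrow> openin (disk n) {y \<in> topspace (disk n). \<Phi> n (z, y) \<in> W}"
    by (rule t.openin_total_space[OF W(1)], unfold openin_prod_discrete_preimage) (use W(2) in auto)
  show "openin (bdry_sphere n) {y \<in> topspace (bdry_sphere n). \<Phi> n (z, y) \<in> W}"
    if W: "\<And>m z. m < n \<Longrightarrow> z \<in> Z m \<Longrightarrow> openin (disk m) {y \<in> topspace (disk m). \<Phi> m (z, y) \<in> W}" and z: "z \<in> Z n"
  proof -
    have "openin (prod_topology (discrete_topology (Z n)) (bdry_sphere n))
      {a \<in> topspace (prod_topology (discrete_topology (Z n)) (bdry_sphere n)). \<Phi> n a \<in> W}"
      by (rule t.openin_attaching, unfold openin_prod_discrete_preimage) (use W in auto)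
    then show ?thesis unfolding openin_prod_discrete_preimage using z by auto
  qed
  have st: "\<exists>m<n. \<exists>z\<in>Z m. \<exists>y\<in>open_disk m. t = \<Phi> m (z, y)" if t: "t \<in> skel Z \<Phi> n" for t n
  proof -
    obtain m e where m: "m < n" "e \<in> topspace (prod_topology (discrete_topology (Z m)) (disk m)) -
        topspace (prod_topology (discrete_topology (Z m)) (bdry_sphere m))" "t = \<Phi> m e"
      using t.stage_cover[OF t] by blast
    then have "fst e \<in> Z m" "snd e \<in> open_disk m" "t = \<Phi> m (fst e, snd e)" by (auto simp: open_disk_def)
    then show ?thesis using m(1) by blast
  qed
  show "\<exists>n. \<exists>z\<in>Z n. \<exists>y\<in>open_disk n. t = \<Phi> n (z, y)" if "t \<in> topspace T"
    using that t.B_cover st by blast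
  show "\<exists>m<n. \<exists>z'\<in>Z m. \<exists>y'\<in>open_disk m. \<Phi> n (z, y) = \<Phi> m (z', y')" if "z \<in> Z n" "y \<in> topspace (bdry_sphere n)"
    using st[OF t.k_on_A[of "(z, y)" n]] that by simp
  show "n = m \<and> z = z' \<and> y = y'" if "z \<in> Z n" "y \<in> open_disk n" "z' \<in> Z m" "y' \<in> open_disk m" "\<Phi> n (z, y) = \<Phi> m (z', y')"
    using t.cell_unique[of "(z, y)" n "(z', y')" m] that by (auto simp: open_disk_def)
qed

text \<open>A subcomplex is given as a closed union of open cells. Density of the open disk adds the
  boundaries of these cells, and disjointness of open cells keeps all the others out.\<close>

lemma subcomplex_cells:
  assumes CW: "CW_complex T Z \<Phi>" and A: "subcomplex T Z \<Phi> A"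
  shows "\<exists>Z'. (\<forall>n. Z' n \<subseteq> Z n) \<and> (\<forall>n. \<forall>z\<in>Z' n. \<forall>y\<in>topspace (disk n). \<Phi> n (z, y) \<in> A) \<and>
    (\<forall>n. \<forall>z\<in>Z n - Z' n. \<forall>y\<in>open_disk n. \<Phi> n (z, y) \<notin> A)"
proof -
  obtain Z' where Z': "\<And>n. Z' n \<subseteq> Z n" and Aeq: "A = (\<Union>n. \<Phi> n ` (Z' n \<times> open_disk n))" and cl: "closedin T A"
    using A by (auto simp: subcomplex_def open_disk_def)
  have "\<Phi> n (z, y) \<in> A" if z: "z \<in> Z' n" and y: "y \<in> topspace (disk n)" for n z y
  proof -
    have c: "continuous_map (disk n) T (\<lambda>y. \<Phi> n (z, y))"
      using CW_cell_continuous[OF CW] Z' z by blast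
    have "topspace (disk n) \<subseteq> {y \<in> topspace (disk n). \<Phi> n (z, y) \<in> A}"
      by (rule disk_interior_dense[OF closedin_continuous_map_preimage[OF c cl]])
        (use z in \<open>auto simp: Aeq open_disk_def\<close>)
    then show ?thesis using y by blast
  qed
  moreover have "\<Phi> n (z, y) \<notin> A" if "z \<in> Z n - Z' n" "y \<in> open_disk n" for n z y
  proof
    assume "\<Phi> n (z, y) \<in> A"
    then obtain m z' y' where "z' \<in> Z' m" "y' \<in> open_disk m" "\<Phi> n (z, y) = \<Phi> m (z', y')"
      by (auto simp: Aeq)
    then show False using CW_inj[OF CW, of z n y z' m y'] that Z' by blast
  qed
  ultimately show ?thesis using Z' by (intro exI[of _ Z']) auto
qed

context groupoid_structure
begin

lemma CW_bundle_trivializations: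
  assumes B: "F_bundle C N" and CW: "CW_complex (base N) Z \<Phi>"
  shows "\<exists>V \<Psi> \<Theta>. \<forall>n. \<forall>z\<in>Z n. trivialization N (disk n) (\<lambda>y. \<Phi> n (z, y)) (V n z) (\<Psi> n z) (\<Theta> n z)"
proof -
  define P where "P j V \<Psi> \<Theta> \<longleftrightarrow> (snd j \<in> Z (fst j) \<longrightarrow>
    trivialization N (disk (fst j)) (\<lambda>y. \<Phi> (fst j) (snd j, y)) V \<Psi> \<Theta>)" for j V \<Psi> \<Theta>
  have "\<forall>j. \<exists>V \<Psi> \<Theta>. P j V \<Psi> \<Theta>"
    using trivialization_disk[OF B CW_cell_continuous[OF CW]] unfolding P_def by blast
  then obtain V where "\<forall>j. \<exists>\<Psi> \<Theta>. P j (V j) \<Psi> \<Theta>" by (rule choice[THEN exE])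
  then obtain \<Psi> where "\<forall>j. \<exists>\<Theta>. P j (V j) (\<Psi> j) \<Theta>" by (rule choice[THEN exE])
  then obtain \<Theta> where P: "\<forall>j. P j (V j) (\<Psi> j) (\<Theta> j)" by (rule choice[THEN exE])
  have "trivialization N (disk n) (\<lambda>y. \<Phi> n (z, y)) (V (n, z)) (\<Psi> (n, z)) (\<Theta> (n, z))" if "z \<in> Z n" for n z
    using P[THEN spec, of "(n, z)"] that by (simp add: P_def)
  then show ?thesis
    by (intro exI[of _ "\<lambda>n z. V (n, z)"] exI[of _ "\<lambda>n z. \<Psi> (n, z)"] exI[of _ "\<lambda>n z. \<Theta> (n, z)"]) blast
qed

text \<open>The cells of the system are those of \<open>X_0\<close> and those of each piece not
  lying in its glued part, pushed into the base by the characteristic maps. Base and total space are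
  coherent by two instances of \<open>stratum_cells\<close>.\<close>

lemma F_bundle_of_stratified_bundle:
  fixes X :: "('x, 'b, 'o, 'f) family" and S :: "('b, 'm) stratification" and M :: "nat \<Rightarrow> ('n, 'm, 'o, 'f) family"
  assumes st: "F_stratified_fibre_bundle C S X M h k"
  shows "F_bundle C X"
proof -
  let ?B = "stage S" and ?A = "piece_sub S"
  have X: "F_family C X" and bX: "base X = whole S" and B0: "F_bundle C (restrict_fam X (?B 0))"
    and co: "fam_colimit X ?B" and ss: "stratified_space S"
    using st by (auto simp: F_stratified_fibre_bundle_def)
  have MB: "F_bundle C (M i)" and bM: "base (M i) = piece S i"
    and Fpo: "F_pushout C (restrict_fam (M i) (?A i)) (restrict_fam X (?B (i - 1))) (M i)
          (h i) (att S i) (\<lambda>x. x) (\<lambda>b. b) (k i) (char_map S i) (restrict_fam X (?B i))" if "i \<ge> 1" for i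
    using st that by (auto simp: F_stratified_fibre_bundle_def)
  have sf: "stratified_filtration S" using ss by (simp add: stratified_space_def)
  have cob: "seq_colimit (base X) ?B" and cot: "seq_colimit (total X) (\<lambda>i. {x \<in> topspace (total X). proj X x \<in> ?B i})"
    using co by (auto simp: fam_colimit_def)
  have BX: "?B i \<subseteq> topspace (base X)" and B_cover: "(\<Union>i. ?B i) = topspace (base X)" for i
    using cob by (auto simp: seq_colimit_def)
  have B_mono: "?B i \<subseteq> ?B j" if "i \<le> j" for i j
    using lift_Suc_mono_le[of ?B, OF _ that] cob by (simp add: seq_colimit_def)
  have kmap: "F_map C (M i) (restrict_fam X (?B i)) (k i) (char_map S i)" if "i \<ge> 1" for i
    using Fpo[OF that] by (simp add: F_pushout_def)
  have pob: "top_pushout (subtopology (piece S i) (?A i)) (subtopology (base X) (?B (i - 1))) (piece S i)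
      (att S i) (\<lambda>x. x) (\<lambda>x. x) (char_map S i) (subtopology (base X) (?B i))" if "i \<ge> 1" for i
    using Fpo[OF that] bM[OF that] by (simp add: F_pushout_def)
  have pot: "top_pushout (subtopology (total (M i)) {m \<in> topspace (total (M i)). proj (M i) m \<in> ?A i})
      (subtopology (total X) {x \<in> topspace (total X). proj X x \<in> ?B (i - 1)}) (total (M i))
      (h i) (\<lambda>x. x) (\<lambda>x. x) (k i) (subtopology (total X) {x \<in> topspace (total X). proj X x \<in> ?B i})" if "i \<ge> 1" for i
    using Fpo[OF that] by (simp add: F_pushout_def)

  \<comment> \<open>Cells of the pieces and trivializations over them\<close>
  let ?N0 = "restrict_fam X (?B 0)"
  obtain Z0 :: "nat \<Rightarrow> 'b set" and \<Phi>0 where CW0: "CW_complex (base ?N0) Z0 \<Phi>0"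
    using sf bX by (auto simp: stratified_filtration_def CW_space_def)
  obtain V0 \<Psi>0 \<Theta>0 where tr0: "\<And>n z. z \<in> Z0 n \<Longrightarrow> trivialization ?N0 (disk n) (\<lambda>y. \<Phi>0 n (z, y)) (V0 n z) (\<Psi>0 n z) (\<Theta>0 n z)"
    using CW_bundle_trivializations[OF B0 CW0] by blast

  \<comment> \<open>The guard makes the choice total in \<open>i\<close>, as no conditions are
    imposed on the piece at \<open>i = 0\<close>.\<close>
  define P where "P i Z \<Phi> Z' V \<Psi> \<Theta> \<longleftrightarrow> (i \<ge> 1 \<longrightarrow> CW_complex (piece S i) Z \<Phi> \<and>
    (\<forall>n. Z' n \<subseteq> Z n) \<and> (\<forall>n. \<forall>z\<in>Z' n. \<forall>y\<in>topspace (disk n). \<Phi> n (z, y) \<in> ?A i) \<and>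
    (\<forall>n. \<forall>z\<in>Z n - Z' n. \<forall>y\<in>open_disk n. \<Phi> n (z, y) \<notin> ?A i) \<and>
    (\<forall>n. \<forall>z\<in>Z n. trivialization (M i) (disk n) (\<lambda>y. \<Phi> n (z, y)) (V n z) (\<Psi> n z) (\<Theta> n z)))"
    for i and Z :: "nat \<Rightarrow> 'm set" and \<Phi> Z' V \<Psi> \<Theta>
  have "\<forall>i. \<exists>Z \<Phi> Z' V \<Psi> \<Theta>. P i Z \<Phi> Z' V \<Psi> \<Theta>"
  proof
    fix i
    show "\<exists>Z \<Phi> Z' V \<Psi> \<Theta>. P i Z \<Phi> Z' V \<Psi> \<Theta>"
    proof (cases "i \<ge> 1")
      case False
      then show ?thesis by (simp add: P_def)
    next
      case True
      then obtain Z :: "nat \<Rightarrow> 'm set" and \<Phi> where CW: "CW_complex (piece S i) Z \<Phi>" and sub: "subcomplex (piece S i) Z \<Phi> (?A i)"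
        using sf by (auto simp: stratified_filtration_def CW_pair_def)
      obtain Z' where Z': "(\<forall>n. Z' n \<subseteq> Z n) \<and> (\<forall>n. \<forall>z\<in>Z' n. \<forall>y\<in>topspace (disk n). \<Phi> n (z, y) \<in> ?A i) \<and>
          (\<forall>n. \<forall>z\<in>Z n - Z' n. \<forall>y\<in>open_disk n. \<Phi> n (z, y) \<notin> ?A i)"
        using subcomplex_cells[OF CW sub] by (rule exE)
      have "CW_complex (base (M i)) Z \<Phi>" using CW bM[OF True] by simp
      from CW_bundle_trivializations[OF MB[OF True] this]
      obtain V \<Psi> \<Theta> where "\<forall>n. \<forall>z\<in>Z n. trivialization (M i) (disk n) (\<lambda>y. \<Phi> n (z, y)) (V n z) (\<Psi> n z) (\<Theta> n z)"
        by (elim exE)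
      then have "P i Z \<Phi> Z' V \<Psi> \<Theta>" using CW Z' by (simp add: P_def)
      then show ?thesis by (intro exI)
    qed
  qed
  then obtain Z where "\<forall>i. \<exists>\<Phi> Z' V \<Psi> \<Theta>. P i (Z i) \<Phi> Z' V \<Psi> \<Theta>" by (rule choice[THEN exE])
  then obtain \<Phi> where "\<forall>i. \<exists>Z' V \<Psi> \<Theta>. P i (Z i) (\<Phi> i) Z' V \<Psi> \<Theta>" by (rule choice[THEN exE])
  then obtain Z' where "\<forall>i. \<exists>V \<Psi> \<Theta>. P i (Z i) (\<Phi> i) (Z' i) V \<Psi> \<Theta>" by (rule choice[THEN exE])
  then obtain V where "\<forall>i. \<exists>\<Psi> \<Theta>. P i (Z i) (\<Phi> i) (Z' i) (V i) \<Psi> \<Theta>" by (rule choice[THEN exE])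
  then obtain \<Psi> where "\<forall>i. \<exists>\<Theta>. P i (Z i) (\<Phi> i) (Z' i) (V i) (\<Psi> i) \<Theta>" by (rule choice[THEN exE])
  then obtain \<Theta> where P: "\<forall>i. P i (Z i) (\<Phi> i) (Z' i) (V i) (\<Psi> i) (\<Theta> i)" by (rule choice[THEN exE])
  have CW: "CW_complex (piece S i) (Z i) (\<Phi> i)"
    and \<Phi>A: "\<And>n z y. z \<in> Z' i n \<Longrightarrow> y \<in> topspace (disk n) \<Longrightarrow> \<Phi> i n (z, y) \<in> ?A i"
    and \<Phi>nA: "\<And>n z y. z \<in> Z i n \<Longrightarrow> z \<notin> Z' i n \<Longrightarrow> y \<in> open_disk n \<Longrightarrow> \<Phi> i n (z, y) \<notin> ?A i"
    and Z'Z: "\<And>n z. z \<in> Z' i n \<Longrightarrow> z \<in> Z i n"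
    and tr: "\<And>n z. z \<in> Z i n \<Longrightarrow> trivialization (M i) (disk n) (\<lambda>y. \<Phi> i n (z, y)) (V i n z) (\<Psi> i n z) (\<Theta> i n z)"
    if "i \<ge> 1" for i
    using P[THEN spec, of i] that unfolding P_def by (simp_all add: subset_iff)
  have CWM: "CW_complex (base (M i)) (Z i) (\<Phi> i)" if "i \<ge> 1" for i using CW[OF that] bM[OF that] by simp

  have \<Phi>0B: "\<Phi>0 n (z, y) \<in> ?B 0" if "z \<in> Z0 n" "y \<in> topspace (disk n)" for n z y
    using Pi_mem[OF continuous_map_funspace[OF CW_cell_continuous[OF CW0 that(1)]] that(2)] by simp
  have \<Phi>Q: "\<Phi> i n (z, y) \<in> topspace (piece S i)" if "i \<ge> 1" "z \<in> Z i n" "y \<in> topspace (disk n)" for i n z y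
    using Pi_mem[OF continuous_map_funspace[OF CW_cell_continuous[OF CW[OF that(1)] that(2)]] that(3)] .
  note pobD = top_pushout_inclusionD[OF pob]
  have charB: "char_map S i q \<in> ?B i" if "i \<ge> 1" "q \<in> topspace (piece S i)" for i q
    using pobD(5)[OF that(1)] that(2) BX by auto
  have charA: "char_map S i q \<in> ?B (i - 1)" if "i \<ge> 1" "q \<in> topspace (piece S i)" "q \<in> ?A i" for i q
  proof -
    have "continuous_map (subtopology (piece S i) (?A i)) (subtopology (base X) (?B (i - 1))) (att S i)"
      using pob[OF that(1)] by (simp add: top_pushout_def)
    from Pi_mem[OF continuous_map_funspace[OF this], of q] pobD(4)[OF that(1), of q] that show ?thesis by simp
  qed
  have char_nA: "char_map S i q \<notin> ?B (i - 1)" if "i \<ge> 1" "q \<in> topspace (piece S i)" "q \<notin> ?A i" for i q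
    using pobD(3)[OF that(1)] that BX by auto
  have char_inj: "q = q'" if "i \<ge> 1" "q \<in> topspace (piece S i)" "q \<notin> ?A i" "q' \<in> topspace (piece S i)" "q' \<notin> ?A i"
    "char_map S i q = char_map S i q'" for i q q'
    using inj_onD[OF pobD(2)[OF that(1)] that(6)] that by simp

  \<comment> \<open>Coherence of the base and the total space\<close>
  have strb: "stratum_cells (base X) ?B (piece S) ?A (att S) (char_map S) Z0 (\<lambda>n z. disk n) (\<lambda>n z y. \<Phi>0 n (z, y))
    Z Z' (\<lambda>i n z. disk n) (\<lambda>i n z. bdry_sphere n) (\<lambda>i n z y. \<Phi> i n (z, y))"
  proof (unfold_locales, rule cob)
    fix W assume W: "\<And>n z. z \<in> Z0 n \<Longrightarrow> openin (disk n) {y \<in> topspace (disk n). \<Phi>0 n (z, y) \<in> W}"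
    have "openin (base ?N0) (W \<inter> ?B 0)"
    proof (rule CW_openin[OF CW0])
      fix n z assume z: "z \<in> Z0 n"
      have "{y \<in> topspace (disk n). \<Phi>0 n (z, y) \<in> W \<inter> ?B 0} = {y \<in> topspace (disk n). \<Phi>0 n (z, y) \<in> W}"
        using \<Phi>0B[OF z] by auto
      then show "openin (disk n) {y \<in> topspace (disk n). \<Phi>0 n (z, y) \<in> W \<inter> ?B 0}" using W[OF z] by simp
    qed (use BX in auto)
    then show "openin (subtopology (base X) (?B 0)) (W \<inter> ?B 0)" by simp
  next
    fix i :: nat and N n assume i: "1 \<le> i" and N: "N \<subseteq> topspace (piece S i)"
    show "openin (piece S i) N"
      if "\<And>n z. z \<in> Z i n \<Longrightarrow> openin (disk n) {y \<in> topspace (disk n). \<Phi> i n (z, y) \<in> N}"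
      by (rule CW_openin[OF CW[OF i] N that])
    show "openin (bdry_sphere n) {y \<in> topspace (bdry_sphere n). \<Phi> i n (z, y) \<in> N}"
      if "\<And>m z. m < n \<Longrightarrow> z \<in> Z i m \<Longrightarrow> openin (disk m) {y \<in> topspace (disk m). \<Phi> i m (z, y) \<in> N}" "z \<in> Z i n" for z
      by (rule CW_openin_bdry[OF CW[OF i] that])
  next
    fix i n z assume "1 \<le> (i :: nat)" "z \<in> Z i n"
    then show "continuous_map (disk n) (piece S i) (\<lambda>y. \<Phi> i n (z, y))"
      by (rule CW_cell_continuous[OF CW])
  next
    fix i n z y assume "1 \<le> (i :: nat)" "z \<in> Z' i n" "y \<in> topspace (disk n)"
    then show "\<Phi> i n (z, y) \<in> ?A i" by (rule \<Phi>A)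
  qed (rule pob, assumption, rule bdry_sphere_subset_disk)

  have \<Psi>0in: "\<Psi>0 n z (fst p) (snd p) \<in> topspace (total ?N0)"
    if "z \<in> Z0 n" "p \<in> topspace (prod_topology (disk n) (fib C (V0 n z)))" for n z p
    using trivialization_in_fibre[OF tr0[OF that(1)], of "fst p" "snd p"] that(2) by (auto simp: fibre_def)
  have \<Psi>in: "\<Psi> i n z y v \<in> fibre (M i) (\<Phi> i n (z, y))"
    if "i \<ge> 1" "z \<in> Z i n" "y \<in> topspace (disk n)" "v \<in> topspace (fib C (V i n z))" for i n z y v
    using trivialization_in_fibre[OF tr[OF that(1,2)] that(3,4)] .

  have strt: "stratum_cells (total X) (\<lambda>i. {x \<in> topspace (total X). proj X x \<in> ?B i}) (\<lambda>i. total (M i))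
    (\<lambda>i. {m \<in> topspace (total (M i)). proj (M i) m \<in> ?A i}) h k
    Z0 (\<lambda>n z. prod_topology (disk n) (fib C (V0 n z))) (\<lambda>n z p. \<Psi>0 n z (fst p) (snd p))
    Z Z' (\<lambda>i n z. prod_topology (disk n) (fib C (V i n z))) (\<lambda>i n z. prod_topology (bdry_sphere n) (fib C (V i n z)))
    (\<lambda>i n z p. \<Psi> i n z (fst p) (snd p))"
  proof (unfold_locales, rule cot)
    fix W assume W: "\<And>n z. z \<in> Z0 n \<Longrightarrow> openin (prod_topology (disk n) (fib C (V0 n z)))
        {p \<in> topspace (prod_topology (disk n) (fib C (V0 n z))). \<Psi>0 n z (fst p) (snd p) \<in> W}"
    let ?E0 = "{x \<in> topspace (total X). proj X x \<in> ?B 0}"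
    have "openin (total ?N0) (W \<inter> ?E0)"
    proof (rule openin_total_of_cells[OF B0 CW0 tr0])
      fix n z assume z: "z \<in> Z0 n"
      have "{p \<in> topspace (prod_topology (disk n) (fib C (V0 n z))). \<Psi>0 n z (fst p) (snd p) \<in> W \<inter> ?E0}
        = {p \<in> topspace (prod_topology (disk n) (fib C (V0 n z))). \<Psi>0 n z (fst p) (snd p) \<in> W}"
        using \<Psi>0in[OF z] by auto
      then show "openin (prod_topology (disk n) (fib C (V0 n z)))
          {p \<in> topspace (prod_topology (disk n) (fib C (V0 n z))). \<Psi>0 n z (fst p) (snd p) \<in> W \<inter> ?E0}"
        using W[OF z] by simp
    qed auto
    then show "openin (subtopology (total X) ?E0) (W \<inter> ?E0)" by simp
  next
    fix i :: nat and N n assume i: "1 \<le> i" and N: "N \<subseteq> topspace (total (M i))"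
    show "openin (total (M i)) N" if "\<And>n z. z \<in> Z i n \<Longrightarrow> openin (prod_topology (disk n) (fib C (V i n z)))
        {p \<in> topspace (prod_topology (disk n) (fib C (V i n z))). \<Psi> i n z (fst p) (snd p) \<in> N}"
      by (rule openin_total_of_cells[OF MB[OF i] CWM[OF i] tr[OF i] N that])
    show "openin (prod_topology (bdry_sphere n) (fib C (V i n y)))
        {p \<in> topspace (prod_topology (bdry_sphere n) (fib C (V i n y))). \<Psi> i n y (fst p) (snd p) \<in> N}"
      if "\<And>m z. m < n \<Longrightarrow> z \<in> Z i m \<Longrightarrow> openin (prod_topology (disk m) (fib C (V i m z)))
        {p \<in> topspace (prod_topology (disk m) (fib C (V i m z))). \<Psi> i m z (fst p) (snd p) \<in> N}" "y \<in> Z i n" for y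
      by (rule openin_bdry_of_cells[OF MB[OF i] CWM[OF i] tr[OF i] N that])
  next
    fix i n z assume i: "1 \<le> (i :: nat)"
    show "continuous_map (prod_topology (disk n) (fib C (V i n z))) (total (M i)) (\<lambda>p. \<Psi> i n z (fst p) (snd p))"
      and "topspace (prod_topology (bdry_sphere n) (fib C (V i n z))) \<subseteq> topspace (prod_topology (disk n) (fib C (V i n z)))"
      if "z \<in> Z i n"
      using tr[OF i that] bdry_sphere_subset_disk by (auto simp: trivialization_def)
    show "\<Psi> i n z (fst e) (snd e) \<in> {m \<in> topspace (total (M i)). proj (M i) m \<in> ?A i}"
      if "z \<in> Z' i n" "e \<in> topspace (prod_topology (disk n) (fib C (V i n z)))" for e
      using \<Psi>in[OF i Z'Z[OF i that(1)], of "fst e" "snd e"] \<Phi>A[OF i that(1), of "fst e"] that(2) by (auto simp: fibre_def)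
  qed (rule pot)

  interpret b: stratum_cells "base X" ?B "piece S" ?A "att S" "char_map S" Z0 "\<lambda>n z. disk n" "\<lambda>n z y. \<Phi>0 n (z, y)"
    Z Z' "\<lambda>i n z. disk n" "\<lambda>i n z. bdry_sphere n" "\<lambda>i n z y. \<Phi> i n (z, y)"
    by (rule strb)
  interpret t: stratum_cells "total X" "\<lambda>i. {x \<in> topspace (total X). proj X x \<in> ?B i}" "\<lambda>i. total (M i)"
    "\<lambda>i. {m \<in> topspace (total (M i)). proj (M i) m \<in> ?A i}" h k
    Z0 "\<lambda>n z. prod_topology (disk n) (fib C (V0 n z))" "\<lambda>n z p. \<Psi>0 n z (fst p) (snd p)"
    Z Z' "\<lambda>i n z. prod_topology (disk n) (fib C (V i n z))" "\<lambda>i n z. prod_topology (bdry_sphere n) (fib C (V i n z))"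
    "\<lambda>i n z p. \<Psi> i n z (fst p) (snd p)"
    by (rule strt)

  \<comment> \<open>The cell system of a stratified bundle\<close>
  \<comment> \<open>A cell is recorded by stratum, dimension and index, with \<open>Inl\<close> for
    stratum 0 and \<open>Inr\<close> for the pieces. Cells in \<open>Z' i n\<close> are left out:
    their points already belong to earlier stages.\<close>
  define J :: "(nat \<times> nat \<times> ('b + 'm)) set" where
    "J = {(0, n, Inl z) | n z. z \<in> Z0 n} \<union> {(i, n, Inr z) | i n z. i \<ge> 1 \<and> z \<in> Z i n \<and> z \<notin> Z' i n}"
  define lt :: "(nat \<times> nat \<times> ('b + 'm)) rel" where
    "lt = inv_image (less_than <*lex*> less_than) (\<lambda>j. (fst j, fst (snd j)))"
  define cc where "cc j y = (case j of (i, n, Inl z) \<Rightarrow> \<Phi>0 n (z, y) | (i, n, Inr z) \<Rightarrow> char_map S i (\<Phi> i n (z, y)))" for j y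
  define VV where "VV j = (case j of (i, n, Inl z) \<Rightarrow> V0 n z | (i, n, Inr z) \<Rightarrow> V i n z)" for j
  define PP where "PP j y v = (case j of (i, n, Inl z) \<Rightarrow> \<Psi>0 n z y v | (i, n, Inr z) \<Rightarrow> k i (\<Psi> i n z y v))" for j y v
  define dm where "dm j = fst (snd j)" for j :: "nat \<times> nat \<times> ('b + 'm)"
  have simps: "cc (i, n, Inl z) = (\<lambda>y. \<Phi>0 n (z, y))" "cc (i, n, Inr q) = (\<lambda>y. char_map S i (\<Phi> i n (q, y)))"
    "VV (i, n, Inl z) = V0 n z" "VV (i, n, Inr q) = V i n q"
    "PP (i, n, Inl z) = \<Psi>0 n z" "PP (i, n, Inr q) = (\<lambda>y v. k i (\<Psi> i n q y v))" "dm (i, n, w) = n"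
    for i n z q w
    by (simp_all add: cc_def VV_def PP_def dm_def fun_eq_iff)
  have lt_iff: "((i, n, s), (i', n', s')) \<in> lt \<longleftrightarrow> i < i' \<or> i = i' \<and> n < n'" for i n s i' n' s'
    by (auto simp: lt_def)
  have J_cases: thesis if "j \<in> J" "\<And>n z. j = (0, n, Inl z) \<Longrightarrow> z \<in> Z0 n \<Longrightarrow> thesis"
    "\<And>i n z. j = (i, n, Inr z) \<Longrightarrow> i \<ge> 1 \<Longrightarrow> z \<in> Z i n \<Longrightarrow> z \<notin> Z' i n \<Longrightarrow> thesis" for j thesis
    using that unfolding J_def by blast
  have J0: "(0, n, Inl z) \<in> J" if "z \<in> Z0 n" for n z using that by (auto simp: J_def)
  have Ji: "(i, n, Inr z) \<in> J" if "i \<ge> 1" "z \<in> Z i n" "z \<notin> Z' i n" for i n z using that by (auto simp: J_def)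
  \<comment> \<open>The bound on the stratum makes a point glued into stage \<open>i - 1\<close>
    comparable in the order with a cell of stratum \<open>i\<close>.\<close>
  have cover_stage: "\<exists>j\<in>J. fst j \<le> i \<and> b \<in> cc j ` open_disk (dm j)" if "b \<in> ?B i" for b i
    using that
  proof (induction i)
    case 0
    then have "b \<in> topspace (base ?N0)" using BX by auto
    then obtain n z y where "z \<in> Z0 n" "y \<in> open_disk n" "b = \<Phi>0 n (z, y)" using CW_cover[OF CW0] by blast
    then show ?case using J0 by (intro bexI[of _ "(0, n, Inl z)"]) (auto simp: simps)
  next
    case (Suc i)
    show ?case
    proof (cases "b \<in> ?B i")
      case True
      then show ?thesis using Suc.IH le_SucI by blast
    next
      case False
      have "b \<in> ?B (Suc i - 1) \<union> char_map S (Suc i) ` topspace (piece S (Suc i))"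
        using pobD(5)[of "Suc i"] Suc.prems BX by auto
      then obtain q where q: "q \<in> topspace (piece S (Suc i))" "b = char_map S (Suc i) q" using False by auto
      then have qA: "q \<notin> ?A (Suc i)" using charA[of "Suc i" q] False by auto
      obtain n z y where z: "z \<in> Z (Suc i) n" "y \<in> open_disk n" "q = \<Phi> (Suc i) n (z, y)"
        using CW_cover[OF CW q(1)] by auto
      have "z \<notin> Z' (Suc i) n" using \<Phi>A[of "Suc i" z n y] qA z open_disk_subset by auto
      then show ?thesis using Ji z q by (intro bexI[of _ "(Suc i, n, Inr z)"]) (auto simp: simps)
    qed
  qed
  have off: "cc (i, n, Inr z) y \<in> ?B i" "cc (i, n, Inr z) y \<notin> ?B (i - 1)"
    if "i \<ge> 1" "z \<in> Z i n" "z \<notin> Z' i n" "y \<in> open_disk n" for i n z y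
    using charB[OF that(1) \<Phi>Q[OF that(1,2) open_disk_subset[OF that(4)]]]
      char_nA[OF that(1) \<Phi>Q[OF that(1,2) open_disk_subset[OF that(4)]] \<Phi>nA[OF that]] by (auto simp: simps)

  interpret cell_system C X J lt dm VV cc PP
  proof unfold_locales
    show "F_family C X" by (rule X)
    show "wf lt" "trans lt" by (auto simp: lt_def intro!: trans_inv_image)
  next
    fix j assume j: "j \<in> J"
    show "VV j \<in> Obj C"
      using j by (rule J_cases) (use tr0 tr in \<open>auto simp: simps trivialization_def\<close>)
    show "continuous_map (disk (dm j)) (base X) (cc j)"
      using j
    proof (rule J_cases)
      fix n z assume "j = (0, n, Inl z)" "z \<in> Z0 n"
      then show ?thesis
        using CW_cell_continuous[OF CW0, of z n] by (simp add: simps continuous_map_in_subtopology)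
    next
      fix i n z assume a: "j = (i, n, Inr z)" "i \<ge> 1" "z \<in> Z i n"
      have "continuous_map (piece S i) (base X) (char_map S i)"
        using top_pushout_maps(2)[OF pob[OF a(2)]] by (simp add: continuous_map_in_subtopology)
      from continuous_map_compose[OF CW_cell_continuous[OF CW[OF a(2)] a(3)] this]
      show ?thesis by (simp add: a(1) simps comp_def)
    qed
    show "continuous_map (prod_topology (disk (dm j)) (fib C (VV j))) (total X) (\<lambda>p. PP j (fst p) (snd p))"
      using j
    proof (rule J_cases)
      fix n z assume a: "j = (0, n, Inl z)" "z \<in> Z0 n"
      have "continuous_map (prod_topology (disk n) (fib C (V0 n z))) (total ?N0) (\<lambda>p. \<Psi>0 n z (fst p) (snd p))"
        using tr0[OF a(2)] by (simp add: trivialization_def)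
      then show ?thesis by (simp add: a(1) simps continuous_map_in_subtopology)
    next
      fix i n z assume a: "j = (i, n, Inr z)" "i \<ge> 1" "z \<in> Z i n"
      have 1: "continuous_map (prod_topology (disk n) (fib C (V i n z))) (total (M i)) (\<lambda>p. \<Psi> i n z (fst p) (snd p))"
        using tr[OF a(2,3)] by (simp add: trivialization_def)
      have "continuous_map (total (M i)) (total X) (k i)"
        using kmap[OF a(2)] by (simp add: F_map_def continuous_map_in_subtopology)
      from continuous_map_compose[OF 1 this]
      show ?thesis by (simp add: a(1) simps comp_def)
    qed
    fix y
    show "fibre_param X (cc j y) (VV j) (PP j y)" if y: "y \<in> topspace (disk (dm j))"
      using j
    proof (rule J_cases)
      fix n z assume a: "j = (0, n, Inl z)" "z \<in> Z0 n"
      have yn: "y \<in> topspace (disk n)" using y a by (simp add: simps)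
      have "fibre_param ?N0 (\<Phi>0 n (z, y)) (V0 n z) (\<Psi>0 n z y)"
        using tr0[OF a(2)] yn by (simp add: trivialization_def)
      then show ?thesis using \<Phi>0B[OF a(2) yn] by (simp add: a(1) simps fibre_param_restrict)
    next
      fix i n z assume a: "j = (i, n, Inr z)" "i \<ge> 1" "z \<in> Z i n"
      have yn: "y \<in> topspace (disk n)" using y a by (simp add: simps)
      have "fibre_param (M i) (\<Phi> i n (z, y)) (V i n z) (\<Psi> i n z y)"
        using tr[OF a(2,3)] yn by (simp add: trivialization_def)
      from fibre_param_F_map[OF F_bundle_family[OF MB[OF a(2)]] kmap[OF a(2)] _ this]
      have "fibre_param (restrict_fam X (?B i)) (char_map S i (\<Phi> i n (z, y))) (V i n z) (\<lambda>v. k i (\<Psi> i n z y v))"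
        using \<Phi>Q[OF a(2,3) yn] bM[OF a(2)] by simp
      then show ?thesis using charB[OF a(2) \<Phi>Q[OF a(2,3) yn]]
        by (simp add: a(1) simps fibre_param_restrict)
    qed
    show "\<exists>i\<in>J. (i, j) \<in> lt \<and> cc j y \<in> cc i ` open_disk (dm i)" if y: "y \<in> topspace (bdry_sphere (dm j))"
      using j
    proof (rule J_cases)
      fix n z assume a: "j = (0, n, Inl z)" "z \<in> Z0 n"
      obtain m z' y' where m: "m < n" "z' \<in> Z0 m" "y' \<in> open_disk m" "\<Phi>0 n (z, y) = \<Phi>0 m (z', y')"
        using CW_bdry[OF CW0 a(2), of y] y by (auto simp: a(1) simps)
      then show ?thesis using J0 a
        by (intro bexI[of _ "(0, m, Inl z')"]) (auto simp: a(1) simps lt_iff)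
    next
      fix i n z assume a: "j = (i, n, Inr z)" "i \<ge> 1" "z \<in> Z i n"
      have yn: "y \<in> topspace (bdry_sphere n)" using y by (simp add: a(1) simps)
      obtain m z' y' where m: "m < n" "z' \<in> Z i m" "y' \<in> open_disk m" "\<Phi> i n (z, y) = \<Phi> i m (z', y')"
        using CW_bdry[OF CW[OF a(2)] a(3) yn] by blast
      show ?thesis
      proof (cases "z' \<in> Z' i m")
        case False
        then show ?thesis using m a Ji
          by (intro bexI[of _ "(i, m, Inr z')"]) (auto simp: a(1) simps lt_iff)
      next
        \<comment> \<open>The boundary point lies in the subcomplex and is glued into the stage
          below, so it falls into a cell of smaller stratum and of whatever dimension.\<close>
        case True
        then have "\<Phi> i n (z, y) \<in> ?A i" using \<Phi>A[OF a(2)] m open_disk_subset by auto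
        moreover have "\<Phi> i n (z, y) \<in> topspace (piece S i)"
          using \<Phi>Q[OF a(2,3)] yn bdry_sphere_subset_disk by blast
        ultimately have "cc j y \<in> ?B (i - 1)" using charA[OF a(2)] by (simp add: a(1) simps)
        then obtain j' where j': "j' \<in> J" "fst j' \<le> i - 1" "cc j y \<in> cc j' ` open_disk (dm j')"
          using cover_stage by blast
        moreover have "(j', j) \<in> lt" using j'(2) a(1,2) lt_iff[of "fst j'" "fst (snd j')" "snd (snd j')" i n "Inr z"] by auto
        ultimately show ?thesis by blast
      qed
    qed
    fix j' y' assume j': "j' \<in> J" and y: "y \<in> open_disk (dm j)" "y' \<in> open_disk (dm j')" and eq: "cc j y = cc j' y'"
    \<comment> \<open>An open cell of stratum \<open>i\<close> avoids stage \<open>i - 1\<close>,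
      which contains every open cell of smaller stratum; so only cells of the same stratum can share
      a point.\<close>
    have lower: "False" if "j1 \<in> J" "j2 = (i, n, Inr z)" "i \<ge> 1" "z \<in> Z i n" "z \<notin> Z' i n" "fst j1 < i"
      "y1 \<in> open_disk (dm j1)" "y2 \<in> open_disk (dm j2)" "cc j1 y1 = cc j2 y2" for j1 j2 y1 y2 i n z
    proof -
      have "cc j1 y1 \<in> ?B (fst j1)"
        using that(1) by (rule J_cases) (use that(7) \<Phi>0B open_disk_subset off in \<open>auto simp: simps\<close>)
      moreover have "?B (fst j1) \<subseteq> ?B (i - 1)" by (rule B_mono) (use that(6) in simp)
      ultimately have "cc j2 y2 \<in> ?B (i - 1)" using that(9) by auto
      then show False using off(2)[OF that(3-5), of y2] that(2,8) by (simp add: simps)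
    qed
    show "j = j' \<and> y = y'"
      using j
    proof (rule J_cases)
      fix n z assume a: "j = (0, n, Inl z)" "z \<in> Z0 n"
      show ?thesis
        using j'
      proof (rule J_cases)
        fix n' z' assume a': "j' = (0, n', Inl z')" "z' \<in> Z0 n'"
        then show ?thesis using CW_inj[OF CW0 a(2) _ a'(2), of y y'] y eq by (simp add: a(1) simps)
      next
        fix i n' z' assume "j' = (i, n', Inr z')" "i \<ge> 1" "z' \<in> Z i n'" "z' \<notin> Z' i n'"
        then show ?thesis using lower[OF j, of j' i n' z' y y'] y eq a(1) by simp
      qed
    next
      fix i n z assume a: "j = (i, n, Inr z)" "i \<ge> 1" "z \<in> Z i n" "z \<notin> Z' i n"
      show ?thesis
        using j'
      proof (rule J_cases)
        fix n' z' assume "j' = (0, n', Inl z')" "z' \<in> Z0 n'"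
        then show ?thesis using lower[OF j' a, of y' y] y eq a(2) by simp
      next
        fix i' n' z' assume a': "j' = (i', n', Inr z')" "i' \<ge> 1" "z' \<in> Z i' n'" "z' \<notin> Z' i' n'"
        have "\<not> i < i'" using lower[OF j a', of y y'] y eq a(1) by auto
        moreover have "\<not> i' < i" using lower[OF j' a, of y' y] y eq a'(1) by auto
        ultimately have ii: "i' = i" by simp
        have yn: "y \<in> open_disk n" "y' \<in> open_disk n'" using y a a' by (auto simp: simps)
        have a'': "z' \<in> Z i n'" "z' \<notin> Z' i n'" using a' ii by auto
        have "\<Phi> i n (z, y) = \<Phi> i n' (z', y')"
          by (rule char_inj[OF a(2)])
            (use \<Phi>Q[OF a(2,3) open_disk_subset[OF yn(1)]] \<Phi>Q[OF a(2) a''(1) open_disk_subset[OF yn(2)]]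
              \<Phi>nA[OF a(2,3,4) yn(1)] \<Phi>nA[OF a(2) a'' yn(2)] eq ii in \<open>simp_all add: a(1) a'(1) simps\<close>)
        then show ?thesis using CW_inj[OF CW[OF a(2)] a(3) yn(1) a''(1) yn(2)] a(1) a'(1) ii by simp
      qed
    qed
  next
    fix b assume "b \<in> topspace (base X)"
    then show "\<exists>j\<in>J. b \<in> cc j ` open_disk (dm j)" using cover_stage B_cover by blast
  next
    fix W assume W: "W \<subseteq> topspace (base X)" "\<And>j. j \<in> J \<Longrightarrow> openin (disk (dm j)) {y \<in> topspace (disk (dm j)). cc j y \<in> W}"
    show "openin (base X) W"
      by (rule b.openin_strata[OF W(1)]) (use W(2)[OF J0] W(2)[OF Ji] in \<open>simp_all add: simps\<close>)
  next
    fix W j assume j: "j \<in> J" and W: "W \<subseteq> topspace (base X)"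
      "\<And>i. i \<in> J \<Longrightarrow> (i, j) \<in> lt \<Longrightarrow> openin (disk (dm i)) {y \<in> topspace (disk (dm i)). cc i y \<in> W}"
    show "openin (bdry_sphere (dm j)) {y \<in> topspace (bdry_sphere (dm j)). cc j y \<in> W}"
      using j
    proof (rule J_cases)
      fix n z assume a: "j = (0, n, Inl z)" "z \<in> Z0 n"
      show ?thesis
        using CW_openin_bdry[OF CW0 _ a(2), of W] W(2)[OF J0] by (simp add: a(1) simps lt_iff)
    next
      fix i n z assume a: "j = (i, n, Inr z)" "i \<ge> 1" "z \<in> Z i n" "z \<notin> Z' i n"
      have "openin (bdry_sphere n) {y \<in> topspace (bdry_sphere n). char_map S i (\<Phi> i n (z, y)) \<in> W}"
        by (rule b.openin_stratum_attaching[OF a(2) _ _ _ a(3)])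
          (use W(2)[OF J0] W(2)[OF Ji] a(2) in \<open>simp_all add: a(1) simps lt_iff\<close>)
      then show ?thesis by (simp add: a(1) simps)
    qed
  next
    fix W assume W: "W \<subseteq> topspace (total X)"
      "\<And>j. j \<in> J \<Longrightarrow> openin (prod_topology (disk (dm j)) (fib C (VV j)))
         {p \<in> topspace (disk (dm j)) \<times> topspace (fib C (VV j)). PP j (fst p) (snd p) \<in> W}"
    show "openin (total X) W"
      by (rule t.openin_strata[OF W(1)]) (use W(2)[OF J0] W(2)[OF Ji] in \<open>simp_all add: simps\<close>)
  next
    fix W j assume j: "j \<in> J" and W: "W \<subseteq> topspace (total X)"
      "\<And>i. i \<in> J \<Longrightarrow> (i, j) \<in> lt \<Longrightarrow> openin (prod_topology (disk (dm i)) (fib C (VV i)))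
         {p \<in> topspace (disk (dm i)) \<times> topspace (fib C (VV i)). PP i (fst p) (snd p) \<in> W}"
    show "openin (prod_topology (bdry_sphere (dm j)) (fib C (VV j)))
        {p \<in> topspace (bdry_sphere (dm j)) \<times> topspace (fib C (VV j)). PP j (fst p) (snd p) \<in> W}"
      using j
    proof (rule J_cases)
      fix n z assume a: "j = (0, n, Inl z)" "z \<in> Z0 n"
      \<comment> \<open>\<open>openin_bdry_of_cells\<close> speaks of subsets of the total space
        over stage 0, so \<open>W\<close> is cut down to it; the cells of stage 0 map into that part
        anyway.\<close>
      let ?W = "W \<inter> topspace (total ?N0)"
      have e: "{p \<in> topspace (prod_topology (disk m) (fib C (V0 m z'))). \<Psi>0 m z' (fst p) (snd p) \<in> ?W}
        = {p \<in> topspace (prod_topology (disk m) (fib C (V0 m z'))). \<Psi>0 m z' (fst p) (snd p) \<in> W}" if "z' \<in> Z0 m" for m z'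
        using \<Psi>0in[OF that] by blast
      have "openin (prod_topology (bdry_sphere n) (fib C (V0 n z)))
          {p \<in> topspace (prod_topology (bdry_sphere n) (fib C (V0 n z))). \<Psi>0 n z (fst p) (snd p) \<in> ?W}"
      proof (rule openin_bdry_of_cells[OF B0 CW0 tr0 _ _ a(2)])
        fix m z' assume "m < n" "z' \<in> Z0 m"
        then show "openin (prod_topology (disk m) (fib C (V0 m z')))
            {p \<in> topspace (prod_topology (disk m) (fib C (V0 m z'))). \<Psi>0 m z' (fst p) (snd p) \<in> ?W}"
          using W(2)[OF J0, of z' m] unfolding e[OF \<open>z' \<in> Z0 m\<close>] by (simp add: a(1) simps lt_iff)
      qed auto
      moreover have "{p \<in> topspace (prod_topology (bdry_sphere n) (fib C (V0 n z))). \<Psi>0 n z (fst p) (snd p) \<in> ?W}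
        = {p \<in> topspace (prod_topology (bdry_sphere n) (fib C (V0 n z))). \<Psi>0 n z (fst p) (snd p) \<in> W}"
      proof -
        have "p \<in> topspace (prod_topology (disk n) (fib C (V0 n z)))"
          if "p \<in> topspace (prod_topology (bdry_sphere n) (fib C (V0 n z)))" for p
          using that bdry_sphere_subset_disk by auto
        then show ?thesis using \<Psi>0in[OF a(2)] by blast
      qed
      ultimately show ?thesis by (simp add: a(1) simps)
    next
      fix i n z assume a: "j = (i, n, Inr z)" "i \<ge> 1" "z \<in> Z i n" "z \<notin> Z' i n"
      have "openin (prod_topology (bdry_sphere n) (fib C (V i n z)))
        {p \<in> topspace (prod_topology (bdry_sphere n) (fib C (V i n z))). k i (\<Psi> i n z (fst p) (snd p)) \<in> W}"
        by (rule t.openin_stratum_attaching[OF a(2) _ _ _ a(3)])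
          (use W(2)[OF J0] W(2)[OF Ji] a(2) in \<open>simp_all add: a(1) simps lt_iff\<close>)
      then show ?thesis by (simp add: a(1) simps)
    qed
  qed
  show ?thesis by (rule F_bundle_cell_system)
qed

end

theorem mainTheorem2:
  fixes C :: "('o, 'a, 'f) structure_category"
  assumes "structure_category C" and "groupoid C"
  shows
    "(\<forall>(S :: ('b, 'm) stratification) (X :: ('x, 'b, 'o, 'f) family)
        (M :: nat \<Rightarrow> ('n, 'm, 'o, 'f) family) h k.
        F_stratified_fibre_bundle C S X M h k \<longrightarrow> F_bundle C X) \<and>
     (\<forall>(S :: ('b, 'm) stratification) (X :: ('x, 'b, 'o, 'f) family).
        stratified_space S \<and> F_bundle C X \<and> base X = whole S \<longrightarrow>
        (\<exists>(M :: nat \<Rightarrow> ('m \<times> 'x, 'm, 'o, 'f) family) h k.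
           F_stratified_fibre_bundle C S X M h k)) \<and>
     (\<forall>X :: ('x, 'b, 'o, 'f) family. F_complex C X \<longrightarrow> F_bundle C X) \<and>
     (\<forall>(X :: ('x, 'b, 'o, 'f) family) (Z :: nat \<Rightarrow> 'z set) \<Phi>.
        CW_complex (base X) Z \<Phi> \<and> F_bundle C X \<longrightarrow>
        (\<exists>Y :: ('x, 'b, 'o, 'f) family. F_complex C Y \<and> F_isomorphic C X Y))"
proof -
  interpret groupoid_structure C
    using assms by unfold_locales
  \<comment> \<open>In the last statement \<open>X\<close> itself turns out to be a complex, so the
    isomorphism is the identity.\<close>
  have "F_isomorphic C X X" if "F_bundle C X" for X :: "('x, 'b, 'o, 'f) family"
    unfolding F_isomorphic_def using F_map_id[OF F_bundle_family[OF that]] by blast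
  then have "\<exists>Y :: ('x, 'b, 'o, 'f) family. F_complex C Y \<and> F_isomorphic C X Y"
    if "CW_complex (base X) Z \<Phi>" "F_bundle C X"
    for X :: "('x, 'b, 'o, 'f) family" and Z :: "nat \<Rightarrow> 'z set" and \<Phi>
    using F_complex_of_F_bundle[OF that] that(2) by blast
  moreover have "\<exists>(M :: nat \<Rightarrow> ('m \<times> 'x, 'm, 'o, 'f) family) h k. F_stratified_fibre_bundle C S X M h k"
    if "stratified_space S" "F_bundle C X" "base X = whole S"
    for S :: "('b, 'm) stratification" and X :: "('x, 'b, 'o, 'f) family"
    using stratified_bundle_of_F_bundle[OF that] by blast
  ultimately show ?thesis
    using F_bundle_of_stratified_bundle F_bundle_of_F_complex by (intro conjI allI impI) blast+
qed

end
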